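(* Let $(\Omega,\Sigma,\mu)$ be a measure space with the direct sum property, let $\nabla$ be the set of idempotents of $L^\infty(\Omega)$, and let $X$ be a Hilbert--Kaplansky module over $L^\infty(\Omega)$. If $T$ is a self-adjoint cyclically compact operator on $X$, then there exist a partition of unity $\{\pi_0,\pi_1,\ldots,\pi_k,\ldots,\pi_\infty\}$ in $\nabla$ and, for every $k\in\{1,2,\ldots\}\cup\{\infty\}$, an orthonormal family $\{\xi_{k,n}\}_{n=1}^{k}$ in $\pi_kX$ and a family $\{f_{k,n}\}_{n=1}^{k}$ in $\pi_kL^\infty(\Omega)$ (for $k=\infty$ the index $n$ runs over all of $\{1,2,\ldots\}$) such that: (1) $\pi_0T=0$; (2) $\pi_\infty|f_{\infty,n}|\downarrow 0$ as $n\to\infty$; (3) the following representation is valid: $$T=\pi_\infty\sum_{n=1}^\infty f_{\infty,n}\,\xi_{\infty,n}\otimes\xi_{\infty,n}+\sum_{k=1}^\infty\pi_k\sum_{n=1}^kf_{k,n}\,\xi_{k,n}\otimes\xi_{k,n}.$$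
   Context: Direct sum property of $\mu$: there is a family $\{\Omega_i\}_{i\in J}\subset\Sigma$ with $0<\mu(\Omega_i)<+\infty$ such that for every $A\in\Sigma$ with $\mu(A)<+\infty$ there are a countable $J_0\subset J$ and a null set $B$ with $A=\bigcup_{i\in J_0}(A\cap\Omega_i)\cup B$. $L^\infty(\Omega)$ is the algebra of (classes of) bounded complex measurable functions on $\Omega$; $\nabla$ is the Boolean algebra of its idempotents. A partition of unity in $\nabla$ is a family $\{\pi_i\}$ in $\nabla$ with $\pi_i\pi_j=0$ for $i\ne j$ and $\bigvee_i\pi_i=\mathbf 1$ (members may be zero). Let $X$ be a unitary $L^\infty(\Omega)$-module. An $L^\infty(\Omega)$-valued inner product on $X$ is a map $\langle\cdot,\cdot\rangle:X\times X\to L^\infty(\Omega)$ such that $\langle\xi,\xi\rangle\ge0$, with $\langle\xi,\xi\rangle=0$ iff $\xi=0$; $\langle\xi,\eta\rangle=\overline{\langle\eta,\xi\rangle}$; $\langle a\xi,\eta\rangle=a\langle\xi,\eta\rangle$; $\langle\xi+\eta,\zeta\rangle=\langle\xi,\zeta\rangle+\langle\eta,\zeta\rangle$ for all $\xi,\eta,\zeta\in X$, $a\in L^\infty(\Omega)$. Put $\|\xi\|=\sqrt{\langle\xi,\xi\rangle}\in L^\infty(\Omega)$ (vector norm) and $\|\xi\|_\infty=\sqrt{\|\langle\xi,\xi\rangle\|_{L^\infty(\Omega)}}$. $X$ is a Hilbert--Kaplansky module over $L^\infty(\Omega)$ if it is complete for $\|\cdot\|_\infty$ and: (i) if $\xi\in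 X$ and $\{\pi_i\}$ is a partition of unity in $\nabla$ with $\pi_i\xi=0$ for all $i$, then $\xi=0$; (ii) for every norm-bounded family $\{\xi_i\}_{i\in I}$ in $X$ and every partition of unity $\{\pi_i\}_{i\in I}$ in $\nabla$ there is $\xi\in X$ (the mixing, written $\mathrm{mix}_{i}\,\pi_i\xi_i$) with $\pi_i\xi=\pi_i\xi_i$ for all $i$. For $C\subset X$, $\mathrm{mix}(C)$ is the set of all $\xi\in X$ for which there are a partition of unity $\{\pi_i\}_{i\in I}$ in $\nabla$ and elements $\xi_i\in C$ with $\pi_i\xi=\pi_i\xi_i$ for all $i$; $C$ is cyclic if $C=\mathrm{mix}(C)$. Let $\nabla(\mathbb N)$ be the set of partitions of unity $\nu:\mathbb N\to\nabla$ indexed by $\mathbb N$. For a bounded sequence $(\xi_n)$ in $X$ and $\nu\in\nabla(\mathbb N)$ put $\xi_\nu=\mathrm{mix}_{n}\,\nu(n)\xi_n$. A cyclic subsequence of $(\xi_n)$ is a sequence $(\xi_{\nu_j})_{j\in\mathbb N}$ with $\nu_j\in\nabla(\mathbb N)$ and, for all $j$ and all $m,n\in\mathbb N$, $\nu_j(m)\wedge\nu_{j+1}(n)\ne0$ implies $m<n$. A set $C\subset X$ is cyclically compact if it is cyclic and every sequence in $C$ has a cyclic subsequence converging in the norm $\|\cdot\|_\infty$ to an element of $C$; a set is relatively cyclically compact if it is contained in a cyclically compact set. An $L^\infty(\Omega)$-linear operator $T:X\to X$ is cyclically compact if $T(C)$ is relatively cyclically compact for every $\|\cdot\|_\infty$-bounded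 $C\subset X$. $T$ is self-adjoint if $\langle T\xi,\eta\rangle=\langle\xi,T\eta\rangle$ for all $\xi,\eta\in X$. For $\xi,\eta\in X$, $(\xi\otimes\eta)(\zeta)=\langle\zeta,\eta\rangle\xi$ for $\zeta\in X$. A family in $\pi_kX$ is orthonormal if $\langle\xi_{k,n},\xi_{k,m}\rangle=0$ for $n\ne m$ and $\langle\xi_{k,n},\xi_{k,n}\rangle=\pi_k$. The notation $g_n\downarrow0$ means that $(g_n)$ is a decreasing sequence in $L^\infty(\Omega)$ with infimum $0$. Infinite sums of operators are understood pointwise: for each $\zeta\in X$ the partial sums applied to $\zeta$ converge to $T\zeta$ in vector norm almost everywhere on $\Omega$ (order convergence of the vector norm of the difference to $0$); the outer sum over $k$ is a sum of components over the disjoint idempotents $\pi_k$. *)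

theory Defs
  imports "HOL-Analysis.Analysis" "HOL-Algebra.Module" "HOL-Algebra.QuotRing"
begin

section \<open>The algebra of classes of bounded measurable functions\<close>

text \<open>
  The family of the direct sum property is given as a set of measurable sets (a family indexed
  by itself). Its members are not required to be pairwise disjoint.
\<close>

definition direct_sum_property :: "'a measure \<Rightarrow> bool" where
  "direct_sum_property M \<longleftrightarrow>
     (\<exists>\<F>\<subseteq>sets M. (\<forall>U\<in>\<F>. 0 < emeasure M U \<and> emeasure M U < \<infinity>) \<and>
       (\<forall>A\<in>sets M. emeasure M A < \<infinity> \<longrightarrow>
         (\<exists>\<F>\<^sub>0\<subseteq>\<F>. countable \<F>\<^sub>0 \<and> (\<exists>B\<in>null_sets M. A = (\<Union>U\<in>\<F>\<^sub>0. A \<inter> U) \<union> B))))"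

definition bmeas_ring :: "'a measure \<Rightarrow> ('a \<Rightarrow> complex) ring" where
  "bmeas_ring M =
     \<lparr>carrier = {f \<in> borel_measurable M. bounded (f ` space M)},
      mult = (\<lambda>f g x. f x * g x), one = (\<lambda>x. 1),
      zero = (\<lambda>x. 0), add = (\<lambda>f g x. f x + g x)\<rparr>"

definition null_ideal :: "'a measure \<Rightarrow> ('a \<Rightarrow> complex) set" where
  "null_ideal M = {f \<in> carrier (bmeas_ring M). AE x in M. f x = 0}"

definition Linf :: "'a measure \<Rightarrow> ('a \<Rightarrow> complex) set ring" where
  "Linf M = bmeas_ring M Quot null_ideal M"

definition linf_class :: "'a measure \<Rightarrow> ('a \<Rightarrow> complex) \<Rightarrow> ('a \<Rightarrow> complex) set" where
  "linf_class M f = null_ideal M +>\<^bsub>bmeas_ring M\<^esub> f"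

lemma cring_bmeas_ring: "cring (bmeas_ring M)"
proof (rule cringI)
  have bm: "bounded ((\<lambda>x. f x * g x) ` S)" if b: "bounded (f ` S)" "bounded (g ` S)" for f g :: "'a \<Rightarrow> complex" and S
  proof -
    obtain A B where "\<forall>x\<in>S. norm (f x) \<le> A" "\<forall>x\<in>S. norm (g x) \<le> B"
      using b by (auto simp: bounded_iff)
    then have "\<forall>x\<in>S. norm (f x * g x) \<le> A * B"
      by (force simp: norm_mult intro!: mult_mono' )
    then show ?thesis by (auto simp: bounded_iff)
  qed
  show "abelian_group (bmeas_ring M)"
  proof (rule abelian_groupI)
    fix f assume "f \<in> carrier (bmeas_ring M)"
    then show "\<exists>g\<in>carrier (bmeas_ring M). g \<oplus>\<^bsub>bmeas_ring M\<^esub> f = \<zero>\<^bsub>bmeas_ring M\<^esub>"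
      by (intro bexI[of _ "\<lambda>x. - f x"]) (auto simp: bmeas_ring_def bounded_iff)
  qed (auto simp: bmeas_ring_def fun_eq_iff bounded_plus_comp bounded_iff[of "(\<lambda>x. 0) ` space M"])
  show "Group.comm_monoid (bmeas_ring M)"
    by (rule comm_monoidI) (auto simp: bmeas_ring_def fun_eq_iff bm bounded_iff[of "(\<lambda>x. 1) ` space M"])
qed (auto simp: bmeas_ring_def fun_eq_iff algebra_simps)

lemma ideal_null_ideal: "ideal (null_ideal M) (bmeas_ring M)"
proof -
  interpret cring "bmeas_ring M" by (rule cring_bmeas_ring)
  have neg: "(\<lambda>x. - f x) = \<ominus>\<^bsub>bmeas_ring M\<^esub> f" if "f \<in> carrier (bmeas_ring M)" for f
    using that by (intro minus_equality[symmetric]) (auto simp: bmeas_ring_def bounded_iff)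
  show ?thesis
  proof (rule idealI)
    show "ring (bmeas_ring M)" by (rule ring_axioms)
    show "subgroup (null_ideal M) (add_monoid (bmeas_ring M))"
    proof (rule add.subgroupI)
      show "null_ideal M \<subseteq> carrier (bmeas_ring M)" by (auto simp: null_ideal_def)
      have "\<zero>\<^bsub>bmeas_ring M\<^esub> \<in> null_ideal M" unfolding null_ideal_def using zero_closed by (simp add: bmeas_ring_def)
      then show "null_ideal M \<noteq> {}" by auto
    next
      fix a assume a: "a \<in> null_ideal M"
      then have c: "a \<in> carrier (bmeas_ring M)" by (auto simp: null_ideal_def)
      show "\<ominus>\<^bsub>bmeas_ring M\<^esub> a \<in> null_ideal M"
        using a a_inv_closed[OF c] unfolding neg[OF c, symmetric] by (auto simp: null_ideal_def)
    next
      fix a b assume a: "a \<in> null_ideal M" "b \<in> null_ideal M"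
      then have c: "a \<oplus>\<^bsub>bmeas_ring M\<^esub> b \<in> carrier (bmeas_ring M)" by (auto simp: null_ideal_def)
      have "AE x in M. a x + b x = 0" using a by (auto simp: null_ideal_def)
      then show "a \<oplus>\<^bsub>bmeas_ring M\<^esub> b \<in> null_ideal M" using c by (auto simp: null_ideal_def bmeas_ring_def)
    qed
  next
    fix a x assume a: "a \<in> null_ideal M" "x \<in> carrier (bmeas_ring M)"
    then have ac: "a \<in> carrier (bmeas_ring M)" "AE t in M. a t = 0" by (auto simp: null_ideal_def)
    have "AE t in M. x t * a t = 0" "AE t in M. a t * x t = 0" using ac by auto
    then show "x \<otimes>\<^bsub>bmeas_ring M\<^esub> a \<in> null_ideal M" "a \<otimes>\<^bsub>bmeas_ring M\<^esub> x \<in> null_ideal M"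
      using m_closed[OF ac(1) a(2)] m_closed[OF a(2) ac(1)] by (auto simp: null_ideal_def bmeas_ring_def)
  qed
qed

lemma cring_Linf: "cring (Linf M)"
  unfolding Linf_def by (rule ideal.quotient_is_cring[OF ideal_null_ideal cring_bmeas_ring])

lemma in_linf_class_iff:
  assumes "f \<in> carrier (bmeas_ring M)"
  shows "g \<in> linf_class M f \<longleftrightarrow> g \<in> carrier (bmeas_ring M) \<and> (AE x in M. g x = f x)"
proof
  assume "g \<in> linf_class M f"
  then obtain h where "h \<in> null_ideal M" "g = (\<lambda>x. h x + f x)"
    by (auto simp: linf_class_def a_r_coset_def' bmeas_ring_def)
  then show "g \<in> carrier (bmeas_ring M) \<and> (AE x in M. g x = f x)"
    using assms by (auto simp: null_ideal_def bmeas_ring_def bounded_plus_comp)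
next
  assume g: "g \<in> carrier (bmeas_ring M) \<and> (AE x in M. g x = f x)"
  have "(\<lambda>x. g x - f x) \<in> null_ideal M"
    using g assms by (auto simp: null_ideal_def bmeas_ring_def bounded_minus_comp)
  then show "g \<in> linf_class M f"
    unfolding linf_class_def a_r_coset_def'
    by (auto simp: bmeas_ring_def intro!: bexI[of _ "\<lambda>x. g x - f x"])
qed

lemma carrier_Linf: "carrier (Linf M) = linf_class M ` carrier (bmeas_ring M)"
  by (auto simp: Linf_def FactRing_def A_RCOSETS_def' linf_class_def)

text \<open>A representative of a class; everything below depends on it only up to null sets.\<close>

definition linf_rep :: "('a \<Rightarrow> complex) set \<Rightarrow> 'a \<Rightarrow> complex" where
  "linf_rep a = (SOME f. f \<in> a)"

definition linf_cnj :: "'a measure \<Rightarrow> ('a \<Rightarrow> complex) set \<Rightarrow> ('a \<Rightarrow> complex) set" where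
  "linf_cnj M a = linf_class M (\<lambda>x. cnj (linf_rep a x))"

definition linf_abs :: "'a measure \<Rightarrow> ('a \<Rightarrow> complex) set \<Rightarrow> ('a \<Rightarrow> complex) set" where
  "linf_abs M a = linf_class M (\<lambda>x. complex_of_real (cmod (linf_rep a x)))"

text \<open>Square root of a class, meant for classes \<open>\<ge> 0\<close>.\<close>

definition linf_sqrt :: "'a measure \<Rightarrow> ('a \<Rightarrow> complex) set \<Rightarrow> ('a \<Rightarrow> complex) set" where
  "linf_sqrt M a = linf_class M (\<lambda>x. complex_of_real (sqrt (Re (linf_rep a x))))"

text \<open>The essential supremum norm; it is \<open>0\<close> if the whole space is a null set.\<close>

definition linf_norm :: "'a measure \<Rightarrow> ('a \<Rightarrow> complex) set \<Rightarrow> real" where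
  "linf_norm M a = Inf {c. 0 \<le> c \<and> (AE x in M. cmod (linf_rep a x) \<le> c)}"

text \<open>\<open>a \<le> b\<close> means that \<open>b - a\<close> is real and nonnegative almost everywhere.\<close>

definition linf_le :: "'a measure \<Rightarrow> ('a \<Rightarrow> complex) set \<Rightarrow> ('a \<Rightarrow> complex) set \<Rightarrow> bool" where
  "linf_le M a b \<longleftrightarrow>
     (AE x in M. Re (linf_rep a x) \<le> Re (linf_rep b x) \<and> Im (linf_rep a x) = Im (linf_rep b x))"

definition Linf_order :: "'a measure \<Rightarrow> ('a \<Rightarrow> complex) set gorder" where
  "Linf_order M = \<lparr>carrier = carrier (Linf M), eq = (=), le = linf_le M\<rparr>"

definition decreases_to_zero :: "'a measure \<Rightarrow> (nat \<Rightarrow> ('a \<Rightarrow> complex) set) \<Rightarrow> bool" where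
  "decreases_to_zero M g \<longleftrightarrow>
     (\<forall>n. g n \<in> carrier (Linf M)) \<and> (\<forall>n. linf_le M (g (Suc n)) (g n)) \<and>
     greatest (Linf_order M) \<zero>\<^bsub>Linf M\<^esub> (Lower (Linf_order M) (range g))"

text \<open>
  Order convergence to \<open>0\<close> of a sequence of nonnegative classes. For sequences in the algebra
  of bounded classes this is convergence to \<open>0\<close> almost everywhere together with
  boundedness in the essential supremum norm.
\<close>

definition order_null :: "'a measure \<Rightarrow> (nat \<Rightarrow> ('a \<Rightarrow> complex) set) \<Rightarrow> bool" where
  "order_null M g \<longleftrightarrow> (\<exists>e. decreases_to_zero M e \<and> (\<forall>n. linf_le M (g n) (e n)))"

section \<open>Idempotents and partitions of unity\<close>

definition nabla :: "'a measure \<Rightarrow> ('a \<Rightarrow> complex) set gorder" where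
  "nabla M = \<lparr>carrier = {p \<in> carrier (Linf M). p \<otimes>\<^bsub>Linf M\<^esub> p = p}, eq = (=), le = linf_le M\<rparr>"

definition partition_of_unity ::
    "'a measure \<Rightarrow> 'i set \<Rightarrow> ('i \<Rightarrow> ('a \<Rightarrow> complex) set) \<Rightarrow> bool" where
  "partition_of_unity M I \<pi> \<longleftrightarrow>
     (\<forall>i\<in>I. \<pi> i \<in> carrier (nabla M)) \<and>
     (\<forall>i\<in>I. \<forall>j\<in>I. i \<noteq> j \<longrightarrow> \<pi> i \<otimes>\<^bsub>Linf M\<^esub> \<pi> j = \<zero>\<^bsub>Linf M\<^esub>) \<and>
     least (nabla M) \<one>\<^bsub>Linf M\<^esub> (Upper (nabla M) (\<pi> ` I))"

section \<open>Hilbert--Kaplansky modules\<close>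

definition vec_norm ::
    "'a measure \<Rightarrow> ('x \<Rightarrow> 'x \<Rightarrow> ('a \<Rightarrow> complex) set) \<Rightarrow> 'x \<Rightarrow> ('a \<Rightarrow> complex) set" where
  "vec_norm M ip \<xi> = linf_sqrt M (ip \<xi> \<xi>)"

definition norm_inf ::
    "'a measure \<Rightarrow> ('x \<Rightarrow> 'x \<Rightarrow> ('a \<Rightarrow> complex) set) \<Rightarrow> 'x \<Rightarrow> real" where
  "norm_inf M ip \<xi> = sqrt (linf_norm M (ip \<xi> \<xi>))"

definition norm_converges ::
    "'a measure \<Rightarrow> (('a \<Rightarrow> complex) set, 'x, 'm) module_scheme \<Rightarrow>
     ('x \<Rightarrow> 'x \<Rightarrow> ('a \<Rightarrow> complex) set) \<Rightarrow> (nat \<Rightarrow> 'x) \<Rightarrow> 'x \<Rightarrow> bool" where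
  "norm_converges M X ip \<xi> \<eta> \<longleftrightarrow> (\<lambda>n. norm_inf M ip (\<xi> n \<ominus>\<^bsub>X\<^esub> \<eta>)) \<longlonglongrightarrow> 0"

definition norm_Cauchy ::
    "'a measure \<Rightarrow> (('a \<Rightarrow> complex) set, 'x, 'm) module_scheme \<Rightarrow>
     ('x \<Rightarrow> 'x \<Rightarrow> ('a \<Rightarrow> complex) set) \<Rightarrow> (nat \<Rightarrow> 'x) \<Rightarrow> bool" where
  "norm_Cauchy M X ip \<xi> \<longleftrightarrow>
     (\<forall>e>0. \<exists>N. \<forall>m\<ge>N. \<forall>n\<ge>N. norm_inf M ip (\<xi> m \<ominus>\<^bsub>X\<^esub> \<xi> n) < e)"

definition norm_bounded ::
    "'a measure \<Rightarrow> ('x \<Rightarrow> 'x \<Rightarrow> ('a \<Rightarrow> complex) set) \<Rightarrow> 'x set \<Rightarrow> bool" where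
  "norm_bounded M ip C \<longleftrightarrow> (\<exists>K. \<forall>\<xi>\<in>C. norm_inf M ip \<xi> \<le> K)"

definition is_mixing ::
    "(('a \<Rightarrow> complex) set, 'x, 'm) module_scheme \<Rightarrow> 'i set \<Rightarrow>
     ('i \<Rightarrow> ('a \<Rightarrow> complex) set) \<Rightarrow> ('i \<Rightarrow> 'x) \<Rightarrow> 'x \<Rightarrow> bool" where
  "is_mixing X I \<pi> \<xi> \<eta> \<longleftrightarrow> \<eta> \<in> carrier X \<and> (\<forall>i\<in>I. \<pi> i \<odot>\<^bsub>X\<^esub> \<eta> = \<pi> i \<odot>\<^bsub>X\<^esub> \<xi> i)"

text \<open>
  Families indexed by an arbitrary set are indexed here by a set \<open>I\<close> of elements of the type
  of classes. This is no restriction: the nonzero members of a partition of unity are pairwise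
  distinct, so they can be indexed by themselves, and zero members impose no condition.
\<close>

locale Hilbert_Kaplansky_module = module "Linf M" X
  for M :: "'a measure" and X :: "(('a \<Rightarrow> complex) set, 'x, 'm) module_scheme" +
  fixes ip :: "'x \<Rightarrow> 'x \<Rightarrow> ('a \<Rightarrow> complex) set"
  assumes ip_closed:
      "\<And>\<xi> \<eta>. \<xi> \<in> carrier X \<Longrightarrow> \<eta> \<in> carrier X \<Longrightarrow> ip \<xi> \<eta> \<in> carrier (Linf M)"
    and ip_nonneg: "\<And>\<xi>. \<xi> \<in> carrier X \<Longrightarrow> linf_le M \<zero>\<^bsub>Linf M\<^esub> (ip \<xi> \<xi>)"
    and ip_eq_zero: "\<And>\<xi>. \<xi> \<in> carrier X \<Longrightarrow> ip \<xi> \<xi> = \<zero>\<^bsub>Linf M\<^esub> \<longleftrightarrow> \<xi> = \<zero>\<^bsub>X\<^esub>"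
    and ip_cnj:
      "\<And>\<xi> \<eta>. \<xi> \<in> carrier X \<Longrightarrow> \<eta> \<in> carrier X \<Longrightarrow> ip \<xi> \<eta> = linf_cnj M (ip \<eta> \<xi>)"
    and ip_smult:
      "\<And>a \<xi> \<eta>. a \<in> carrier (Linf M) \<Longrightarrow> \<xi> \<in> carrier X \<Longrightarrow> \<eta> \<in> carrier X \<Longrightarrow>
        ip (a \<odot>\<^bsub>X\<^esub> \<xi>) \<eta> = a \<otimes>\<^bsub>Linf M\<^esub> ip \<xi> \<eta>"
    and ip_add:
      "\<And>\<xi> \<eta> \<zeta>. \<xi> \<in> carrier X \<Longrightarrow> \<eta> \<in> carrier X \<Longrightarrow> \<zeta> \<in> carrier X \<Longrightarrow>
        ip (\<xi> \<oplus>\<^bsub>X\<^esub> \<eta>) \<zeta> = ip \<xi> \<zeta> \<oplus>\<^bsub>Linf M\<^esub> ip \<eta> \<zeta>"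
    and complete:
      "\<And>\<xi>. range \<xi> \<subseteq> carrier X \<Longrightarrow> norm_Cauchy M X ip \<xi> \<Longrightarrow>
        \<exists>\<eta>\<in>carrier X. norm_converges M X ip \<xi> \<eta>"
    and separated:
      "\<And>(I :: ('a \<Rightarrow> complex) set set) \<pi> \<xi>. partition_of_unity M I \<pi> \<Longrightarrow> \<xi> \<in> carrier X \<Longrightarrow>
        (\<forall>i\<in>I. \<pi> i \<odot>\<^bsub>X\<^esub> \<xi> = \<zero>\<^bsub>X\<^esub>) \<Longrightarrow> \<xi> = \<zero>\<^bsub>X\<^esub>"
    and mixing_ex:
      "\<And>(I :: ('a \<Rightarrow> complex) set set) \<pi> \<xi>. partition_of_unity M I \<pi> \<Longrightarrow> \<xi> ` I \<subseteq> carrier X \<Longrightarrow>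
        norm_bounded M ip (\<xi> ` I) \<Longrightarrow> \<exists>\<eta>. is_mixing X I \<pi> \<xi> \<eta>"

section \<open>Cyclical compactness\<close>

definition mix ::
    "'a measure \<Rightarrow> (('a \<Rightarrow> complex) set, 'x, 'm) module_scheme \<Rightarrow> 'x set \<Rightarrow> 'x set" where
  "mix M X C =
     {\<eta>. \<exists>(I :: ('a \<Rightarrow> complex) set set) \<pi> \<xi>.
        partition_of_unity M I \<pi> \<and> \<xi> ` I \<subseteq> C \<and> is_mixing X I \<pi> \<xi> \<eta>}"

definition cyclic ::
    "'a measure \<Rightarrow> (('a \<Rightarrow> complex) set, 'x, 'm) module_scheme \<Rightarrow> 'x set \<Rightarrow> bool" where
  "cyclic M X C \<longleftrightarrow> C \<subseteq> carrier X \<and> C = mix M X C"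

text \<open>
  The meet of two idempotents is their product. Mixings are unique by \<open>separated\<close>, so
  \<open>is_mixing\<close> determines the members of a cyclic subsequence. Cyclic subsequences are formed
  for bounded sequences only.
\<close>

definition cyclic_subseq ::
    "'a measure \<Rightarrow> (('a \<Rightarrow> complex) set, 'x, 'm) module_scheme \<Rightarrow>
     ('x \<Rightarrow> 'x \<Rightarrow> ('a \<Rightarrow> complex) set) \<Rightarrow> (nat \<Rightarrow> 'x) \<Rightarrow> (nat \<Rightarrow> 'x) \<Rightarrow> bool" where
  "cyclic_subseq M X ip \<xi> \<eta> \<longleftrightarrow>
     norm_bounded M ip (range \<xi>) \<and>
     (\<exists>\<nu> :: nat \<Rightarrow> nat \<Rightarrow> ('a \<Rightarrow> complex) set.
        (\<forall>j. partition_of_unity M UNIV (\<nu> j)) \<and>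
        (\<forall>j m n. \<nu> j m \<otimes>\<^bsub>Linf M\<^esub> \<nu> (Suc j) n \<noteq> \<zero>\<^bsub>Linf M\<^esub> \<longrightarrow> m < n) \<and>
        (\<forall>j. is_mixing X UNIV (\<nu> j) \<xi> (\<eta> j)))"

definition cyclically_compact ::
    "'a measure \<Rightarrow> (('a \<Rightarrow> complex) set, 'x, 'm) module_scheme \<Rightarrow>
     ('x \<Rightarrow> 'x \<Rightarrow> ('a \<Rightarrow> complex) set) \<Rightarrow> 'x set \<Rightarrow> bool" where
  "cyclically_compact M X ip C \<longleftrightarrow>
     cyclic M X C \<and>
     (\<forall>\<xi>. range \<xi> \<subseteq> C \<longrightarrow>
        (\<exists>\<eta>. cyclic_subseq M X ip \<xi> \<eta> \<and> (\<exists>\<zeta>\<in>C. norm_converges M X ip \<eta> \<zeta>)))"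

definition relatively_cyclically_compact ::
    "'a measure \<Rightarrow> (('a \<Rightarrow> complex) set, 'x, 'm) module_scheme \<Rightarrow>
     ('x \<Rightarrow> 'x \<Rightarrow> ('a \<Rightarrow> complex) set) \<Rightarrow> 'x set \<Rightarrow> bool" where
  "relatively_cyclically_compact M X ip C \<longleftrightarrow> (\<exists>D. cyclically_compact M X ip D \<and> C \<subseteq> D)"

definition Linf_linear ::
    "'a measure \<Rightarrow> (('a \<Rightarrow> complex) set, 'x, 'm) module_scheme \<Rightarrow> ('x \<Rightarrow> 'x) \<Rightarrow> bool" where
  "Linf_linear M X T \<longleftrightarrow>
     T \<in> carrier X \<rightarrow> carrier X \<and>
     (\<forall>\<xi>\<in>carrier X. \<forall>\<eta>\<in>carrier X. T (\<xi> \<oplus>\<^bsub>X\<^esub> \<eta>) = T \<xi> \<oplus>\<^bsub>X\<^esub> T \<eta>) \<and>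
     (\<forall>a\<in>carrier (Linf M). \<forall>\<xi>\<in>carrier X. T (a \<odot>\<^bsub>X\<^esub> \<xi>) = a \<odot>\<^bsub>X\<^esub> T \<xi>)"

definition cyclically_compact_operator ::
    "'a measure \<Rightarrow> (('a \<Rightarrow> complex) set, 'x, 'm) module_scheme \<Rightarrow>
     ('x \<Rightarrow> 'x \<Rightarrow> ('a \<Rightarrow> complex) set) \<Rightarrow> ('x \<Rightarrow> 'x) \<Rightarrow> bool" where
  "cyclically_compact_operator M X ip T \<longleftrightarrow>
     Linf_linear M X T \<and>
     (\<forall>C\<subseteq>carrier X. norm_bounded M ip C \<longrightarrow> relatively_cyclically_compact M X ip (T ` C))"

definition self_adjoint ::
    "(('a \<Rightarrow> complex) set, 'x, 'm) module_scheme \<Rightarrow>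
     ('x \<Rightarrow> 'x \<Rightarrow> ('a \<Rightarrow> complex) set) \<Rightarrow> ('x \<Rightarrow> 'x) \<Rightarrow> bool" where
  "self_adjoint X ip T \<longleftrightarrow> (\<forall>\<xi>\<in>carrier X. \<forall>\<eta>\<in>carrier X. ip (T \<xi>) \<eta> = ip \<xi> (T \<eta>))"

section \<open>Orthonormal families and series\<close>

definition rank_one ::
    "(('a \<Rightarrow> complex) set, 'x, 'm) module_scheme \<Rightarrow>
     ('x \<Rightarrow> 'x \<Rightarrow> ('a \<Rightarrow> complex) set) \<Rightarrow> 'x \<Rightarrow> 'x \<Rightarrow> 'x \<Rightarrow> 'x" where
  "rank_one X ip \<xi> \<eta> \<zeta> = ip \<zeta> \<eta> \<odot>\<^bsub>X\<^esub> \<xi>"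

text \<open>Orthonormal families in \<open>pX\<close>, for an idempotent \<open>p\<close>.\<close>

definition orthonormal_family ::
    "'a measure \<Rightarrow> (('a \<Rightarrow> complex) set, 'x, 'm) module_scheme \<Rightarrow>
     ('x \<Rightarrow> 'x \<Rightarrow> ('a \<Rightarrow> complex) set) \<Rightarrow> ('a \<Rightarrow> complex) set \<Rightarrow> 'i set \<Rightarrow> ('i \<Rightarrow> 'x) \<Rightarrow> bool" where
  "orthonormal_family M X ip p A \<xi> \<longleftrightarrow>
     (\<forall>n\<in>A. \<xi> n \<in> (\<lambda>\<eta>. p \<odot>\<^bsub>X\<^esub> \<eta>) ` carrier X) \<and>
     (\<forall>n\<in>A. \<forall>m\<in>A. n \<noteq> m \<longrightarrow> ip (\<xi> n) (\<xi> m) = \<zero>\<^bsub>Linf M\<^esub>) \<and>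
     (\<forall>n\<in>A. ip (\<xi> n) (\<xi> n) = p)"

text \<open>Convergence in vector norm of the series of the \<open>s n\<close> over \<open>n \<ge> 1\<close>.\<close>

definition vec_sums ::
    "'a measure \<Rightarrow> (('a \<Rightarrow> complex) set, 'x, 'm) module_scheme \<Rightarrow>
     ('x \<Rightarrow> 'x \<Rightarrow> ('a \<Rightarrow> complex) set) \<Rightarrow> (nat \<Rightarrow> 'x) \<Rightarrow> 'x \<Rightarrow> bool" where
  "vec_sums M X ip s \<eta> \<longleftrightarrow>
     order_null M (\<lambda>N. vec_norm M ip ((\<Oplus>\<^bsub>X\<^esub>n\<in>{1..N}. s n) \<ominus>\<^bsub>X\<^esub> \<eta>))"

end

theory Submission
  imports Defs
begin

text \<open>
  Identities and inequalities are read pointwise almost everywhere. The supremum \<open>m\<close> of \<open>|T \<zeta>|\<close> over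
  the unit ball is approached uniformly by a sequence in the unit ball, obtained
  by an exhaustion argument and mixing. Cyclic compactness turns it into a vector \<open>\<omega>\<close> with
  \<open>T\<^sup>2 \<omega> = m\<^sup>2 \<omega>\<close> and \<open>|\<omega>| = m\<close>, and \<open>(T - m)(T + m) \<omega> = 0\<close> yields an eigenvector with eigenvalue
  \<open>\<lambda>\<close>, \<open>|\<lambda>| = m\<close>, normalised on the support of \<open>\<lambda>\<close>. Deflating \<open>T\<close> by it and iterating gives an
  orthogonal sequence \<open>\<xi>\<^sub>n\<close> with decreasing \<open>|\<lambda>\<^sub>n|\<close>, which tends to \<open>0\<close> by cyclic compactness; the
  \<open>n\<close>-th remainder of \<open>T\<close> is bounded by \<open>|\<lambda>\<^sub>n|\<close>. The idempotent \<open>\<pi>\<^sub>k\<close> is the set where exactly the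
  first \<open>k\<close> eigenvalues are nonzero.
\<close>

section \<open>Representatives of classes\<close>

text \<open>A vector of X has no values at points, since X is not given as a field of Hilbert
  spaces. Only inner products and norms are functions, each up to a null set that depends on the
  vectors involved, and uncountably many null sets cannot be united; the measure need not be
  sigma-finite. This decides the form of the arguments: vector identities are tested against one
  vector at a time, suprema run over sequences, and arbitrary partitions of unity are handled
  through the Boolean algebra instead of a covering by sets. The inverse of a norm may be unbounded,
  so division is replaced by multiplication or by mixing. The operator need not be positive, so
  maximising |T \<zeta>| leads to T^2 first; the sign of the eigenvalue is recovered afterwards and
  may vary from point to point. A vector of norm one need not exist where the remaining operator
  vanishes. Eigenvectors are therefore zero exactly where their eigenvalues are, the iteration never
  stops, and the distinction by the number k of terms is made only after it.\<close>

lemma bmeas_carrier_iff: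
  "f \<in> carrier (bmeas_ring M) \<longleftrightarrow> f \<in> borel_measurable M \<and> (\<exists>K. \<forall>x\<in>space M. cmod (f x) \<le> K)"
  by (auto simp: bmeas_ring_def bounded_iff)

lemma bmeas_carrierI:
  assumes "f \<in> borel_measurable M" "\<And>x. x \<in> space M \<Longrightarrow> cmod (f x) \<le> K"
  shows "f \<in> carrier (bmeas_ring M)"
  using assms by (auto simp: bmeas_carrier_iff)

lemma bmeas_measurable: "f \<in> carrier (bmeas_ring M) \<Longrightarrow> f \<in> borel_measurable M"
  by (simp add: bmeas_carrier_iff)

lemma linf_class_closed: "f \<in> carrier (bmeas_ring M) \<Longrightarrow> linf_class M f \<in> carrier (Linf M)"
  by (simp add: carrier_Linf)

lemma linf_rep_in:
  assumes "a \<in> carrier (Linf M)"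
  shows "linf_rep a \<in> a"
proof -
  from assms obtain f where "f \<in> carrier (bmeas_ring M)" "a = linf_class M f" by (auto simp: carrier_Linf)
  then have "f \<in> a" by (simp add: in_linf_class_iff)
  then show ?thesis unfolding linf_rep_def by (rule someI[where P = "\<lambda>f. f \<in> a"])
qed

lemma linf_rep_bmeas: "a \<in> carrier (Linf M) \<Longrightarrow> linf_rep a \<in> carrier (bmeas_ring M)"
  using linf_rep_in[of a M] by (auto simp: carrier_Linf in_linf_class_iff)

lemma linf_rep_measurable [measurable]: "a \<in> carrier (Linf M) \<Longrightarrow> linf_rep a \<in> borel_measurable M"
  by (simp add: bmeas_measurable linf_rep_bmeas)

lemma linf_rep_class:
  assumes "f \<in> carrier (bmeas_ring M)"
  shows "AE x in M. linf_rep (linf_class M f) x = f x"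
  using linf_rep_in[OF linf_class_closed[OF assms]] assms by (simp add: in_linf_class_iff)

lemma linf_class_eqI:
  assumes "f \<in> carrier (bmeas_ring M)" "g \<in> carrier (bmeas_ring M)" "AE x in M. f x = g x"
  shows "linf_class M f = linf_class M g"
proof (rule Set.set_eqI)
  fix h
  have "(AE x in M. h x = f x) \<longleftrightarrow> (AE x in M. h x = g x)"
    using assms(3) by (auto elim: AE_mp)
  then show "h \<in> linf_class M f \<longleftrightarrow> h \<in> linf_class M g"
    using assms by (simp add: in_linf_class_iff)
qed

lemma linf_class_rep:
  assumes "a \<in> carrier (Linf M)"
  shows "linf_class M (linf_rep a) = a"
proof -
  obtain f where f: "f \<in> carrier (bmeas_ring M)" "a = linf_class M f"
    using assms by (auto simp: carrier_Linf)
  show ?thesis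
    using linf_class_eqI[OF linf_rep_bmeas[OF assms] f(1)] linf_rep_class[OF f(1)] f(2) by auto
qed

lemma linf_eqI:
  assumes "a \<in> carrier (Linf M)" "b \<in> carrier (Linf M)" "AE x in M. linf_rep a x = linf_rep b x"
  shows "a = b"
  using linf_class_eqI[OF linf_rep_bmeas linf_rep_bmeas] assms linf_class_rep by metis

lemma linf_rep_bounded:
  assumes "a \<in> carrier (Linf M)"
  obtains K where "0 \<le> K" "\<And>x. x \<in> space M \<Longrightarrow> cmod (linf_rep a x) \<le> K"
proof -
  obtain K where "\<forall>x\<in>space M. cmod (linf_rep a x) \<le> K"
    using linf_rep_bmeas[OF assms] by (auto simp: bmeas_carrier_iff)
  then show thesis by (intro that[of "max K 0"]) (auto intro: order_trans)
qed

lemma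
  shows linf_class_mult: "f \<in> carrier (bmeas_ring M) \<Longrightarrow> g \<in> carrier (bmeas_ring M) \<Longrightarrow>
           linf_class M f \<otimes>\<^bsub>Linf M\<^esub> linf_class M g = linf_class M (\<lambda>x. f x * g x)"
    and linf_class_add: "f \<in> carrier (bmeas_ring M) \<Longrightarrow> g \<in> carrier (bmeas_ring M) \<Longrightarrow>
           linf_class M f \<oplus>\<^bsub>Linf M\<^esub> linf_class M g = linf_class M (\<lambda>x. f x + g x)"
    and linf_class_one: "\<one>\<^bsub>Linf M\<^esub> = linf_class M (\<lambda>x. 1)"
    and linf_class_zero: "\<zero>\<^bsub>Linf M\<^esub> = linf_class M (\<lambda>x. 0)"
proof -
  have ops: "f \<otimes>\<^bsub>bmeas_ring M\<^esub> g = (\<lambda>x. f x * g x)" "f \<oplus>\<^bsub>bmeas_ring M\<^esub> g = (\<lambda>x. f x + g x)"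
    "\<one>\<^bsub>bmeas_ring M\<^esub> = (\<lambda>x. 1)" "\<zero>\<^bsub>bmeas_ring M\<^esub> = (\<lambda>x. 0)" for f g :: "'a \<Rightarrow> complex"
    by (simp_all add: bmeas_ring_def)
  note h = ideal.rcos_ring_hom[OF ideal_null_ideal[of M], folded Linf_def linf_class_def]
  show "f \<in> carrier (bmeas_ring M) \<Longrightarrow> g \<in> carrier (bmeas_ring M) \<Longrightarrow>
      linf_class M f \<otimes>\<^bsub>Linf M\<^esub> linf_class M g = linf_class M (\<lambda>x. f x * g x)"
    "f \<in> carrier (bmeas_ring M) \<Longrightarrow> g \<in> carrier (bmeas_ring M) \<Longrightarrow>
      linf_class M f \<oplus>\<^bsub>Linf M\<^esub> linf_class M g = linf_class M (\<lambda>x. f x + g x)"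
    "\<one>\<^bsub>Linf M\<^esub> = linf_class M (\<lambda>x. 1)"
    using ring_hom_mult[OF h, of f g] ring_hom_add[OF h, of f g] ring_hom_one[OF h] by (simp_all add: ops linf_class_def)
  from ring_hom_zero[OF h] show "\<zero>\<^bsub>Linf M\<^esub> = linf_class M (\<lambda>x. 0)"
    using cring_Linf[of M] cring_bmeas_ring[of M] by (simp add: cring_def ops linf_class_def)
qed

lemma linf_zero_closed [simp]: "\<zero>\<^bsub>Linf M\<^esub> \<in> carrier (Linf M)"
  and linf_one_closed [simp]: "\<one>\<^bsub>Linf M\<^esub> \<in> carrier (Linf M)"
  and linf_mult_closed [simp]: "a \<in> carrier (Linf M) \<Longrightarrow> b \<in> carrier (Linf M) \<Longrightarrow> a \<otimes>\<^bsub>Linf M\<^esub> b \<in> carrier (Linf M)"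
  and linf_add_closed [simp]: "a \<in> carrier (Linf M) \<Longrightarrow> b \<in> carrier (Linf M) \<Longrightarrow> a \<oplus>\<^bsub>Linf M\<^esub> b \<in> carrier (Linf M)"
proof -
  interpret cring "Linf M" by (rule cring_Linf)
  show "\<zero>\<^bsub>Linf M\<^esub> \<in> carrier (Linf M)" "\<one>\<^bsub>Linf M\<^esub> \<in> carrier (Linf M)"
    "a \<in> carrier (Linf M) \<Longrightarrow> b \<in> carrier (Linf M) \<Longrightarrow> a \<otimes>\<^bsub>Linf M\<^esub> b \<in> carrier (Linf M)"
    "a \<in> carrier (Linf M) \<Longrightarrow> b \<in> carrier (Linf M) \<Longrightarrow> a \<oplus>\<^bsub>Linf M\<^esub> b \<in> carrier (Linf M)" by auto
qed

lemma bmeas_mult: "f \<in> carrier (bmeas_ring M) \<Longrightarrow> g \<in> carrier (bmeas_ring M) \<Longrightarrow> (\<lambda>x. f x * g x) \<in> carrier (bmeas_ring M)"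
  and bmeas_add: "f \<in> carrier (bmeas_ring M) \<Longrightarrow> g \<in> carrier (bmeas_ring M) \<Longrightarrow> (\<lambda>x. f x + g x) \<in> carrier (bmeas_ring M)"
proof -
  interpret B: cring "bmeas_ring M" by (rule cring_bmeas_ring)
  show "f \<in> carrier (bmeas_ring M) \<Longrightarrow> g \<in> carrier (bmeas_ring M) \<Longrightarrow> (\<lambda>x. f x * g x) \<in> carrier (bmeas_ring M)"
    using B.m_closed[of f g] by (simp add: bmeas_ring_def)
  show "f \<in> carrier (bmeas_ring M) \<Longrightarrow> g \<in> carrier (bmeas_ring M) \<Longrightarrow> (\<lambda>x. f x + g x) \<in> carrier (bmeas_ring M)"
    using B.a_closed[of f g] by (simp add: bmeas_ring_def)
qed

text \<open>The chosen representatives are not multiplicative everywhere; the exceptional null set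
  depends on a and b.\<close>

lemma linf_rep_mult:
  assumes "a \<in> carrier (Linf M)" "b \<in> carrier (Linf M)"
  shows "AE x in M. linf_rep (a \<otimes>\<^bsub>Linf M\<^esub> b) x = linf_rep a x * linf_rep b x"
  using linf_rep_class[OF bmeas_mult[OF linf_rep_bmeas linf_rep_bmeas], OF assms]
    linf_class_mult[OF linf_rep_bmeas linf_rep_bmeas, OF assms] assms by (simp add: linf_class_rep)

lemma linf_rep_add:
  assumes "a \<in> carrier (Linf M)" "b \<in> carrier (Linf M)"
  shows "AE x in M. linf_rep (a \<oplus>\<^bsub>Linf M\<^esub> b) x = linf_rep a x + linf_rep b x"
  using linf_rep_class[OF bmeas_add[OF linf_rep_bmeas linf_rep_bmeas], OF assms]
    linf_class_add[OF linf_rep_bmeas linf_rep_bmeas, OF assms] assms by (simp add: linf_class_rep)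

lemma linf_rep_zero: "AE x in M. linf_rep \<zero>\<^bsub>Linf M\<^esub> x = 0"
  unfolding linf_class_zero by (rule linf_rep_class) (auto simp: bmeas_carrier_iff)

lemma linf_rep_one: "AE x in M. linf_rep \<one>\<^bsub>Linf M\<^esub> x = 1"
  unfolding linf_class_one by (rule linf_rep_class) (auto simp: bmeas_carrier_iff)

lemma bmeas_cnj: "f \<in> carrier (bmeas_ring M) \<Longrightarrow> (\<lambda>x. cnj (f x)) \<in> carrier (bmeas_ring M)"
  unfolding bmeas_carrier_iff
  by (auto intro: borel_measurable_continuous_on[where f = cnj] continuous_intros)

lemma bmeas_cmod: "f \<in> carrier (bmeas_ring M) \<Longrightarrow> (\<lambda>x. complex_of_real (cmod (f x))) \<in> carrier (bmeas_ring M)"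
  unfolding bmeas_carrier_iff by auto

lemma bmeas_sqrt_Re:
  assumes "f \<in> carrier (bmeas_ring M)"
  shows "(\<lambda>x. complex_of_real (sqrt (Re (f x)))) \<in> carrier (bmeas_ring M)"
proof -
  from assms obtain K where K: "\<forall>x\<in>space M. cmod (f x) \<le> K" and [measurable]: "f \<in> borel_measurable M"
    by (auto simp: bmeas_carrier_iff)
  have "\<bar>sqrt (Re (f x))\<bar> \<le> sqrt K" if "x \<in> space M" for x
  proof -
    \<comment> \<open>\<open>sqrt\<close> is an odd function on the reals, so the bound holds
      without a sign condition on the real part.\<close>
    have "\<bar>sqrt (Re (f x))\<bar> = sqrt \<bar>Re (f x)\<bar>" by (cases "0 \<le> Re (f x)") (auto simp: real_sqrt_minus)
    also have "\<dots> \<le> sqrt K" using K that abs_Re_le_cmod[of "f x"] by (auto intro: order_trans)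
    finally show ?thesis .
  qed
  then show ?thesis unfolding bmeas_carrier_iff by auto
qed

lemma linf_cnj_closed [simp]: "a \<in> carrier (Linf M) \<Longrightarrow> linf_cnj M a \<in> carrier (Linf M)"
  unfolding linf_cnj_def by (intro linf_class_closed bmeas_cnj linf_rep_bmeas)

lemma linf_rep_cnj: "a \<in> carrier (Linf M) \<Longrightarrow> AE x in M. linf_rep (linf_cnj M a) x = cnj (linf_rep a x)"
  unfolding linf_cnj_def by (intro linf_rep_class bmeas_cnj linf_rep_bmeas)

lemma linf_abs_closed [simp]: "a \<in> carrier (Linf M) \<Longrightarrow> linf_abs M a \<in> carrier (Linf M)"
  unfolding linf_abs_def by (intro linf_class_closed bmeas_cmod linf_rep_bmeas)

lemma linf_rep_abs:
  "a \<in> carrier (Linf M) \<Longrightarrow> AE x in M. linf_rep (linf_abs M a) x = complex_of_real (cmod (linf_rep a x))"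
  unfolding linf_abs_def by (intro linf_rep_class bmeas_cmod linf_rep_bmeas)

lemma linf_sqrt_closed [simp]: "a \<in> carrier (Linf M) \<Longrightarrow> linf_sqrt M a \<in> carrier (Linf M)"
  unfolding linf_sqrt_def by (intro linf_class_closed bmeas_sqrt_Re linf_rep_bmeas)

lemma linf_rep_sqrt:
  "a \<in> carrier (Linf M) \<Longrightarrow> AE x in M. linf_rep (linf_sqrt M a) x = complex_of_real (sqrt (Re (linf_rep a x)))"
  unfolding linf_sqrt_def by (intro linf_rep_class bmeas_sqrt_Re linf_rep_bmeas)

text \<open>The infimum is attained: the bounds \<open>Inf S + 1 / (n + 1)\<close> hold
  simultaneously off one null set. Inequalities for the norm thus become inequalities at almost all
  points.\<close>

lemma linf_norm_le_iff:
  assumes "a \<in> carrier (Linf M)"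
  shows "linf_norm M a \<le> c \<longleftrightarrow> 0 \<le> c \<and> (AE x in M. cmod (linf_rep a x) \<le> c)"
proof -
  define S where "S = {c. 0 \<le> c \<and> (AE x in M. cmod (linf_rep a x) \<le> c)}"
  obtain K where K: "0 \<le> K" "\<And>x. x \<in> space M \<Longrightarrow> cmod (linf_rep a x) \<le> K"
    using linf_rep_bounded[OF assms] by blast
  then have ne: "K \<in> S" by (auto simp: S_def)
  have bb: "bdd_below S" by (auto simp: S_def bdd_below_def)
  have eq: "linf_norm M a = Inf S" by (simp add: linf_norm_def S_def)
  have nn: "0 \<le> Inf S" using ne by (intro cInf_greatest) (auto simp: S_def)
  have "AE x in M. cmod (linf_rep a x) \<le> Inf S + 1 / real (Suc n)" for n
  proof -
    have "Inf S < Inf S + 1 / real (Suc n)" by simp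
    then obtain d where "d \<in> S" "d < Inf S + 1 / real (Suc n)"
      using cInf_lessD ne by (metis empty_iff)
    then show ?thesis by (auto simp: S_def)
  qed
  then have "AE x in M. \<forall>n. cmod (linf_rep a x) \<le> Inf S + 1 / real (Suc n)"
    by (simp add: AE_all_countable)
  then have "AE x in M. cmod (linf_rep a x) \<le> Inf S"
  proof eventually_elim
    case (elim x)
    have "(\<lambda>n. Inf S + 1 / real (Suc n)) \<longlonglongrightarrow> Inf S + 0"
      by (intro tendsto_intros LIMSEQ_Suc lim_1_over_n)
    then show ?case using elim by (intro LIMSEQ_le_const[where X = "\<lambda>n. Inf S + 1 / real (Suc n)"]) auto
  qed
  then have S: "Inf S \<in> S" using nn by (simp add: S_def)
  show ?thesis unfolding eq
  proof
    assume "Inf S \<le> c"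
    with S show "0 \<le> c \<and> (AE x in M. cmod (linf_rep a x) \<le> c)"
      unfolding S_def by (auto elim!: eventually_mono)
  next
    assume "0 \<le> c \<and> (AE x in M. cmod (linf_rep a x) \<le> c)"
    then have "c \<in> S" by (auto simp: S_def)
    then show "Inf S \<le> c" using bb by (rule cInf_lower)
  qed
qed

section \<open>Idempotents as indicator classes, and partitions of unity\<close>

definition linf_ind :: "'a measure \<Rightarrow> 'a set \<Rightarrow> ('a \<Rightarrow> complex) set" where
  "linf_ind M A = linf_class M (indicator A)"

lemma bmeas_indicator: "A \<in> sets M \<Longrightarrow> (indicator A :: 'a \<Rightarrow> complex) \<in> carrier (bmeas_ring M)"
  by (intro bmeas_carrierI[where K = 1]) (auto simp: indicator_def)

lemma linf_ind_closed [simp]: "A \<in> sets M \<Longrightarrow> linf_ind M A \<in> carrier (Linf M)"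
  unfolding linf_ind_def by (intro linf_class_closed bmeas_indicator)

lemma linf_rep_ind: "A \<in> sets M \<Longrightarrow> AE x in M. linf_rep (linf_ind M A) x = indicator A x"
  unfolding linf_ind_def by (intro linf_rep_class bmeas_indicator)

lemma nabla_iff:
  "p \<in> carrier (nabla M) \<longleftrightarrow> p \<in> carrier (Linf M) \<and> (AE x in M. linf_rep p x = 0 \<or> linf_rep p x = 1)"
proof -
  have "p \<otimes>\<^bsub>Linf M\<^esub> p = p \<longleftrightarrow> (AE x in M. linf_rep p x = 0 \<or> linf_rep p x = 1)"
    if p: "p \<in> carrier (Linf M)"
  proof
    assume "p \<otimes>\<^bsub>Linf M\<^esub> p = p"
    then have "AE x in M. linf_rep p x * linf_rep p x = linf_rep p x"
      using linf_rep_mult[OF p p] by auto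
    then show "AE x in M. linf_rep p x = 0 \<or> linf_rep p x = 1" by eventually_elim simp
  next
    assume "AE x in M. linf_rep p x = 0 \<or> linf_rep p x = 1"
    with linf_rep_mult[OF p p] have "AE x in M. linf_rep (p \<otimes>\<^bsub>Linf M\<^esub> p) x = linf_rep p x"
      by eventually_elim auto
    with p show "p \<otimes>\<^bsub>Linf M\<^esub> p = p" by (intro linf_eqI) auto
  qed
  then show ?thesis by (auto simp: nabla_def)
qed

lemma linf_ind_nabla [simp]: "A \<in> sets M \<Longrightarrow> linf_ind M A \<in> carrier (nabla M)"
  using linf_rep_ind[of A M] by (auto simp: nabla_iff indicator_def elim!: eventually_mono)

lemma nabla_closed: "p \<in> carrier (nabla M) \<Longrightarrow> p \<in> carrier (Linf M)"
  by (simp add: nabla_def)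

text \<open>A representative takes values other than 0 and 1 on a null set only, so an idempotent is
  the same as a measurable set modulo null sets.\<close>

lemma nabla_eq_ind:
  assumes "p \<in> carrier (nabla M)"
  obtains A where "A \<in> sets M" "p = linf_ind M A"
proof -
  have p [measurable]: "linf_rep p \<in> borel_measurable M" using assms by (auto intro!: linf_rep_measurable nabla_closed)
  define A where "A = {x \<in> space M. linf_rep p x = 1}"
  have A: "A \<in> sets M" unfolding A_def by measurable
  have "AE x in M. linf_rep p x = 0 \<or> linf_rep p x = 1" using assms by (simp add: nabla_iff)
  with linf_rep_ind[OF A] AE_space have "AE x in M. linf_rep p x = linf_rep (linf_ind M A) x"
    by eventually_elim (auto simp: A_def indicator_def)
  with A assms have "p = linf_ind M A" by (intro linf_eqI) (auto simp: nabla_closed)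
  with A that show thesis by blast
qed

lemma linf_ind_mult_eq_zero_iff:
  assumes [simp]: "A \<in> sets M" "p \<in> carrier (Linf M)"
  shows "linf_ind M A \<otimes>\<^bsub>Linf M\<^esub> p = \<zero>\<^bsub>Linf M\<^esub> \<longleftrightarrow> (AE x in M. x \<in> A \<longrightarrow> linf_rep p x = 0)"
proof
  assume "linf_ind M A \<otimes>\<^bsub>Linf M\<^esub> p = \<zero>\<^bsub>Linf M\<^esub>"
  with linf_rep_mult[of "linf_ind M A" M p] linf_rep_ind[of A M] linf_rep_zero[of M]
  have "AE x in M. indicator A x * linf_rep p x = 0" by auto
  then show "AE x in M. x \<in> A \<longrightarrow> linf_rep p x = 0" by eventually_elim auto
next
  assume *: "AE x in M. x \<in> A \<longrightarrow> linf_rep p x = 0"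
  show "linf_ind M A \<otimes>\<^bsub>Linf M\<^esub> p = \<zero>\<^bsub>Linf M\<^esub>"
  proof (rule linf_eqI)
    show "AE x in M. linf_rep (linf_ind M A \<otimes>\<^bsub>Linf M\<^esub> p) x = linf_rep \<zero>\<^bsub>Linf M\<^esub> x"
      using linf_rep_mult[OF linf_ind_closed[OF assms(1)] assms(2)] linf_rep_ind[OF assms(1)]
        linf_rep_zero[of M] * by eventually_elim (auto simp: indicator_def)
  qed simp_all
qed

text \<open>The index set may be uncountable, so the null sets for the single members cannot be
  united. Instead, the complement of A is an upper bound of all members in the Boolean algebra and
  therefore dominates 1. This is how a property is glued along an arbitrary partition of
  unity.\<close>

lemma partition_of_unity_AE:
  assumes part: "partition_of_unity M I \<pi>" and A [measurable]: "A \<in> sets M"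
    and *: "\<And>i. i \<in> I \<Longrightarrow> AE x in M. linf_rep (\<pi> i) x = 1 \<longrightarrow> x \<notin> A"
  shows "AE x in M. x \<notin> A"
proof -
  have \<pi>: "\<pi> i \<in> carrier (nabla M)" if "i \<in> I" for i using part that by (auto simp: partition_of_unity_def)
  define u where "u = linf_ind M (space M - A)"
  have u: "u \<in> carrier (nabla M)" "AE x in M. linf_rep u x = indicator (space M - A) x"
    unfolding u_def by (auto intro!: linf_rep_ind)
  have "linf_le M (\<pi> i) u" if i: "i \<in> I" for i
  proof -
    have "AE x in M. linf_rep (\<pi> i) x = 0 \<or> linf_rep (\<pi> i) x = 1" using \<pi>[OF i] by (simp add: nabla_iff)
    then show ?thesis unfolding linf_le_def using *[OF i] u(2) AE_space
      by eventually_elim (auto simp: indicator_def)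
  qed
  then have "u \<in> Upper (nabla M) (\<pi> ` I)" using u(1) \<pi> by (auto simp: Upper_def nabla_def)
  then have "linf_le M \<one>\<^bsub>Linf M\<^esub> u"
    using part by (auto simp: partition_of_unity_def least_def) (auto simp: nabla_def)
  then show ?thesis unfolding linf_le_def using u(2) linf_rep_one[of M]
    by eventually_elim (auto simp: indicator_def split: if_splits)
qed

text \<open>In \<open>max\<close> the supremum condition is replaced by a disjointness test: if u is
  an upper bound of the family, its complement is disjoint from all members, hence null.\<close>

lemma partition_of_unityI:
  assumes \<pi>: "\<And>i. i \<in> I \<Longrightarrow> \<pi> i \<in> carrier (nabla M)"
    and orth: "\<And>i j. i \<in> I \<Longrightarrow> j \<in> I \<Longrightarrow> i \<noteq> j \<Longrightarrow> \<pi> i \<otimes>\<^bsub>Linf M\<^esub> \<pi> j = \<zero>\<^bsub>Linf M\<^esub>"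
    and max: "\<And>A. A \<in> sets M \<Longrightarrow> (\<And>i. i \<in> I \<Longrightarrow> linf_ind M A \<otimes>\<^bsub>Linf M\<^esub> \<pi> i = \<zero>\<^bsub>Linf M\<^esub>) \<Longrightarrow> AE x in M. x \<notin> A"
  shows "partition_of_unity M I \<pi>"
  unfolding partition_of_unity_def
proof (intro conjI ballI impI)
  show "least (nabla M) \<one>\<^bsub>Linf M\<^esub> (Upper (nabla M) (\<pi> ` I))"
    unfolding least_def
  proof (intro conjI ballI)
    have one: "\<one>\<^bsub>Linf M\<^esub> \<in> carrier (nabla M)" using linf_rep_one[of M] by (auto simp: nabla_iff elim!: eventually_mono)
    have "linf_le M p \<one>\<^bsub>Linf M\<^esub>" if "p \<in> carrier (nabla M)" for p
    proof -
      have "AE x in M. linf_rep p x = 0 \<or> linf_rep p x = 1" using that by (simp add: nabla_iff)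
      then show ?thesis unfolding linf_le_def using linf_rep_one[of M] by eventually_elim auto
    qed
    then show "\<one>\<^bsub>Linf M\<^esub> \<in> Upper (nabla M) (\<pi> ` I)" using one \<pi> by (auto simp: Upper_def nabla_def)
    fix u assume "u \<in> Upper (nabla M) (\<pi> ` I)"
    then have u: "u \<in> carrier (nabla M)" "\<And>i. i \<in> I \<Longrightarrow> linf_le M (\<pi> i) u"
      using \<pi> by (auto simp: Upper_def) (auto simp: nabla_def)
    obtain A where A: "A \<in> sets M" "u = linf_ind M A" using u(1) by (rule nabla_eq_ind)
    have "AE x in M. x \<notin> space M - A"
    proof (rule max)
      fix i assume i: "i \<in> I"
      have "AE x in M. linf_rep (\<pi> i) x = 0 \<or> linf_rep (\<pi> i) x = 1" using \<pi>[OF i] by (simp add: nabla_iff)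
      then have "AE x in M. x \<in> space M - A \<longrightarrow> linf_rep (\<pi> i) x = 0"
        using u(2)[OF i] linf_rep_ind[OF A(1)] unfolding linf_le_def A(2) by eventually_elim auto
      then show "linf_ind M (space M - A) \<otimes>\<^bsub>Linf M\<^esub> \<pi> i = \<zero>\<^bsub>Linf M\<^esub>"
        using A \<pi>[OF i] by (subst linf_ind_mult_eq_zero_iff) (auto simp: nabla_closed)
    qed (use A in auto)
    then have "linf_le M \<one>\<^bsub>Linf M\<^esub> u"
      using AE_space linf_rep_one[of M] linf_rep_ind[OF A(1)] unfolding linf_le_def A(2)
      by eventually_elim auto
    then show "\<one>\<^bsub>Linf M\<^esub> \<sqsubseteq>\<^bsub>nabla M\<^esub> u" by (simp add: nabla_def)
  qed (rule Upper_closed)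
qed (use assms in auto)

lemma partition_of_unity_ind:
  assumes A: "\<And>i :: 'i :: countable. A i \<in> sets M" and dis: "\<And>i j. i \<noteq> j \<Longrightarrow> A i \<inter> A j = {}"
    and cov: "space M \<subseteq> (\<Union>i. A i)"
  shows "partition_of_unity M UNIV (\<lambda>i. linf_ind M (A i))"
proof (rule partition_of_unityI)
  fix i j :: 'i assume ij: "i \<noteq> j"
  show "linf_ind M (A i) \<otimes>\<^bsub>Linf M\<^esub> linf_ind M (A j) = \<zero>\<^bsub>Linf M\<^esub>"
    using linf_rep_ind[OF A[of j]] dis[OF ij]
    by (subst linf_ind_mult_eq_zero_iff) (auto simp: A indicator_def elim!: eventually_mono)
next
  fix B assume B: "B \<in> sets M" and "\<And>i :: 'i. i \<in> UNIV \<Longrightarrow> linf_ind M B \<otimes>\<^bsub>Linf M\<^esub> linf_ind M (A i) = \<zero>\<^bsub>Linf M\<^esub>"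
  then have *: "AE x in M. x \<in> B \<longrightarrow> linf_rep (linf_ind M (A i)) x = 0" for i :: 'i
    using linf_ind_mult_eq_zero_iff[of B M "linf_ind M (A i)"] A by simp
  have "AE x in M. x \<in> B \<longrightarrow> x \<notin> A i" for i :: 'i
    using *[of i] linf_rep_ind[OF A[of i]] by eventually_elim auto
  then have "AE x in M. \<forall>i :: 'i. x \<in> B \<longrightarrow> x \<notin> A i" unfolding AE_all_countable ..
  with AE_space show "AE x in M. x \<notin> B" by eventually_elim (use cov in auto)
qed (use A in auto)

text \<open>The countable index type makes the set of uncovered points measurable, so that
  \<open>partition_of_unity_AE\<close> applies to it.\<close>

lemma partition_of_unity_cover:
  fixes \<pi> :: "'i :: countable \<Rightarrow> ('a \<Rightarrow> complex) set"
  assumes part: "partition_of_unity M UNIV \<pi>"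
  shows "AE x in M. \<exists>i. linf_rep (\<pi> i) x = 1"
proof -
  have [measurable]: "linf_rep (\<pi> i) \<in> borel_measurable M" for i
    using part by (auto simp: partition_of_unity_def intro!: linf_rep_measurable nabla_closed)
  have "AE x in M. x \<notin> {x \<in> space M. \<forall>i. linf_rep (\<pi> i) x \<noteq> 1}"
    by (rule partition_of_unity_AE[OF part]) auto
  with AE_space show ?thesis by eventually_elim auto
qed

text \<open>The mixing axiom admits only index sets consisting of classes. Indexing a partition by
  its own members brings any index type into this form.\<close>

lemma partition_of_unity_self:
  assumes "partition_of_unity M I \<pi>"
  shows "partition_of_unity M (\<pi> ` I) (\<lambda>p. p)"
  unfolding partition_of_unity_def
proof (intro conjI ballI impI)
  fix p q assume "p \<in> \<pi> ` I" "q \<in> \<pi> ` I" and ne: "p \<noteq> q"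
  then obtain i j where ij: "i \<in> I" "j \<in> I" "p = \<pi> i" "q = \<pi> j" by (elim imageE)
  with ne have "i \<noteq> j" by metis
  with assms ij show "p \<otimes>\<^bsub>Linf M\<^esub> q = \<zero>\<^bsub>Linf M\<^esub>" by (simp add: partition_of_unity_def)
qed (use assms in \<open>auto simp: partition_of_unity_def\<close>)

text \<open>Countably many inequalities hold off a common null set, so a lower bound of the sequence
  is below its pointwise limit. This turns almost everywhere convergence of a decreasing sequence
  into infimum 0.\<close>

lemma decreases_to_zeroI:
  assumes g: "\<And>n. g n \<in> carrier (Linf M)"
    and re: "AE x in M. \<forall>n. linf_rep (g n) x = complex_of_real (h n x)"
    and dec: "AE x in M. \<forall>n. h (Suc n) x \<le> h n x"
    and lim: "AE x in M. (\<lambda>n. h n x) \<longlonglongrightarrow> 0"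
  shows "decreases_to_zero M g"
  unfolding decreases_to_zero_def
proof (intro conjI allI)
  show "linf_le M (g (Suc n)) (g n)" for n
    unfolding linf_le_def using re dec by eventually_elim auto
  show "greatest (Linf_order M) \<zero>\<^bsub>Linf M\<^esub> (Lower (Linf_order M) (range g))"
    unfolding greatest_def
  proof (intro conjI ballI)
    have "linf_le M \<zero>\<^bsub>Linf M\<^esub> (g n)" for n
      unfolding linf_le_def using re dec lim linf_rep_zero[of M]
    proof eventually_elim
      case (elim x)
      then have "decseq (\<lambda>n. h n x)" by (auto simp: decseq_Suc_iff)
      then have "0 \<le> h n x" using elim by (intro decseq_ge) auto
      then show ?case using elim by auto
    qed
    then show "\<zero>\<^bsub>Linf M\<^esub> \<in> Lower (Linf_order M) (range g)" by (auto simp: Lower_def Linf_order_def)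
    fix l assume "l \<in> Lower (Linf_order M) (range g)"
    then have "linf_le M l (g n)" for n using g by (auto simp: Lower_def Linf_order_def)
    then have "AE x in M. \<forall>n. Re (linf_rep l x) \<le> Re (linf_rep (g n) x) \<and> Im (linf_rep l x) = Im (linf_rep (g n) x)"
      unfolding linf_le_def by (simp add: AE_all_countable)
    then have "linf_le M l \<zero>\<^bsub>Linf M\<^esub>"
      unfolding linf_le_def using re lim linf_rep_zero[of M]
    proof eventually_elim
      case (elim x)
      then have "Re (linf_rep l x) \<le> 0" by (intro LIMSEQ_le_const[of "\<lambda>n. h n x"]) auto
      then show ?case using elim by auto
    qed
    then show "l \<sqsubseteq>\<^bsub>Linf_order M\<^esub> \<zero>\<^bsub>Linf M\<^esub>" by (simp add: Linf_order_def)
  qed (rule Lower_closed)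
qed (rule g)

text \<open>Exhaustion by Zorn's lemma: beside a maximal disjoint family of idempotents that come
  from sets with property \<open>Q\<close> no non-null set can be left over, because some non-null
  part of it has property \<open>Q\<close>. The family may be uncountable, so disjointness is meant
  for classes and not for sets.\<close>

lemma dense_partition_exists:
  assumes dense: "\<And>A. A \<in> sets M \<Longrightarrow> \<not> (AE x in M. x \<notin> A) \<Longrightarrow>
    \<exists>B\<in>sets M. B \<subseteq> A \<and> \<not> (AE x in M. x \<notin> B) \<and> Q B"
  obtains G where "partition_of_unity M G (\<lambda>p. p)" "\<And>p. p \<in> G \<Longrightarrow> \<exists>B\<in>sets M. p = linf_ind M B \<and> Q B"
proof -
  define U where "U = {linf_ind M B |B. B \<in> sets M \<and> Q B}"
  define S where "S = {G. G \<subseteq> U \<and> pairwise (\<lambda>p q. p \<otimes>\<^bsub>Linf M\<^esub> q = \<zero>\<^bsub>Linf M\<^esub>) G}"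
  interpret L: cring "Linf M" by (rule cring_Linf)
  have U: "U \<subseteq> carrier (nabla M)" by (auto simp: U_def)
  have "\<exists>G\<in>S. \<forall>H\<in>S. G \<subseteq> H \<longrightarrow> H = G"
  proof (rule subset_Zorn')
    fix C assume C: "subset.chain S C"
    show "\<Union>C \<in> S" unfolding S_def mem_Collect_eq
    proof
      show "\<Union>C \<subseteq> U" using C by (auto simp: subset.chain_def S_def)
      show "pairwise (\<lambda>p q. p \<otimes>\<^bsub>Linf M\<^esub> q = \<zero>\<^bsub>Linf M\<^esub>) (\<Union>C)"
      proof (rule pairwiseI)
        fix p q assume pq: "p \<in> \<Union>C" "q \<in> \<Union>C" "p \<noteq> q"
        from pq(1,2) obtain P R where "P \<in> C" "p \<in> P" "R \<in> C" "q \<in> R" by (elim UnionE)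
        moreover from this C have "P \<subseteq> R \<or> R \<subseteq> P" by (auto simp: subset.chain_def)
        ultimately obtain P where P: "P \<in> C" "p \<in> P" "q \<in> P" by (elim disjE) (simp_all add: subset_iff)
        then have "P \<in> S" using C by (auto simp: subset.chain_def)
        then show "p \<otimes>\<^bsub>Linf M\<^esub> q = \<zero>\<^bsub>Linf M\<^esub>" using P pq(3) unfolding S_def pairwise_def by simp
      qed
    qed
  qed
  then obtain G where GS: "G \<in> S" and Gmax: "\<And>H. H \<in> S \<Longrightarrow> G \<subseteq> H \<Longrightarrow> H = G" by (elim bexE) simp
  have GU: "G \<subseteq> U" and Gp: "pairwise (\<lambda>p q. p \<otimes>\<^bsub>Linf M\<^esub> q = \<zero>\<^bsub>Linf M\<^esub>) G" using GS by (simp_all add: S_def)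
  have "partition_of_unity M G (\<lambda>p. p)"
  proof (rule partition_of_unityI)
    fix p assume "p \<in> G" then show "p \<in> carrier (nabla M)" using GU U by (meson subsetD)
  next
    fix p q assume "p \<in> G" "q \<in> G" "p \<noteq> q"
    then show "p \<otimes>\<^bsub>Linf M\<^esub> q = \<zero>\<^bsub>Linf M\<^esub>" using Gp by (simp add: pairwise_def)
  next
    fix A assume A: "A \<in> sets M" and Az: "\<And>p. p \<in> G \<Longrightarrow> linf_ind M A \<otimes>\<^bsub>Linf M\<^esub> p = \<zero>\<^bsub>Linf M\<^esub>"
    show "AE x in M. x \<notin> A"
    proof (rule ccontr)
      assume "\<not> (AE x in M. x \<notin> A)"
      from dense[OF A this] obtain B where B: "B \<in> sets M" "B \<subseteq> A" "\<not> (AE x in M. x \<notin> B)" "Q B"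
        by (elim bexE conjE)
      have Bz: "linf_ind M B \<otimes>\<^bsub>Linf M\<^esub> p = \<zero>\<^bsub>Linf M\<^esub>" if p: "p \<in> G" for p
      proof -
        have pc: "p \<in> carrier (Linf M)" using p GU U nabla_closed by (meson subsetD)
        have "AE x in M. x \<in> A \<longrightarrow> linf_rep p x = 0" using Az[OF p] linf_ind_mult_eq_zero_iff[OF A pc] by simp
        then have "AE x in M. x \<in> B \<longrightarrow> linf_rep p x = 0" by eventually_elim (use B(2) in auto)
        then show ?thesis using linf_ind_mult_eq_zero_iff[OF B(1) pc] by simp
      qed
      have "insert (linf_ind M B) G \<in> S" unfolding S_def mem_Collect_eq
      proof
        show "insert (linf_ind M B) G \<subseteq> U" using GU B unfolding U_def by (intro insert_subsetI) blast+
        show "pairwise (\<lambda>p q. p \<otimes>\<^bsub>Linf M\<^esub> q = \<zero>\<^bsub>Linf M\<^esub>) (insert (linf_ind M B) G)"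
          unfolding pairwise_insert
        proof (intro conjI allI impI Gp)
          fix p assume p: "p \<in> G \<and> p \<noteq> linf_ind M B"
          then have "p \<in> carrier (Linf M)" using GU U nabla_closed by (meson subsetD)
          then show "p \<otimes>\<^bsub>Linf M\<^esub> linf_ind M B = \<zero>\<^bsub>Linf M\<^esub>"
            using Bz[of p] p L.m_comm[of p "linf_ind M B"] B(1) by simp
          show "linf_ind M B \<otimes>\<^bsub>Linf M\<^esub> p = \<zero>\<^bsub>Linf M\<^esub>" using Bz p by simp
        qed
      qed
      \<comment> \<open>Maximality puts the class of B into G itself; being disjoint from every
        member, it is disjoint from itself, so B is null.\<close>
      then have "insert (linf_ind M B) G = G" by (rule Gmax) (rule subset_insertI)
      then have "linf_ind M B \<in> G" by (metis insertI1)
      then have "linf_ind M B \<otimes>\<^bsub>Linf M\<^esub> linf_ind M B = \<zero>\<^bsub>Linf M\<^esub>" by (rule Bz)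
      then have "AE x in M. x \<in> B \<longrightarrow> linf_rep (linf_ind M B) x = 0"
        using linf_ind_mult_eq_zero_iff[OF B(1) linf_ind_closed[OF B(1)]] by simp
      with linf_rep_ind[OF B(1)] have "AE x in M. x \<notin> B" by eventually_elim auto
      with B(3) show False by simp
    qed
  qed
  moreover have "\<exists>B\<in>sets M. p = linf_ind M B \<and> Q B" if "p \<in> G" for p
  proof -
    have "p \<in> U" using that GU by (meson subsetD)
    then show ?thesis unfolding U_def by blast
  qed
  ultimately show thesis by (rule that)
qed

section \<open>Pointwise inner products and mixings\<close>

context Hilbert_Kaplansky_module
begin

definition ipf :: "'x \<Rightarrow> 'x \<Rightarrow> 'a \<Rightarrow> complex" where
  "ipf \<xi> \<eta> = linf_rep (ip \<xi> \<eta>)"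

text \<open>The modulus only serves to make the pointwise norm nonnegative everywhere: \<open>ipf \<xi> \<xi>\<close> is
  nonnegative merely almost everywhere.\<close>

definition vnf :: "'x \<Rightarrow> 'a \<Rightarrow> real" where
  "vnf \<xi> x = sqrt (cmod (ipf \<xi> \<xi> x))"

declare M.minus_closed [simp] M.a_inv_closed [simp] smult_closed [simp]

lemma minus_add_cancel:
  assumes "\<xi> \<in> carrier X" "\<eta> \<in> carrier X"
  shows "(\<xi> \<ominus>\<^bsub>X\<^esub> \<eta>) \<oplus>\<^bsub>X\<^esub> \<eta> = \<xi>"
  using assms by (simp add: a_minus_def M.a_assoc M.l_neg)

lemma ipf_measurable [measurable]: "\<xi> \<in> carrier X \<Longrightarrow> \<eta> \<in> carrier X \<Longrightarrow> ipf \<xi> \<eta> \<in> borel_measurable M"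
  unfolding ipf_def by (intro linf_rep_measurable ip_closed)

lemma vnf_measurable [measurable]: "\<xi> \<in> carrier X \<Longrightarrow> vnf \<xi> \<in> borel_measurable M"
  unfolding vnf_def by measurable

lemma vnf_nonneg [simp]: "0 \<le> vnf \<xi> x"
  by (simp add: vnf_def)

lemma ipf_cnj:
  assumes "\<xi> \<in> carrier X" "\<eta> \<in> carrier X"
  shows "AE x in M. ipf \<eta> \<xi> x = cnj (ipf \<xi> \<eta> x)"
  using linf_rep_cnj[OF ip_closed[OF assms]] ip_cnj[OF assms(2,1)] by (simp add: ipf_def)

lemma ipf_add_left:
  assumes "\<xi> \<in> carrier X" "\<eta> \<in> carrier X" "\<zeta> \<in> carrier X"
  shows "AE x in M. ipf (\<xi> \<oplus>\<^bsub>X\<^esub> \<eta>) \<zeta> x = ipf \<xi> \<zeta> x + ipf \<eta> \<zeta> x"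
  using linf_rep_add[OF ip_closed ip_closed, OF assms(1,3,2,3)] ip_add[OF assms] by (simp add: ipf_def)

lemma ipf_smult_left:
  assumes "a \<in> carrier (Linf M)" "\<xi> \<in> carrier X" "\<eta> \<in> carrier X"
  shows "AE x in M. ipf (a \<odot>\<^bsub>X\<^esub> \<xi>) \<eta> x = linf_rep a x * ipf \<xi> \<eta> x"
  using linf_rep_mult[OF assms(1) ip_closed, OF assms(2,3)] ip_smult[OF assms] by (simp add: ipf_def)

lemma ipf_zero_left:
  assumes "\<zeta> \<in> carrier X"
  shows "AE x in M. ipf \<zero>\<^bsub>X\<^esub> \<zeta> x = 0"
proof -
  have "\<zero>\<^bsub>Linf M\<^esub> \<odot>\<^bsub>X\<^esub> \<zero>\<^bsub>X\<^esub> = \<zero>\<^bsub>X\<^esub>" by simp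
  with ipf_smult_left[OF linf_zero_closed M.zero_closed assms] linf_rep_zero[of M]
  show ?thesis by auto
qed

lemma ipf_uminus_left:
  assumes "\<xi> \<in> carrier X" "\<zeta> \<in> carrier X"
  shows "AE x in M. ipf (\<ominus>\<^bsub>X\<^esub> \<xi>) \<zeta> x = - ipf \<xi> \<zeta> x"
proof -
  have "\<xi> \<oplus>\<^bsub>X\<^esub> (\<ominus>\<^bsub>X\<^esub> \<xi>) = \<zero>\<^bsub>X\<^esub>" using assms by (simp add: M.r_neg)
  with ipf_add_left[of \<xi> "\<ominus>\<^bsub>X\<^esub> \<xi>" \<zeta>] ipf_zero_left[OF assms(2)] assms
  have "AE x in M. 0 = ipf \<xi> \<zeta> x + ipf (\<ominus>\<^bsub>X\<^esub> \<xi>) \<zeta> x" by (auto elim: eventually_elim2)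
  then show ?thesis by eventually_elim (simp add: eq_neg_iff_add_eq_0 add.commute)
qed

lemma ipf_minus_left:
  assumes "\<xi> \<in> carrier X" "\<eta> \<in> carrier X" "\<zeta> \<in> carrier X"
  shows "AE x in M. ipf (\<xi> \<ominus>\<^bsub>X\<^esub> \<eta>) \<zeta> x = ipf \<xi> \<zeta> x - ipf \<eta> \<zeta> x"
proof -
  have "\<xi> \<ominus>\<^bsub>X\<^esub> \<eta> = \<xi> \<oplus>\<^bsub>X\<^esub> (\<ominus>\<^bsub>X\<^esub> \<eta>)" by (simp add: a_minus_def)
  with ipf_add_left[of \<xi> "\<ominus>\<^bsub>X\<^esub> \<eta>" \<zeta>] ipf_uminus_left[OF assms(2,3)] assms show ?thesis
    by (auto elim: eventually_elim2)
qed

lemma ipf_add_right: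
  assumes "\<xi> \<in> carrier X" "\<eta> \<in> carrier X" "\<zeta> \<in> carrier X"
  shows "AE x in M. ipf \<zeta> (\<xi> \<oplus>\<^bsub>X\<^esub> \<eta>) x = ipf \<zeta> \<xi> x + ipf \<zeta> \<eta> x"
  using ipf_cnj[of "\<xi> \<oplus>\<^bsub>X\<^esub> \<eta>" \<zeta>] ipf_cnj[of \<xi> \<zeta>] ipf_cnj[of \<eta> \<zeta>] ipf_add_left[of \<xi> \<eta> \<zeta>] assms
  by simp (elim AE_mp, simp)

lemma ipf_minus_right:
  assumes "\<xi> \<in> carrier X" "\<eta> \<in> carrier X" "\<zeta> \<in> carrier X"
  shows "AE x in M. ipf \<zeta> (\<xi> \<ominus>\<^bsub>X\<^esub> \<eta>) x = ipf \<zeta> \<xi> x - ipf \<zeta> \<eta> x"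
  using ipf_cnj[of "\<xi> \<ominus>\<^bsub>X\<^esub> \<eta>" \<zeta>] ipf_cnj[of \<xi> \<zeta>] ipf_cnj[of \<eta> \<zeta>] ipf_minus_left[of \<xi> \<eta> \<zeta>] assms
  by simp (elim AE_mp, simp)

lemma ipf_smult_right:
  assumes "a \<in> carrier (Linf M)" "\<xi> \<in> carrier X" "\<eta> \<in> carrier X"
  shows "AE x in M. ipf \<eta> (a \<odot>\<^bsub>X\<^esub> \<xi>) x = cnj (linf_rep a x) * ipf \<eta> \<xi> x"
  using ipf_cnj[of "a \<odot>\<^bsub>X\<^esub> \<xi>" \<eta>] ipf_cnj[of \<xi> \<eta>] ipf_smult_left[of a \<xi> \<eta>] assms
  by simp (elim AE_mp, simp)

lemma ipf_self:
  assumes "\<xi> \<in> carrier X"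
  shows "AE x in M. ipf \<xi> \<xi> x = complex_of_real ((vnf \<xi> x)\<^sup>2)"
proof -
  have "AE x in M. 0 \<le> Re (ipf \<xi> \<xi> x) \<and> Im (ipf \<xi> \<xi> x) = 0"
    using ip_nonneg[OF assms] linf_rep_zero[of M] unfolding linf_le_def ipf_def
    by (auto elim!: eventually_elim2)
  then show ?thesis
    by eventually_elim (simp add: vnf_def complex_eq_iff cmod_def)
qed

lemma ip_self_eq_ind:
  assumes "\<xi> \<in> carrier X" "A \<in> sets M" "AE x in M. vnf \<xi> x = indicator A x"
  shows "ip \<xi> \<xi> = linf_ind M A"
proof (rule linf_eqI)
  show "AE x in M. linf_rep (ip \<xi> \<xi>) x = linf_rep (linf_ind M A) x"
    using ipf_self[OF assms(1)] linf_rep_ind[OF assms(2)] assms(3) unfolding ipf_def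
    by eventually_elim (auto simp: indicator_def)
qed (use assms in \<open>auto intro: ip_closed\<close>)

lemma vec_eq_zeroI:
  assumes "\<xi> \<in> carrier X" "AE x in M. vnf \<xi> x = 0"
  shows "\<xi> = \<zero>\<^bsub>X\<^esub>"
proof -
  have "ip \<xi> \<xi> = \<zero>\<^bsub>Linf M\<^esub>"
  proof (rule linf_eqI)
    show "AE x in M. linf_rep (ip \<xi> \<xi>) x = linf_rep \<zero>\<^bsub>Linf M\<^esub> x"
      using ipf_self[OF assms(1)] linf_rep_zero[of M] assms(2) unfolding ipf_def by eventually_elim auto
  qed (use assms in \<open>auto intro: ip_closed\<close>)
  then show ?thesis using ip_eq_zero assms by auto
qed

text \<open>Inner products against \<zeta> replace the values of a vector. The null set may depend
  on \<zeta>, for the argument takes only \<zeta> = \<xi> - \<eta>. Identities between images under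
  operators thereby become arithmetic of complex numbers at almost every point.\<close>

lemma vec_eqI:
  assumes "\<xi> \<in> carrier X" "\<eta> \<in> carrier X" "\<And>\<zeta>. \<zeta> \<in> carrier X \<Longrightarrow> AE x in M. ipf \<xi> \<zeta> x = ipf \<eta> \<zeta> x"
  shows "\<xi> = \<eta>"
proof -
  have c: "\<xi> \<ominus>\<^bsub>X\<^esub> \<eta> \<in> carrier X" using assms by auto
  from ipf_minus_left[OF assms(1,2) c] assms(3)[OF c]
  have "AE x in M. vnf (\<xi> \<ominus>\<^bsub>X\<^esub> \<eta>) x = 0" by eventually_elim (simp add: vnf_def)
  then have "\<xi> \<ominus>\<^bsub>X\<^esub> \<eta> = \<zero>\<^bsub>X\<^esub>" using c by (rule vec_eq_zeroI[rotated])
  then show ?thesis using minus_add_cancel[OF assms(1,2)] assms(2) by simp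
qed

lemma vec_eqI':
  assumes "\<xi> \<in> carrier X" "\<eta> \<in> carrier X" "AE x in M. vnf (\<xi> \<ominus>\<^bsub>X\<^esub> \<eta>) x = 0"
  shows "\<xi> = \<eta>"
proof -
  have "\<xi> \<ominus>\<^bsub>X\<^esub> \<eta> = \<zero>\<^bsub>X\<^esub>" by (rule vec_eq_zeroI) (use assms in auto)
  then show ?thesis using minus_add_cancel[OF assms(1,2)] assms(2) by simp
qed

lemma vnf_smult:
  assumes "a \<in> carrier (Linf M)" "\<xi> \<in> carrier X"
  shows "AE x in M. vnf (a \<odot>\<^bsub>X\<^esub> \<xi>) x = cmod (linf_rep a x) * vnf \<xi> x"
proof -
  have c: "a \<odot>\<^bsub>X\<^esub> \<xi> \<in> carrier X" using assms by auto
  from ipf_smult_left[OF assms c] ipf_smult_right[OF assms assms(2)] show ?thesis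
    by eventually_elim (simp add: vnf_def norm_mult real_sqrt_mult)
qed

lemma vnf_zero: "AE x in M. vnf \<zero>\<^bsub>X\<^esub> x = 0"
  using ipf_zero_left[OF M.zero_closed] by eventually_elim (simp add: vnf_def)

lemma vnf_minus_commute:
  assumes "\<xi> \<in> carrier X" "\<eta> \<in> carrier X"
  shows "AE x in M. vnf (\<xi> \<ominus>\<^bsub>X\<^esub> \<eta>) x = vnf (\<eta> \<ominus>\<^bsub>X\<^esub> \<xi>) x"
proof -
  have c: "\<xi> \<ominus>\<^bsub>X\<^esub> \<eta> \<in> carrier X" "\<eta> \<ominus>\<^bsub>X\<^esub> \<xi> \<in> carrier X" using assms by auto
  from ipf_minus_left[OF assms c(1)] ipf_minus_left[OF assms(2,1) c(2)]
    ipf_minus_right[OF assms assms(1)] ipf_minus_right[OF assms assms(2)]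
    ipf_minus_right[OF assms(2,1) assms(1)] ipf_minus_right[OF assms(2,1) assms(2)]
  have "AE x in M. ipf (\<xi> \<ominus>\<^bsub>X\<^esub> \<eta>) (\<xi> \<ominus>\<^bsub>X\<^esub> \<eta>) x = ipf (\<eta> \<ominus>\<^bsub>X\<^esub> \<xi>) (\<eta> \<ominus>\<^bsub>X\<^esub> \<xi>) x"
    by eventually_elim simp
  then show ?thesis by eventually_elim (simp add: vnf_def)
qed

text \<open>The usual argument subtracts from \<xi> its projection to \<eta> and so divides by
  |\<eta>|^2, which may have no bounded inverse. Multiplied by |\<eta>|^2 the difference is \<zeta>
  = |\<eta>|^2 \<xi> - <\<xi>,\<eta>> \<eta>, and |\<zeta>|^2 = |\<eta>|^2 (|\<eta>|^2 |\<xi>|^2 -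
  |<\<xi>,\<eta>>|^2).\<close>

lemma Cauchy_Schwarz_AE:
  assumes \<xi> [measurable]: "\<xi> \<in> carrier X" and \<eta> [measurable]: "\<eta> \<in> carrier X"
  shows "AE x in M. cmod (ipf \<xi> \<eta> x) \<le> vnf \<xi> x * vnf \<eta> x"
proof -
  define \<zeta> where "\<zeta> = ip \<eta> \<eta> \<odot>\<^bsub>X\<^esub> \<xi> \<ominus>\<^bsub>X\<^esub> ip \<xi> \<eta> \<odot>\<^bsub>X\<^esub> \<eta>"
  have c: "ip \<eta> \<eta> \<in> carrier (Linf M)" "ip \<xi> \<eta> \<in> carrier (Linf M)" using assms ip_closed by auto
  have c': "ip \<eta> \<eta> \<odot>\<^bsub>X\<^esub> \<xi> \<in> carrier X" "ip \<xi> \<eta> \<odot>\<^bsub>X\<^esub> \<eta> \<in> carrier X" "\<zeta> \<in> carrier X"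
    using assms c by (auto simp: \<zeta>_def)
  have left: "AE x in M. ipf \<zeta> \<theta> x = ipf \<eta> \<eta> x * ipf \<xi> \<theta> x - ipf \<xi> \<eta> x * ipf \<eta> \<theta> x" if "\<theta> \<in> carrier X" for \<theta>
    using ipf_minus_left[OF c'(1,2) that] ipf_smult_left[OF c(1) \<xi> that] ipf_smult_left[OF c(2) \<eta> that]
    unfolding \<zeta>_def by eventually_elim (simp add: ipf_def)
  have right: "AE x in M. ipf \<theta> \<zeta> x = cnj (ipf \<eta> \<eta> x) * ipf \<theta> \<xi> x - cnj (ipf \<xi> \<eta> x) * ipf \<theta> \<eta> x" if "\<theta> \<in> carrier X" for \<theta>
    using ipf_minus_right[OF c'(1,2) that] ipf_smult_right[OF c(1) \<xi> that] ipf_smult_right[OF c(2) \<eta> that]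
    unfolding \<zeta>_def by eventually_elim (simp add: ipf_def)
  \<comment> \<open>Where |\<eta>| = 0 the formula for |\<zeta>|^2 carries no information. There the
    idempotent of Z annihilates \<eta>, hence also the inner product with \<eta>.\<close>
  define Z where "Z = {x \<in> space M. vnf \<eta> x = 0}"
  have Z: "Z \<in> sets M" unfolding Z_def by measurable
  have "linf_ind M Z \<odot>\<^bsub>X\<^esub> \<eta> = \<zero>\<^bsub>X\<^esub>"
    by (rule vec_eq_zeroI) (use Z \<eta> vnf_smult[OF linf_ind_closed[OF Z] \<eta>] linf_rep_ind[OF Z] in
        \<open>auto elim!: eventually_elim2 simp: Z_def indicator_def\<close>)
  with ipf_smult_right[OF linf_ind_closed[OF Z] \<eta> \<xi>] ipf_zero_left[OF \<xi>] ipf_cnj[OF M.zero_closed \<xi>]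
    linf_rep_ind[OF Z]
  have "AE x in M. cnj (indicator Z x) * ipf \<xi> \<eta> x = 0"
    by simp (elim AE_mp, simp)
  then have zero: "AE x in M. vnf \<eta> x = 0 \<longrightarrow> ipf \<xi> \<eta> x = 0"
    using AE_space by eventually_elim (auto simp: Z_def indicator_def)
  show ?thesis
    using ipf_self[OF c'(3)] ipf_self[OF \<xi>] ipf_self[OF \<eta>] left[OF c'(3)] right[OF \<xi>] right[OF \<eta>]
      ipf_cnj[OF \<xi> \<eta>] zero
  proof eventually_elim
    case (elim x)
    define n where "n = vnf \<eta> x" define m where "m = vnf \<xi> x" define z where "z = ipf \<xi> \<eta> x"
    have nn: "0 \<le> n" "0 \<le> m" by (auto simp: n_def m_def)
    have zz: "cnj z * z = complex_of_real ((cmod z)\<^sup>2)" "z * cnj z = complex_of_real ((cmod z)\<^sup>2)"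
      by (simp_all only: complex_norm_square mult.commute[of "cnj z" z])
    have "complex_of_real ((vnf \<zeta> x)\<^sup>2) =
        complex_of_real (n\<^sup>2) * (complex_of_real (n\<^sup>2) * complex_of_real (m\<^sup>2) - cnj z * z)
        - z * (complex_of_real (n\<^sup>2) * cnj z - cnj z * complex_of_real (n\<^sup>2))"
      using elim unfolding n_def m_def z_def by (simp add: algebra_simps)
    also have "\<dots> = complex_of_real (n\<^sup>2 * (n\<^sup>2 * m\<^sup>2 - (cmod z)\<^sup>2))"
      unfolding zz by simp
    finally have "(vnf \<zeta> x)\<^sup>2 = n\<^sup>2 * (n\<^sup>2 * m\<^sup>2 - (cmod z)\<^sup>2)" by (simp only: of_real_eq_iff)
    then have *: "0 \<le> n\<^sup>2 * (n\<^sup>2 * m\<^sup>2 - (cmod z)\<^sup>2)" by (metis zero_le_power2)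
    show ?case
    proof (cases "n = 0")
      case True then show ?thesis using elim by (simp add: n_def)
    next
      case False
      then have "0 < n\<^sup>2" by simp
      from mult_le_cancel_left_pos[OF this, of 0 "n\<^sup>2 * m\<^sup>2 - (cmod z)\<^sup>2"] *
      have "0 \<le> n\<^sup>2 * m\<^sup>2 - (cmod z)\<^sup>2" by (simp only: mult_zero_right)
      then have "(cmod z)\<^sup>2 \<le> (m * n)\<^sup>2" by (simp add: power_mult_distrib mult.commute[of "m\<^sup>2"])
      then have "cmod z \<le> m * n" using nn(2,1) by (rule power2_le_imp_le[OF _ mult_nonneg_nonneg])
      then show ?thesis by (simp add: n_def m_def z_def)
    qed
  qed
qed

lemma vnf_add:
  assumes "\<xi> \<in> carrier X" "\<eta> \<in> carrier X"
  shows "AE x in M. vnf (\<xi> \<oplus>\<^bsub>X\<^esub> \<eta>) x \<le> vnf \<xi> x + vnf \<eta> x"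
proof -
  have c: "\<xi> \<oplus>\<^bsub>X\<^esub> \<eta> \<in> carrier X" using assms by auto
  from ipf_add_left[OF assms c] ipf_add_right[OF assms assms(1)] ipf_add_right[OF assms assms(2)]
    ipf_self[OF c] ipf_self[OF assms(1)] ipf_self[OF assms(2)]
    Cauchy_Schwarz_AE[OF assms] Cauchy_Schwarz_AE[OF assms(2,1)]
  show ?thesis
  proof eventually_elim
    case (elim x)
    define r where "r = vnf (\<xi> \<oplus>\<^bsub>X\<^esub> \<eta>) x"
    have "r\<^sup>2 = cmod (complex_of_real (r\<^sup>2))" by (simp add: norm_power)
    also have "complex_of_real (r\<^sup>2) = complex_of_real ((vnf \<xi> x)\<^sup>2) + ipf \<xi> \<eta> x + (ipf \<eta> \<xi> x + complex_of_real ((vnf \<eta> x)\<^sup>2))"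
      using elim by (simp add: r_def)
    also have "cmod \<dots> \<le> (vnf \<xi> x)\<^sup>2 + cmod (ipf \<xi> \<eta> x) + (cmod (ipf \<eta> \<xi> x) + (vnf \<eta> x)\<^sup>2)"
      by (intro norm_triangle_mono order_refl) (auto simp: norm_power)
    also have "\<dots> \<le> (vnf \<xi> x + vnf \<eta> x)\<^sup>2"
      using elim(7,8) by (simp add: power2_eq_square algebra_simps)
    finally show ?case unfolding r_def by (rule power2_le_imp_le) simp
  qed
qed

lemma vnf_uminus:
  assumes "\<xi> \<in> carrier X"
  shows "AE x in M. vnf (\<ominus>\<^bsub>X\<^esub> \<xi>) x = vnf \<xi> x"
proof -
  have c: "\<ominus>\<^bsub>X\<^esub> \<xi> \<in> carrier X" using assms by auto
  from ipf_uminus_left[OF assms c] ipf_uminus_left[OF assms assms] ipf_cnj[OF assms c]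
  show ?thesis by eventually_elim (metis complex_mod_cnj norm_minus_cancel vnf_def)
qed

lemma vnf_minus:
  assumes "\<xi> \<in> carrier X" "\<eta> \<in> carrier X"
  shows "AE x in M. vnf (\<xi> \<ominus>\<^bsub>X\<^esub> \<eta>) x \<le> vnf \<xi> x + vnf \<eta> x"
proof -
  have "\<ominus>\<^bsub>X\<^esub> \<eta> \<in> carrier X" using assms by simp
  from vnf_add[OF assms(1) this] vnf_uminus[OF assms(2)] show ?thesis
    unfolding a_minus_def by eventually_elim simp
qed

lemma vnf_diff:
  assumes "\<xi> \<in> carrier X" "\<eta> \<in> carrier X"
  shows "AE x in M. \<bar>vnf \<xi> x - vnf \<eta> x\<bar> \<le> vnf (\<xi> \<ominus>\<^bsub>X\<^esub> \<eta>) x"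
proof -
  have c: "\<xi> \<ominus>\<^bsub>X\<^esub> \<eta> \<in> carrier X" "\<eta> \<ominus>\<^bsub>X\<^esub> \<xi> \<in> carrier X" using assms by auto
  have eq: "(\<xi> \<ominus>\<^bsub>X\<^esub> \<eta>) \<oplus>\<^bsub>X\<^esub> \<eta> = \<xi>" "(\<eta> \<ominus>\<^bsub>X\<^esub> \<xi>) \<oplus>\<^bsub>X\<^esub> \<xi> = \<eta>"
    using assms by (simp_all add: minus_add_cancel)
  from vnf_add[OF c(1) assms(2)] vnf_add[OF c(2) assms(1)] vnf_minus_commute[OF assms]
  show ?thesis unfolding eq by eventually_elim simp
qed

section \<open>The essential supremum norm and bounded sets\<close>

lemma vec_norm_closed: "\<xi> \<in> carrier X \<Longrightarrow> vec_norm M ip \<xi> \<in> carrier (Linf M)"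
  by (simp add: vec_norm_def ip_closed)

lemma vec_norm_AE:
  assumes "\<xi> \<in> carrier X"
  shows "AE x in M. linf_rep (vec_norm M ip \<xi>) x = complex_of_real (vnf \<xi> x)"
  using linf_rep_sqrt[OF ip_closed[OF assms assms]] ipf_self[OF assms] unfolding vec_norm_def ipf_def
  by eventually_elim simp

text \<open>The conjunct \<open>0 \<le> c\<close> matters if the whole space is null: then every
  constant is an almost everywhere bound.\<close>

lemma norm_inf_le_iff:
  assumes "\<xi> \<in> carrier X"
  shows "norm_inf M ip \<xi> \<le> c \<longleftrightarrow> 0 \<le> c \<and> (AE x in M. vnf \<xi> x \<le> c)"
proof -
  have c: "ip \<xi> \<xi> \<in> carrier (Linf M)" using assms ip_closed by auto
  have nn: "0 \<le> linf_norm M (ip \<xi> \<xi>)" using linf_norm_le_iff[OF c] by blast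
  have "norm_inf M ip \<xi> \<le> c \<longleftrightarrow> 0 \<le> c \<and> linf_norm M (ip \<xi> \<xi>) \<le> c\<^sup>2"
    unfolding norm_inf_def using nn real_sqrt_le_iff[of "linf_norm M (ip \<xi> \<xi>)" "c\<^sup>2"]
    by (cases "0 \<le> c") (auto simp: not_le intro: less_le_trans)
  also have "\<dots> \<longleftrightarrow> 0 \<le> c \<and> (AE x in M. vnf \<xi> x \<le> c)"
  proof (cases "0 \<le> c")
    case True
    then have "cmod (linf_rep (ip \<xi> \<xi>) x) \<le> c\<^sup>2 \<longleftrightarrow> vnf \<xi> x \<le> c" for x
      unfolding vnf_def ipf_def using real_sqrt_le_iff[of "cmod (linf_rep (ip \<xi> \<xi>) x)" "c\<^sup>2"] by simp
    with True show ?thesis by (simp add: linf_norm_le_iff[OF c])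
  qed simp
  finally show ?thesis .
qed

lemma vnf_le_norm_inf: "\<xi> \<in> carrier X \<Longrightarrow> AE x in M. vnf \<xi> x \<le> norm_inf M ip \<xi>"
  using norm_inf_le_iff by blast

lemma norm_boundedI:
  assumes "C \<subseteq> carrier X" "0 \<le> K" "\<And>\<xi>. \<xi> \<in> C \<Longrightarrow> AE x in M. vnf \<xi> x \<le> K"
  shows "norm_bounded M ip C"
  unfolding norm_bounded_def using assms by (intro exI[of _ K] ballI) (auto simp: norm_inf_le_iff subset_iff)

lemma norm_boundedE:
  assumes "norm_bounded M ip C" "C \<subseteq> carrier X"
  obtains K where "0 \<le> K" "\<And>\<xi>. \<xi> \<in> C \<Longrightarrow> AE x in M. vnf \<xi> x \<le> K"
proof -
  obtain K where "\<forall>\<xi>\<in>C. norm_inf M ip \<xi> \<le> K" using assms by (auto simp: norm_bounded_def)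
  then have "AE x in M. vnf \<xi> x \<le> max K 0" if "\<xi> \<in> C" for \<xi>
    using that assms(2) norm_inf_le_iff[of \<xi> "max K 0"] by (auto simp: le_max_iff_disj)
  then show thesis by (intro that[of "max K 0"]) auto
qed

section \<open>Locality and mixing of vectors\<close>

lemma smult_eq_vnf:
  assumes p: "p \<in> carrier (Linf M)" and c: "\<xi> \<in> carrier X" "\<eta> \<in> carrier X" and eq: "p \<odot>\<^bsub>X\<^esub> \<xi> = p \<odot>\<^bsub>X\<^esub> \<eta>"
  shows "AE x in M. linf_rep p x \<noteq> 0 \<longrightarrow> vnf \<xi> x = vnf \<eta> x"
  using vnf_smult[OF p c(1)] vnf_smult[OF p c(2)] unfolding eq by eventually_elim auto

text \<open>Together with \<open>smult_eq_vnf\<close> this expresses that vectors which agree after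
  multiplication by p coincide where p is nonzero. Norms and inner products of a mixing are read off
  from its pieces in this way.\<close>

lemma smult_eq_ipf:
  assumes p: "p \<in> carrier (Linf M)" and c: "\<xi> \<in> carrier X" "\<eta> \<in> carrier X" and \<zeta>: "\<zeta> \<in> carrier X"
    and eq: "p \<odot>\<^bsub>X\<^esub> \<xi> = p \<odot>\<^bsub>X\<^esub> \<eta>"
  shows "AE x in M. linf_rep p x \<noteq> 0 \<longrightarrow> ipf \<xi> \<zeta> x = ipf \<eta> \<zeta> x"
  using ipf_smult_left[OF p c(1) \<zeta>] ipf_smult_left[OF p c(2) \<zeta>] unfolding eq by eventually_elim auto

lemma mixing_exists:
  fixes I :: "'i set"
  assumes part: "partition_of_unity M I \<pi>" and c: "\<And>i. i \<in> I \<Longrightarrow> \<xi> i \<in> carrier X"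
    and K: "0 \<le> K" "\<And>i. i \<in> I \<Longrightarrow> AE x in M. vnf (\<xi> i) x \<le> K"
  obtains \<eta> where "\<eta> \<in> carrier X" "\<And>i. i \<in> I \<Longrightarrow> \<pi> i \<odot>\<^bsub>X\<^esub> \<eta> = \<pi> i \<odot>\<^bsub>X\<^esub> \<xi> i"
proof -
  \<comment> \<open>Several indices may have the same member p; \<open>h\<close> picks one of them.
    Two indices with the same member make it orthogonal to itself, so p = 0 and the condition at the
    other index is void.\<close>
  define h where "h p = (SOME i. i \<in> I \<and> \<pi> i = p)" for p
  have h: "h (\<pi> i) \<in> I \<and> \<pi> (h (\<pi> i)) = \<pi> i" if "i \<in> I" for i
    unfolding h_def by (rule someI[of "\<lambda>j. j \<in> I \<and> \<pi> j = \<pi> i"]) (use that in auto)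
  have sub: "(\<lambda>p. \<xi> (h p)) ` (\<pi> ` I) \<subseteq> carrier X" using c h by (simp add: image_subset_iff)
  have bd: "norm_bounded M ip ((\<lambda>p. \<xi> (h p)) ` (\<pi> ` I))"
    by (rule norm_boundedI[OF sub K(1)]) (use K h in auto)
  from mixing_ex[OF partition_of_unity_self[OF part] sub bd]
  obtain \<eta> where \<eta>: "is_mixing X (\<pi> ` I) (\<lambda>p. p) (\<lambda>p. \<xi> (h p)) \<eta>" by blast
  have "\<pi> i \<odot>\<^bsub>X\<^esub> \<eta> = \<pi> i \<odot>\<^bsub>X\<^esub> \<xi> i" if i: "i \<in> I" for i
  proof -
    have *: "\<pi> i \<odot>\<^bsub>X\<^esub> \<eta> = \<pi> i \<odot>\<^bsub>X\<^esub> \<xi> (h (\<pi> i))" using \<eta> i by (simp add: is_mixing_def)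
    show ?thesis
    proof (cases "h (\<pi> i) = i")
      case False
      then have "\<pi> (h (\<pi> i)) \<otimes>\<^bsub>Linf M\<^esub> \<pi> i = \<zero>\<^bsub>Linf M\<^esub>" "\<pi> i \<otimes>\<^bsub>Linf M\<^esub> \<pi> i = \<pi> i"
        using part h[OF i] i by (auto simp: partition_of_unity_def) (auto simp: nabla_def)
      then have "\<pi> i = \<zero>\<^bsub>Linf M\<^esub>" using h[OF i] by simp
      moreover have "\<xi> (h (\<pi> i)) \<in> carrier X" using c h[OF i] by blast
      ultimately show ?thesis using * c[OF i] by simp
    qed (use * in simp)
  qed
  with \<eta> that show thesis by (auto simp: is_mixing_def)
qed

lemma mixing_exists_ind:
  fixes A :: "nat \<Rightarrow> 'a set"
  assumes A: "\<And>k. A k \<in> sets M" "\<And>i j. i \<noteq> j \<Longrightarrow> A i \<inter> A j = {}" "space M \<subseteq> (\<Union>k. A k)"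
    and c: "\<And>k. \<xi> k \<in> carrier X" and K: "0 \<le> K" "\<And>k. AE x in M. vnf (\<xi> k) x \<le> K"
  shows "\<exists>\<eta>\<in>carrier X. (AE x in M. \<forall>k. x \<in> A k \<longrightarrow> vnf \<eta> x = vnf (\<xi> k) x) \<and>
    (\<forall>\<zeta>\<in>carrier X. AE x in M. \<forall>k. x \<in> A k \<longrightarrow> ipf \<eta> \<zeta> x = ipf (\<xi> k) \<zeta> x)"
proof -
  have part: "partition_of_unity M UNIV (\<lambda>k. linf_ind M (A k))" using A by (rule partition_of_unity_ind)
  obtain \<eta> where \<eta>: "\<eta> \<in> carrier X" "\<And>k. linf_ind M (A k) \<odot>\<^bsub>X\<^esub> \<eta> = linf_ind M (A k) \<odot>\<^bsub>X\<^esub> \<xi> k"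
    by (rule mixing_exists[OF part, of \<xi> K]) (use c K in auto)
  have "AE x in M. \<forall>k. x \<in> A k \<longrightarrow> vnf \<eta> x = vnf (\<xi> k) x"
    unfolding AE_all_countable
  proof
    fix k
    show "AE x in M. x \<in> A k \<longrightarrow> vnf \<eta> x = vnf (\<xi> k) x"
      using smult_eq_vnf[OF linf_ind_closed[OF A(1)] \<eta>(1) c \<eta>(2)[of k]] linf_rep_ind[OF A(1)[of k]]
      by eventually_elim auto
  qed
  moreover have "AE x in M. \<forall>k. x \<in> A k \<longrightarrow> ipf \<eta> \<zeta> x = ipf (\<xi> k) \<zeta> x" if \<zeta>: "\<zeta> \<in> carrier X" for \<zeta>
    unfolding AE_all_countable
  proof
    fix k
    show "AE x in M. x \<in> A k \<longrightarrow> ipf \<eta> \<zeta> x = ipf (\<xi> k) \<zeta> x"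
      using smult_eq_ipf[OF linf_ind_closed[OF A(1)] \<eta>(1) c \<zeta> \<eta>(2)[of k]] linf_rep_ind[OF A(1)[of k]]
      by eventually_elim auto
  qed
  ultimately show ?thesis using \<eta>(1) by blast
qed

text \<open>The quotient \<open>w / |w|\<close> is bounded on each set where the integer part of \<open>1 / |w|\<close> is constant;
  the pieces are mixed.\<close>

lemma polar_decomposition:
  assumes w [measurable]: "w \<in> carrier X"
  obtains \<xi> where "\<xi> \<in> carrier X" "AE x in M. vnf \<xi> x = (if vnf w x = 0 then 0 else 1)"
    "w = vec_norm M ip w \<odot>\<^bsub>X\<^esub> \<xi>"
proof -
  \<comment> \<open>On \<open>A k\<close> with k > 0 the bound 1 / |w| \<le> k holds, and
    \<open>A 0\<close> is the zero set of w. There \<open>b 0\<close> vanishes too, because division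
    by zero yields 0, so \<xi> vanishes where w does.\<close>
  define h where "h x = (if vnf w x = 0 then 0 else Suc (nat \<lfloor>1 / vnf w x\<rfloor>))" for x
  define A where "A k = {x \<in> space M. h x = k}" for k
  have A [measurable]: "A k \<in> sets M" for k unfolding A_def h_def by measurable
  define b where "b k x = complex_of_real (indicator (A k) x / vnf w x)" for k x
  have b: "b k \<in> carrier (bmeas_ring M)" for k
  proof (rule bmeas_carrierI)
    show "b k \<in> borel_measurable M" unfolding b_def by measurable
    fix x assume "x \<in> space M"
    have "1 / vnf w x \<le> real k" if "x \<in> A k" "vnf w x \<noteq> 0"
    proof -
      have "k = Suc (nat \<lfloor>1 / vnf w x\<rfloor>)" using that by (simp add: A_def h_def)
      moreover have "0 \<le> 1 / vnf w x" by simp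
      ultimately show ?thesis by linarith
    qed
    then show "cmod (b k x) \<le> real k" by (cases "vnf w x = 0") (auto simp: b_def indicator_def norm_divide)
  qed
  define \<rho> where "\<rho> k = linf_class M (b k) \<odot>\<^bsub>X\<^esub> w" for k
  have \<rho>: "\<rho> k \<in> carrier X" for k unfolding \<rho>_def using b w by (intro smult_closed linf_class_closed)
  have v\<rho>: "AE x in M. vnf (\<rho> k) x = cmod (b k x) * vnf w x" for k
    using vnf_smult[OF linf_class_closed[OF b] w, of k] linf_rep_class[OF b[of k]] unfolding \<rho>_def
    by eventually_elim simp
  have "AE x in M. vnf (\<rho> k) x \<le> 1" for k
    using v\<rho>[of k] by eventually_elim (auto simp: b_def indicator_def norm_divide)
  then have "\<exists>\<eta>\<in>carrier X. (AE x in M. \<forall>k. x \<in> A k \<longrightarrow> vnf \<eta> x = vnf (\<rho> k) x) \<and>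
    (\<forall>\<zeta>\<in>carrier X. AE x in M. \<forall>k. x \<in> A k \<longrightarrow> ipf \<eta> \<zeta> x = ipf (\<rho> k) \<zeta> x)"
    by (intro mixing_exists_ind[where K = 1] A \<rho>) (auto simp: A_def)
  then obtain \<xi> where \<xi>: "\<xi> \<in> carrier X" "AE x in M. \<forall>k. x \<in> A k \<longrightarrow> vnf \<xi> x = vnf (\<rho> k) x"
    "\<And>\<zeta>. \<zeta> \<in> carrier X \<Longrightarrow> AE x in M. \<forall>k. x \<in> A k \<longrightarrow> ipf \<xi> \<zeta> x = ipf (\<rho> k) \<zeta> x"
    by blast
  have "AE x in M. \<forall>k. vnf (\<rho> k) x = cmod (b k x) * vnf w x" using v\<rho> by (simp add: AE_all_countable)
  with \<xi>(2) AE_space have "AE x in M. vnf \<xi> x = (if vnf w x = 0 then 0 else 1)"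
  proof eventually_elim
    case (elim x)
    then have "x \<in> A (h x)" by (simp add: A_def)
    with elim have "vnf \<xi> x = cmod (b (h x) x) * vnf w x" by simp
    with \<open>x \<in> A (h x)\<close> show ?case by (simp add: b_def norm_divide)
  qed
  moreover have "w = vec_norm M ip w \<odot>\<^bsub>X\<^esub> \<xi>"
  proof (rule vec_eqI)
    show c: "vec_norm M ip w \<odot>\<^bsub>X\<^esub> \<xi> \<in> carrier X" using \<xi>(1) w vec_norm_closed by simp
    fix \<zeta> assume \<zeta>: "\<zeta> \<in> carrier X"
    have "AE x in M. ipf (\<rho> k) \<zeta> x = b k x * ipf w \<zeta> x" for k
      using ipf_smult_left[OF linf_class_closed[OF b] w \<zeta>, of k] linf_rep_class[OF b[of k]] unfolding \<rho>_def
      by eventually_elim simp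
    then have "AE x in M. \<forall>k. ipf (\<rho> k) \<zeta> x = b k x * ipf w \<zeta> x" by (simp add: AE_all_countable)
    with \<xi>(3)[OF \<zeta>] AE_space ipf_smult_left[OF vec_norm_closed[OF w] \<xi>(1) \<zeta>] vec_norm_AE[OF w]
      Cauchy_Schwarz_AE[OF w \<zeta>]
    show "AE x in M. ipf w \<zeta> x = ipf (vec_norm M ip w \<odot>\<^bsub>X\<^esub> \<xi>) \<zeta> x"
    proof eventually_elim
      case (elim x)
      then have "x \<in> A (h x)" by (simp add: A_def)
      \<comment> \<open>At zeros of w both sides vanish, the left one by Cauchy-Schwarz.\<close>
      with elim show ?case by (cases "vnf w x = 0") (auto simp: b_def)
    qed
  qed (use w in auto)
  ultimately show thesis using that \<xi>(1) by blast
qed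

section \<open>The unit ball and cyclic subsequences\<close>

definition unit_ball :: "'x set" where
  "unit_ball = {\<xi> \<in> carrier X. AE x in M. vnf \<xi> x \<le> 1}"

lemma unit_ballD: "\<xi> \<in> unit_ball \<Longrightarrow> \<xi> \<in> carrier X" "\<xi> \<in> unit_ball \<Longrightarrow> AE x in M. vnf \<xi> x \<le> 1"
  by (auto simp: unit_ball_def)

lemma norm_bounded_unit_ball: "norm_bounded M ip unit_ball"
  by (rule norm_boundedI[of _ 1]) (auto simp: unit_ball_def)

text \<open>Cyclic subsequences exist for bounded sequences only.\<close>

lemma cyclically_compact_norm_bounded:
  assumes D: "cyclically_compact M X ip D"
  shows "norm_bounded M ip D"
proof (rule ccontr)
  assume "\<not> norm_bounded M ip D"
  then have "\<exists>\<xi>\<in>D. norm_inf M ip \<xi> > K" for K by (auto simp: norm_bounded_def not_le)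
  then have "\<exists>s. \<forall>n. s n \<in> D \<and> norm_inf M ip (s n) > real n"
    by (intro choice) blast
  then obtain s where s: "\<And>n. s n \<in> D" "\<And>n. norm_inf M ip (s n) > real n" by blast
  then have "norm_bounded M ip (range s)"
    using D unfolding cyclically_compact_def cyclic_subseq_def by (meson image_subsetI)
  then obtain K where "\<And>n. norm_inf M ip (s n) \<le> K" by (auto simp: norm_bounded_def)
  moreover obtain n where "K < real n" using reals_Archimedean2 by blast
  ultimately show False using s(2)[of n] by (meson less_le_trans not_less_iff_gr_or_eq order.strict_trans)
qed

lemma partition_nabla: "partition_of_unity M I \<pi> \<Longrightarrow> i \<in> I \<Longrightarrow> \<pi> i \<in> carrier (Linf M)"
  by (auto simp: partition_of_unity_def intro: nabla_closed)

lemma vec_eq_partitionI: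
  fixes \<pi> :: "nat \<Rightarrow> ('a \<Rightarrow> complex) set"
  assumes part: "partition_of_unity M UNIV \<pi>" and c: "\<xi> \<in> carrier X" "\<eta> \<in> carrier X"
    and eq: "\<And>n. \<pi> n \<odot>\<^bsub>X\<^esub> \<xi> = \<pi> n \<odot>\<^bsub>X\<^esub> \<eta>"
  shows "\<xi> = \<eta>"
proof (rule vec_eqI[OF c])
  fix \<zeta> assume \<zeta>: "\<zeta> \<in> carrier X"
  have "AE x in M. \<forall>n. linf_rep (\<pi> n) x \<noteq> 0 \<longrightarrow> ipf \<xi> \<zeta> x = ipf \<eta> \<zeta> x"
    unfolding AE_all_countable using smult_eq_ipf[OF partition_nabla[OF part] c \<zeta> eq] by blast
  with partition_of_unity_cover[OF part] show "AE x in M. ipf \<xi> \<zeta> x = ipf \<eta> \<zeta> x"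
    by eventually_elim auto
qed

text \<open>Only countably many products of idempotents are involved, so one null set suffices: off
  it a cyclic subsequence is an ordinary subsequence whose indices k depend on the point.\<close>

lemma cyclic_partitions_AE:
  fixes \<nu> :: "nat \<Rightarrow> nat \<Rightarrow> ('a \<Rightarrow> complex) set"
  assumes part: "\<And>j. partition_of_unity M UNIV (\<nu> j)"
    and inc: "\<And>j m n. \<nu> j m \<otimes>\<^bsub>Linf M\<^esub> \<nu> (Suc j) n \<noteq> \<zero>\<^bsub>Linf M\<^esub> \<Longrightarrow> m < n"
  shows "AE x in M. \<exists>k. strict_mono k \<and> (\<forall>j. linf_rep (\<nu> j (k j)) x = 1)"
proof -
  have c: "\<nu> j n \<in> carrier (Linf M)" for j n using partition_nabla[OF part] by simp
  have "AE x in M. \<forall>j. \<exists>n. linf_rep (\<nu> j n) x = 1"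
    unfolding AE_all_countable using partition_of_unity_cover[OF part] by blast
  moreover have "AE x in M. \<forall>j m n. linf_rep (\<nu> j m) x = 1 \<longrightarrow> linf_rep (\<nu> (Suc j) n) x = 1 \<longrightarrow> m < n"
    unfolding AE_all_countable
  proof (intro allI)
    fix j m n
    show "AE x in M. linf_rep (\<nu> j m) x = 1 \<longrightarrow> linf_rep (\<nu> (Suc j) n) x = 1 \<longrightarrow> m < n"
    proof (cases "m < n")
      case False
      then have "\<nu> j m \<otimes>\<^bsub>Linf M\<^esub> \<nu> (Suc j) n = \<zero>\<^bsub>Linf M\<^esub>" using inc by metis
      with linf_rep_mult[OF c[of j m] c[of "Suc j" n]] linf_rep_zero[of M]
      have "AE x in M. linf_rep (\<nu> j m) x * linf_rep (\<nu> (Suc j) n) x = 0" by auto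
      then show ?thesis by eventually_elim auto
    qed simp
  qed
  ultimately show ?thesis
  proof eventually_elim
    case (elim x)
    then obtain k where k: "\<And>j. linf_rep (\<nu> j (k j)) x = 1" by metis
    with elim(2) have "k j < k (Suc j)" for j by blast
    with k show ?case by (auto simp: strict_mono_Suc_iff)
  qed
qed

lemma vnf_minus_square:
  assumes "\<xi> \<in> carrier X" "\<eta> \<in> carrier X"
  shows "AE x in M. (vnf (\<xi> \<ominus>\<^bsub>X\<^esub> \<eta>) x)\<^sup>2 = (vnf \<xi> x)\<^sup>2 - 2 * Re (ipf \<xi> \<eta> x) + (vnf \<eta> x)\<^sup>2"
proof -
  have c: "\<xi> \<ominus>\<^bsub>X\<^esub> \<eta> \<in> carrier X" using assms by simp
  from ipf_self[OF c] ipf_self[OF assms(1)] ipf_self[OF assms(2)] ipf_minus_left[OF assms c]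
    ipf_minus_right[OF assms assms(1)] ipf_minus_right[OF assms assms(2)] ipf_cnj[OF assms]
  show ?thesis
  proof eventually_elim
    case (elim x)
    then have "complex_of_real ((vnf (\<xi> \<ominus>\<^bsub>X\<^esub> \<eta>) x)\<^sup>2) =
      complex_of_real ((vnf \<xi> x)\<^sup>2) - ipf \<xi> \<eta> x - (cnj (ipf \<xi> \<eta> x) - complex_of_real ((vnf \<eta> x)\<^sup>2))"
      by simp
    from arg_cong[OF this, of Re] show ?case by simp
  qed
qed

text \<open>The last condition makes |l| the pointwise operator norm of S, attained at \<xi> where l
  is nonzero. Where l = 0 no vector of norm one need exist, so \<xi> is zero there instead of being
  normalised.\<close>

definition dominant_eigenvector :: "('x \<Rightarrow> 'x) \<Rightarrow> 'x \<Rightarrow> ('a \<Rightarrow> complex) set \<Rightarrow> bool" where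
  "dominant_eigenvector S \<xi> l \<longleftrightarrow> \<xi> \<in> carrier X \<and> l \<in> carrier (Linf M) \<and> S \<xi> = l \<odot>\<^bsub>X\<^esub> \<xi> \<and>
     (AE x in M. Im (linf_rep l x) = 0) \<and>
     (AE x in M. vnf \<xi> x = (if linf_rep l x = 0 then 0 else 1)) \<and>
     (\<forall>\<zeta>\<in>carrier X. AE x in M. vnf (S \<zeta>) x \<le> cmod (linf_rep l x) * vnf \<zeta> x)"

lemma ipf_finsum_left:
  assumes "finite A" "\<And>i. i \<in> A \<Longrightarrow> g i \<in> carrier X" "\<zeta> \<in> carrier X"
  shows "AE x in M. ipf (\<Oplus>\<^bsub>X\<^esub>i\<in>A. g i) \<zeta> x = (\<Sum>i\<in>A. ipf (g i) \<zeta> x)"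
  using assms(1,2)
proof (induction A rule: finite_induct)
  case empty
  then show ?case using ipf_zero_left[OF assms(3)] by simp
next
  case (insert i A)
  have c: "g i \<in> carrier X" "(\<Oplus>\<^bsub>X\<^esub>i\<in>A. g i) \<in> carrier X" using insert by (auto intro: M.finsum_closed)
  have "(\<Oplus>\<^bsub>X\<^esub>i\<in>insert i A. g i) = g i \<oplus>\<^bsub>X\<^esub> (\<Oplus>\<^bsub>X\<^esub>i\<in>A. g i)"
    using insert by (intro M.finsum_insert) auto
  then have "AE x in M. ipf (\<Oplus>\<^bsub>X\<^esub>i\<in>insert i A. g i) \<zeta> x = ipf (g i) \<zeta> x + ipf (\<Oplus>\<^bsub>X\<^esub>i\<in>A. g i) \<zeta> x"
    using ipf_add_left[OF c assms(3)] by simp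
  moreover have "AE x in M. ipf (\<Oplus>\<^bsub>X\<^esub>i\<in>A. g i) \<zeta> x = (\<Sum>i\<in>A. ipf (g i) \<zeta> x)" using insert by simp
  ultimately show ?case by eventually_elim (use insert(1,2) in simp)
qed

text \<open>The majorant occurs twice: as a sequence e of classes, because order convergence asks
  for bounded classes, and as functions h, because monotonicity and the limit are checked at
  points.\<close>

lemma order_null_vec_normI:
  assumes c: "\<And>n. \<xi> n \<in> carrier X" and e: "\<And>n. e n \<in> carrier (Linf M)"
    and re: "\<And>n. AE x in M. linf_rep (e n) x = complex_of_real (h n x)"
    and dec: "AE x in M. \<forall>n. h (Suc n) x \<le> h n x"
    and lim: "AE x in M. (\<lambda>n. h n x) \<longlonglongrightarrow> 0"
    and le: "\<And>n. AE x in M. vnf (\<xi> n) x \<le> h n x"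
  shows "order_null M (\<lambda>n. vec_norm M ip (\<xi> n))"
  unfolding order_null_def
proof (intro exI[of _ e] conjI allI)
  show "decreases_to_zero M e"
    using e dec lim re by (intro decreases_to_zeroI[where h = h]) (auto simp: AE_all_countable)
  show "linf_le M (vec_norm M ip (\<xi> n)) (e n)" for n
    unfolding linf_le_def using vec_norm_AE[OF c[of n]] re[of n] le[of n] by eventually_elim auto
qed

end

section \<open>Self-adjoint cyclically compact operators\<close>

text \<open>The operator is a parameter of the locale because the results are applied again to every
  operator obtained from T by deflation.\<close>

locale compact_self_adjoint = Hilbert_Kaplansky_module M X ip
  for M :: "'a measure" and X :: "(('a \<Rightarrow> complex) set, 'x, 'm) module_scheme"
    and ip :: "'x \<Rightarrow> 'x \<Rightarrow> ('a \<Rightarrow> complex) set" +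
  fixes T :: "'x \<Rightarrow> 'x"
  assumes compact: "cyclically_compact_operator M X ip T"
    and self_adj: "self_adjoint X ip T"
begin

section \<open>Linearity and boundedness of the operator\<close>

lemma T_closed [simp]: "\<xi> \<in> carrier X \<Longrightarrow> T \<xi> \<in> carrier X"
  using compact by (auto simp: cyclically_compact_operator_def Linf_linear_def)

lemma T_add: "\<xi> \<in> carrier X \<Longrightarrow> \<eta> \<in> carrier X \<Longrightarrow> T (\<xi> \<oplus>\<^bsub>X\<^esub> \<eta>) = T \<xi> \<oplus>\<^bsub>X\<^esub> T \<eta>"
  using compact by (auto simp: cyclically_compact_operator_def Linf_linear_def)

lemma T_smult: "a \<in> carrier (Linf M) \<Longrightarrow> \<xi> \<in> carrier X \<Longrightarrow> T (a \<odot>\<^bsub>X\<^esub> \<xi>) = a \<odot>\<^bsub>X\<^esub> T \<xi>"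
  using compact by (auto simp: cyclically_compact_operator_def Linf_linear_def)

lemma T_minus:
  assumes "\<xi> \<in> carrier X" "\<eta> \<in> carrier X"
  shows "T (\<xi> \<ominus>\<^bsub>X\<^esub> \<eta>) = T \<xi> \<ominus>\<^bsub>X\<^esub> T \<eta>"
proof -
  have c: "\<xi> \<ominus>\<^bsub>X\<^esub> \<eta> \<in> carrier X" using assms by simp
  have "T \<xi> = T (\<xi> \<ominus>\<^bsub>X\<^esub> \<eta>) \<oplus>\<^bsub>X\<^esub> T \<eta>"
    using T_add[OF c assms(2)] minus_add_cancel[OF assms] by simp
  then show ?thesis using assms c by (simp add: a_minus_def M.a_assoc M.r_neg)
qed

lemma T_ip:
  "\<xi> \<in> carrier X \<Longrightarrow> \<eta> \<in> carrier X \<Longrightarrow> ipf (T \<xi>) \<eta> = ipf \<xi> (T \<eta>)"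
  using self_adj by (simp add: self_adjoint_def ipf_def)

text \<open>Boundedness is a consequence of compactness: the image of the unit ball lies in a
  cyclically compact set, and such sets are norm bounded.\<close>

lemma T_bounded:
  obtains K where "0 \<le> K" "\<And>\<zeta>. \<zeta> \<in> unit_ball \<Longrightarrow> AE x in M. vnf (T \<zeta>) x \<le> K"
proof -
  have "relatively_cyclically_compact M X ip (T ` unit_ball)"
    using compact norm_bounded_unit_ball unit_ballD(1) unfolding cyclically_compact_operator_def by blast
  then obtain D where D: "cyclically_compact M X ip D" "T ` unit_ball \<subseteq> D"
    by (auto simp: relatively_cyclically_compact_def)
  then have "D \<subseteq> carrier X" by (auto simp: cyclically_compact_def cyclic_def)
  then obtain K where "0 \<le> K" "\<And>\<xi>. \<xi> \<in> D \<Longrightarrow> AE x in M. vnf \<xi> x \<le> K"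
    using norm_boundedE[OF cyclically_compact_norm_bounded[OF D(1)]] by metis
  with D(2) that show thesis by (meson image_subset_iff)
qed

text \<open>Homogeneity over the algebra: \<eta> = |\<eta>| \<xi> with \<xi> in the unit ball, and
  the factor |\<eta>| passes through T.\<close>

lemma T_dominated:
  assumes \<eta>: "\<eta> \<in> carrier X" and m: "\<And>\<zeta>. \<zeta> \<in> unit_ball \<Longrightarrow> AE x in M. vnf (T \<zeta>) x \<le> m x"
  shows "AE x in M. vnf (T \<eta>) x \<le> m x * vnf \<eta> x"
proof -
  obtain \<xi> where \<xi>: "\<xi> \<in> carrier X" "AE x in M. vnf \<xi> x = (if vnf \<eta> x = 0 then 0 else 1)"
    "\<eta> = vec_norm M ip \<eta> \<odot>\<^bsub>X\<^esub> \<xi>"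
    by (rule polar_decomposition[OF \<eta>])
  have "T \<eta> = vec_norm M ip \<eta> \<odot>\<^bsub>X\<^esub> T \<xi>"
    using T_smult[OF vec_norm_closed[OF \<eta>] \<xi>(1)] \<xi>(3) by simp
  then have "AE x in M. vnf (T \<eta>) x = cmod (linf_rep (vec_norm M ip \<eta>) x) * vnf (T \<xi>) x"
    using vnf_smult[OF vec_norm_closed[OF \<eta>] T_closed[OF \<xi>(1)]] by simp
  moreover have "\<xi> \<in> unit_ball" using \<xi>(1,2) by (auto simp: unit_ball_def elim!: eventually_mono)
  note m[OF this]
  ultimately show ?thesis using vec_norm_AE[OF \<eta>]
    by eventually_elim (simp add: mult.commute[of "m _"] mult_left_mono)
qed

section \<open>Maximisation over the unit ball\<close>

text \<open>Locally a maximiser up to \<open>\<epsilon>\<close> exists because \<open>|T \<zeta>|\<close> cannot be increased by \<open>\<epsilon>\<close> infinitely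
  often; the local maximisers are then mixed.\<close>

lemma almost_maximiser_exists:
  assumes \<epsilon>: "0 < (\<epsilon> :: real)"
  obtains \<eta> where "\<eta> \<in> unit_ball" "\<And>\<zeta>. \<zeta> \<in> unit_ball \<Longrightarrow> AE x in M. vnf (T \<zeta>) x \<le> vnf (T \<eta>) x + \<epsilon>"
proof -
  define good where "good B \<eta> \<longleftrightarrow> \<eta> \<in> unit_ball \<and>
    (\<forall>\<zeta>\<in>unit_ball. AE x in M. x \<in> B \<longrightarrow> vnf (T \<zeta>) x \<le> vnf (T \<eta>) x + \<epsilon>)" for B \<eta>
  obtain K where K: "0 \<le> K" "\<And>\<zeta>. \<zeta> \<in> unit_ball \<Longrightarrow> AE x in M. vnf (T \<zeta>) x \<le> K"
    using T_bounded by metis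
  have zero: "\<zero>\<^bsub>X\<^esub> \<in> unit_ball" using vnf_zero by (auto simp: unit_ball_def elim!: eventually_mono)
  have loc: "\<exists>B\<in>sets M. B \<subseteq> A \<and> \<not> (AE x in M. x \<notin> B) \<and> (\<exists>\<eta>. good B \<eta>)"
    if A: "A \<in> sets M" "\<not> (AE x in M. x \<notin> A)" for A
  proof (rule ccontr)
    assume no: "\<not> ?thesis"
    \<comment> \<open>As long as there is no local maximiser, passing from \<eta> to a vector that
      gains \<epsilon> shrinks the set but keeps it non-null; after n rounds |T \<eta>| is at least
      n \<epsilon> on it. For large n this exceeds the bound K.\<close>
    have "\<exists>B\<in>sets M. B \<subseteq> A \<and> \<not> (AE x in M. x \<notin> B) \<and>
        (\<exists>\<eta>\<in>unit_ball. AE x in M. x \<in> B \<longrightarrow> real n * \<epsilon> \<le> vnf (T \<eta>) x)" for n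
    proof (induction n)
      case 0
      show ?case using A zero by (intro bexI[of _ A] conjI bexI[of _ "\<zero>\<^bsub>X\<^esub>"]) auto
    next
      case (Suc n)
      then obtain B \<eta> where B: "B \<in> sets M" "B \<subseteq> A" "\<not> (AE x in M. x \<notin> B)" and \<eta>: "\<eta> \<in> unit_ball"
        "AE x in M. x \<in> B \<longrightarrow> real n * \<epsilon> \<le> vnf (T \<eta>) x" by (elim bexE conjE)
      with no have "\<not> good B \<eta>" by auto
      then obtain \<zeta> where \<zeta>: "\<zeta> \<in> unit_ball" "\<not> (AE x in M. x \<in> B \<longrightarrow> vnf (T \<zeta>) x \<le> vnf (T \<eta>) x + \<epsilon>)"
        using \<eta>(1) by (auto simp: good_def)
      have [measurable]: "vnf (T \<zeta>) \<in> borel_measurable M" "vnf (T \<eta>) \<in> borel_measurable M" "B \<in> sets M"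
        using \<zeta>(1) \<eta>(1) B(1) by (auto simp: unit_ballD)
      define C where "C = {x \<in> space M. x \<in> B \<and> \<not> vnf (T \<zeta>) x \<le> vnf (T \<eta>) x + \<epsilon>}"
      have C: "C \<in> sets M" unfolding C_def by measurable
      have "\<not> (AE x in M. x \<notin> C)"
      proof
        assume "AE x in M. x \<notin> C"
        with AE_space have "AE x in M. x \<in> B \<longrightarrow> vnf (T \<zeta>) x \<le> vnf (T \<eta>) x + \<epsilon>"
          by eventually_elim (auto simp: C_def)
        with \<zeta>(2) show False by simp
      qed
      moreover have "AE x in M. x \<in> C \<longrightarrow> real (Suc n) * \<epsilon> \<le> vnf (T \<zeta>) x"
        using \<eta>(2) by eventually_elim (auto simp: C_def algebra_simps)
      ultimately show ?case using C B(2) \<zeta>(1)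
        by (intro bexI[of _ C] conjI bexI[of _ \<zeta>]) (auto simp: C_def)
    qed
    moreover obtain n where "K < real n * \<epsilon>" using reals_Archimedean3[OF \<epsilon>] by blast
    ultimately obtain B \<eta> where B: "\<not> (AE x in M. x \<notin> B)" and \<eta>: "\<eta> \<in> unit_ball"
        "AE x in M. x \<in> B \<longrightarrow> real n * \<epsilon> \<le> vnf (T \<eta>) x" by blast
    from K(2)[OF \<eta>(1)] \<eta>(2) have "AE x in M. x \<notin> B"
      by eventually_elim (use \<open>K < real n * \<epsilon>\<close> in auto)
    with B show False by simp
  qed
  obtain G where G: "partition_of_unity M G (\<lambda>p. p)"
    and Gg: "\<And>p. p \<in> G \<Longrightarrow> \<exists>B\<in>sets M. p = linf_ind M B \<and> (\<exists>\<eta>. good B \<eta>)"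
    using dense_partition_exists[of M "\<lambda>B. \<exists>\<eta>. good B \<eta>"] loc by metis
  have "\<forall>p\<in>G. \<exists>B \<eta>. B \<in> sets M \<and> p = linf_ind M B \<and> good B \<eta>" using Gg by meson
  then obtain B e where Be: "\<And>p. p \<in> G \<Longrightarrow> B p \<in> sets M" "\<And>p. p \<in> G \<Longrightarrow> p = linf_ind M (B p)"
    "\<And>p. p \<in> G \<Longrightarrow> good (B p) (e p)" by (metis (no_types, lifting))
  have e: "e p \<in> unit_ball" if "p \<in> G" for p using Be(3)[OF that] by (simp add: good_def)
  obtain \<eta> where \<eta>: "\<eta> \<in> carrier X" "\<And>p. p \<in> G \<Longrightarrow> p \<odot>\<^bsub>X\<^esub> \<eta> = p \<odot>\<^bsub>X\<^esub> e p"
    by (rule mixing_exists[OF G, of e 1]) (use e unit_ballD in auto)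
  have [measurable]: "vnf \<eta> \<in> borel_measurable M" "vnf (T \<eta>) \<in> borel_measurable M" using \<eta>(1) by auto
  have pc: "p \<in> carrier (Linf M)" if "p \<in> G" for p using linf_ind_closed[OF Be(1)[OF that]] Be(2)[OF that] by simp
  \<comment> \<open>The partition G may be uncountable; the inequality is proved by showing that its
    measurable exceptional set misses every member.\<close>
  have "AE x in M. x \<notin> {x \<in> space M. \<not> vnf \<eta> x \<le> 1}"
  proof (rule partition_of_unity_AE[OF G])
    fix p assume p: "p \<in> G"
    show "AE x in M. linf_rep p x = 1 \<longrightarrow> x \<notin> {x \<in> space M. \<not> vnf \<eta> x \<le> 1}"
      using smult_eq_vnf[OF pc[OF p] \<eta>(1) unit_ballD(1)[OF e[OF p]] \<eta>(2)[OF p]] unit_ballD(2)[OF e[OF p]]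
      by eventually_elim auto
  qed measurable
  with AE_space have "AE x in M. vnf \<eta> x \<le> 1" by eventually_elim auto
  then have "\<eta> \<in> unit_ball" using \<eta>(1) by (simp add: unit_ball_def)
  moreover have "AE x in M. vnf (T \<zeta>) x \<le> vnf (T \<eta>) x + \<epsilon>" if \<zeta>: "\<zeta> \<in> unit_ball" for \<zeta>
  proof -
    have [measurable]: "vnf (T \<zeta>) \<in> borel_measurable M" using \<zeta> by (auto simp: unit_ballD)
    have "AE x in M. x \<notin> {x \<in> space M. \<not> vnf (T \<zeta>) x \<le> vnf (T \<eta>) x + \<epsilon>}"
    proof (rule partition_of_unity_AE[OF G])
      fix p assume p: "p \<in> G"
      note ep = unit_ballD(1)[OF e[OF p]]
      have "p \<odot>\<^bsub>X\<^esub> T \<eta> = p \<odot>\<^bsub>X\<^esub> T (e p)"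
        using T_smult[OF pc[OF p] \<eta>(1)] T_smult[OF pc[OF p] ep] \<eta>(2)[OF p] by simp
      from smult_eq_vnf[OF pc[OF p] T_closed[OF \<eta>(1)] T_closed[OF ep] this]
      have 1: "AE x in M. linf_rep p x \<noteq> 0 \<longrightarrow> vnf (T \<eta>) x = vnf (T (e p)) x" .
      have 2: "AE x in M. linf_rep p x = indicator (B p) x"
        using linf_rep_ind[OF Be(1)[OF p]] Be(2)[OF p] by simp
      have 3: "AE x in M. x \<in> B p \<longrightarrow> vnf (T \<zeta>) x \<le> vnf (T (e p)) x + \<epsilon>"
        using Be(3)[OF p] \<zeta> by (simp add: good_def)
      from 1 2 3 show "AE x in M. linf_rep p x = 1 \<longrightarrow> x \<notin> {x \<in> space M. \<not> vnf (T \<zeta>) x \<le> vnf (T \<eta>) x + \<epsilon>}"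
        by eventually_elim (auto simp: indicator_def split: if_splits)
    qed measurable
    with AE_space show ?thesis by eventually_elim auto
  qed
  ultimately show thesis using that by blast
qed

text \<open>The unit ball is uncountable, so the supremum over it is not formed at points. The
  supremum m along the vectors \<open>\<eta> n\<close>, each within 1 / (n + 1) of every competitor,
  already dominates |T \<zeta>| for each \<zeta> almost everywhere.\<close>

lemma maximising_sequence_exists:
  obtains m :: "'a \<Rightarrow> real" and K \<eta> where "m \<in> borel_measurable M" "\<And>x. 0 \<le> m x" "\<And>x. m x \<le> K"
    "\<And>n. \<eta> n \<in> unit_ball" "\<And>n. AE x in M. m x \<le> vnf (T (\<eta> n)) x + 1 / real (Suc n)"
    "\<And>\<zeta>. \<zeta> \<in> carrier X \<Longrightarrow> AE x in M. vnf (T \<zeta>) x \<le> m x * vnf \<zeta> x"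
proof -
  obtain K where K: "0 \<le> K" "\<And>\<zeta>. \<zeta> \<in> unit_ball \<Longrightarrow> AE x in M. vnf (T \<zeta>) x \<le> K"
    using T_bounded by metis
  have "\<exists>\<eta>. \<eta> \<in> unit_ball \<and> (\<forall>\<zeta>\<in>unit_ball. AE x in M. vnf (T \<zeta>) x \<le> vnf (T \<eta>) x + 1 / real (Suc n))" for n
    by (rule almost_maximiser_exists[of "1 / real (Suc n)"]) auto
  then have "\<exists>\<eta>. \<forall>n. \<eta> n \<in> unit_ball \<and> (\<forall>\<zeta>\<in>unit_ball. AE x in M. vnf (T \<zeta>) x \<le> vnf (T (\<eta> n)) x + 1 / real (Suc n))"
    by (intro choice) blast
  then obtain \<eta> where \<eta>: "\<And>n. \<eta> n \<in> unit_ball"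
    "\<And>n \<zeta>. \<zeta> \<in> unit_ball \<Longrightarrow> AE x in M. vnf (T \<zeta>) x \<le> vnf (T (\<eta> n)) x + 1 / real (Suc n)" by blast
  have [measurable]: "vnf (T (\<eta> n)) \<in> borel_measurable M" for n using \<eta>(1) by (auto simp: unit_ballD)
  \<comment> \<open>Truncation at K makes the sequence bounded at every point, not just almost
    everywhere, so that \<open>SUP\<close> is a genuine supremum and is measurable.\<close>
  define h where "h n x = min K (vnf (T (\<eta> n)) x)" for n x
  define m where "m x = (SUP n. h n x)" for x
  have bdd: "bdd_above (range (\<lambda>n. h n x))" for x by (rule bdd_aboveI[of _ K]) (auto simp: h_def)
  have hm: "h n x \<le> m x" for n x unfolding m_def by (rule cSUP_upper[OF _ bdd]) simp
  have "0 \<le> m x" for x using hm[of 0 x] K(1) vnf_nonneg[of "T (\<eta> 0)" x] unfolding h_def by linarith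
  moreover have "m x \<le> K" for x unfolding m_def by (rule cSUP_least) (auto simp: h_def)
  moreover have "m \<in> borel_measurable M" unfolding m_def h_def
    by (rule borel_measurable_cSUP) (use bdd in \<open>auto simp: h_def\<close>)
  moreover have "AE x in M. \<forall>n. h n x = vnf (T (\<eta> n)) x"
    unfolding AE_all_countable h_def
  proof
    fix n show "AE x in M. min K (vnf (T (\<eta> n)) x) = vnf (T (\<eta> n)) x"
      using K(2)[OF \<eta>(1)[of n]] by eventually_elim simp
  qed
  note h = this
  have "AE x in M. \<forall>k. vnf (T (\<eta> k)) x \<le> vnf (T (\<eta> n)) x + 1 / real (Suc n)" for n
    unfolding AE_all_countable using \<eta> by blast
  then have mn: "AE x in M. m x \<le> vnf (T (\<eta> n)) x + 1 / real (Suc n)" for n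
    using h
  proof (rule eventually_elim2)
    fix x assume "\<forall>k. vnf (T (\<eta> k)) x \<le> vnf (T (\<eta> n)) x + 1 / real (Suc n)" "\<forall>n. h n x = vnf (T (\<eta> n)) x"
    then show "m x \<le> vnf (T (\<eta> n)) x + 1 / real (Suc n)" unfolding m_def by (intro cSUP_least) auto
  qed
  have "AE x in M. vnf (T \<zeta>) x \<le> m x" if \<zeta>: "\<zeta> \<in> unit_ball" for \<zeta>
  proof -
    have "AE x in M. \<forall>n. vnf (T \<zeta>) x \<le> vnf (T (\<eta> n)) x + 1 / real (Suc n)"
      unfolding AE_all_countable using \<eta> \<zeta> by blast
    then show ?thesis using h
    proof eventually_elim
      case (elim x)
      then have *: "vnf (T \<zeta>) x \<le> m x + 1 / real (Suc n)" for n
        using hm[of n x] by (metis (no_types, lifting) add_right_mono order_trans)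
      have "(\<lambda>n. m x + 1 / real (Suc n)) \<longlonglongrightarrow> m x + 0"
        by (intro tendsto_intros LIMSEQ_Suc lim_1_over_n)
      then show ?case using * by (intro LIMSEQ_le_const[where X = "\<lambda>n. m x + 1 / real (Suc n)"]) auto
    qed
  qed
  then have "AE x in M. vnf (T \<zeta>) x \<le> m x * vnf \<zeta> x" if "\<zeta> \<in> carrier X" for \<zeta>
    using T_dominated[OF that] by blast
  ultimately show thesis using that \<eta>(1) mn by blast
qed

text \<open>Compactness concerns the images: the \<open>\<eta> n\<close> themselves need not have a
  convergent cyclic subsequence. The statement serves the maximising sequence and, later, the
  orthogonal eigenvectors.\<close>

lemma cyclic_limit_exists:
  assumes \<eta>: "\<And>n :: nat. \<eta> n \<in> unit_ball"
  shows "\<exists>\<sigma> \<omega> (\<nu> :: nat \<Rightarrow> nat \<Rightarrow> ('a \<Rightarrow> complex) set). \<omega> \<in> carrier X \<and>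
    (\<lambda>j. norm_inf M ip (\<sigma> j \<ominus>\<^bsub>X\<^esub> \<omega>)) \<longlonglongrightarrow> 0 \<and> (\<forall>j. partition_of_unity M UNIV (\<nu> j)) \<and>
    (AE x in M. \<exists>k. strict_mono k \<and> (\<forall>j. linf_rep (\<nu> j (k j)) x = 1)) \<and>
    (\<forall>j. is_mixing X UNIV (\<nu> j) (\<lambda>n. T (\<eta> n)) (\<sigma> j))"
proof -
  have "relatively_cyclically_compact M X ip (T ` unit_ball)"
    using compact norm_bounded_unit_ball unit_ballD(1) unfolding cyclically_compact_operator_def by blast
  then obtain D where D: "cyclically_compact M X ip D" "T ` unit_ball \<subseteq> D"
    by (auto simp: relatively_cyclically_compact_def)
  have DX: "D \<subseteq> carrier X" using D(1) by (auto simp: cyclically_compact_def cyclic_def)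
  have "range (\<lambda>n. T (\<eta> n)) \<subseteq> D" using D(2) \<eta> by blast
  then obtain \<sigma> \<omega> where \<sigma>: "cyclic_subseq M X ip (\<lambda>n. T (\<eta> n)) \<sigma>" and \<omega>D: "\<omega> \<in> D"
    and conv: "norm_converges M X ip \<sigma> \<omega>"
    using D(1) unfolding cyclically_compact_def by blast
  from \<sigma> obtain \<nu> :: "nat \<Rightarrow> nat \<Rightarrow> ('a \<Rightarrow> complex) set" where part: "\<And>j. partition_of_unity M UNIV (\<nu> j)"
    and inc: "\<And>j m n. \<nu> j m \<otimes>\<^bsub>Linf M\<^esub> \<nu> (Suc j) n \<noteq> \<zero>\<^bsub>Linf M\<^esub> \<Longrightarrow> m < n"
    and mix: "\<And>j. is_mixing X UNIV (\<nu> j) (\<lambda>n. T (\<eta> n)) (\<sigma> j)"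
    unfolding cyclic_subseq_def by blast
  have "AE x in M. \<exists>k. strict_mono k \<and> (\<forall>j. linf_rep (\<nu> j (k j)) x = 1)"
    using part inc by (rule cyclic_partitions_AE)
  moreover have "(\<lambda>j. norm_inf M ip (\<sigma> j \<ominus>\<^bsub>X\<^esub> \<omega>)) \<longlonglongrightarrow> 0" using conv by (simp add: norm_converges_def)
  ultimately show ?thesis using part mix \<omega>D DX by blast
qed

text \<open>With \<open>m\<close> the supremum of \<open>|T \<zeta>|\<close> over the unit ball and \<open>z\<^sub>j\<close> almost maximising,
  \<open>|T\<^sup>2 z\<^sub>j - m\<^sup>2 z\<^sub>j|\<^sup>2 \<le> m\<^sup>2 (m\<^sup>2 - |T z\<^sub>j|\<^sup>2)\<close> tends to \<open>0\<close>; hence every limit \<open>\<omega>\<close> of the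
  \<open>T z\<^sub>j\<close> satisfies \<open>T\<^sup>2 \<omega> = m\<^sup>2 \<omega>\<close> and \<open>|\<omega>| = m\<close>.\<close>

lemma square_eigenvector_exists:
  obtains m :: "'a \<Rightarrow> real" and K \<omega> where "m \<in> borel_measurable M" "\<And>x. 0 \<le> m x" "\<And>x. m x \<le> K"
    "\<And>\<zeta>. \<zeta> \<in> carrier X \<Longrightarrow> AE x in M. vnf (T \<zeta>) x \<le> m x * vnf \<zeta> x"
    "\<omega> \<in> carrier X" "AE x in M. vnf \<omega> x = m x"
    "T (T \<omega>) = linf_class M (\<lambda>x. complex_of_real ((m x)\<^sup>2)) \<odot>\<^bsub>X\<^esub> \<omega>"
proof -
  obtain m :: "'a \<Rightarrow> real" and K \<eta> where m [measurable]: "m \<in> borel_measurable M" and m0: "\<And>x. 0 \<le> m x" and mK: "\<And>x. m x \<le> K"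
    and \<eta>: "\<And>n. \<eta> n \<in> unit_ball" and m\<eta>: "\<And>n. AE x in M. m x \<le> vnf (T (\<eta> n)) x + 1 / real (Suc n)"
    and Tm: "\<And>\<zeta>. \<zeta> \<in> carrier X \<Longrightarrow> AE x in M. vnf (T \<zeta>) x \<le> m x * vnf \<zeta> x"
    by (rule maximising_sequence_exists) blast
  have K0: "0 \<le> K" using m0 mK order_trans by blast
  define S where "S = linf_class M (\<lambda>x. complex_of_real ((m x)\<^sup>2))"
  have b: "(\<lambda>x. complex_of_real ((m x)\<^sup>2)) \<in> carrier (bmeas_ring M)"
    by (rule bmeas_carrierI[of _ _ "K\<^sup>2"]) (auto simp: norm_power m0 mK intro!: power_mono)
  have S: "S \<in> carrier (Linf M)" "AE x in M. linf_rep S x = complex_of_real ((m x)\<^sup>2)"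
    unfolding S_def using b by (auto intro: linf_class_closed linf_rep_class)
  have TK: "AE x in M. vnf (T \<zeta>) x \<le> K * vnf \<zeta> x" if "\<zeta> \<in> carrier X" for \<zeta>
    using Tm[OF that] by eventually_elim (meson mK mult_right_mono order_trans vnf_nonneg)
  from cyclic_limit_exists[of \<eta>] \<eta> obtain \<sigma> \<omega> and \<nu> :: "nat \<Rightarrow> nat \<Rightarrow> ('a \<Rightarrow> complex) set"
    where \<omega>: "\<omega> \<in> carrier X" and conv: "(\<lambda>j. norm_inf M ip (\<sigma> j \<ominus>\<^bsub>X\<^esub> \<omega>)) \<longlonglongrightarrow> 0"
    and part: "\<And>j. partition_of_unity M UNIV (\<nu> j)"
    and kk: "AE x in M. \<exists>k. strict_mono k \<and> (\<forall>j. linf_rep (\<nu> j (k j)) x = 1)"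
    and mix: "\<And>j. is_mixing X UNIV (\<nu> j) (\<lambda>n. T (\<eta> n)) (\<sigma> j)" by blast
  have \<nu>c: "\<nu> j n \<in> carrier (Linf M)" for j n using partition_nabla[OF part] by simp
  \<comment> \<open>Mixing the \<open>\<eta> n\<close> by the partition that produces
    \<open>\<sigma> j\<close> gives a vector z with T z = \<open>\<sigma> j\<close>, since T
    commutes with mixings.\<close>
  have "\<exists>\<zeta>\<in>carrier X. \<forall>n. \<nu> j n \<odot>\<^bsub>X\<^esub> \<zeta> = \<nu> j n \<odot>\<^bsub>X\<^esub> \<eta> n" for j
    by (rule mixing_exists[OF part[of j], of \<eta> 1]) (use \<eta> unit_ballD in auto)
  then obtain z where z: "\<And>j. z j \<in> carrier X" "\<And>j n. \<nu> j n \<odot>\<^bsub>X\<^esub> z j = \<nu> j n \<odot>\<^bsub>X\<^esub> \<eta> n" by metis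
  have \<eta>c: "\<eta> n \<in> carrier X" for n using \<eta> unit_ballD by blast
  have Tz: "\<sigma> j = T (z j)" for j
  proof (rule vec_eq_partitionI[OF part[of j]])
    show "\<sigma> j \<in> carrier X" "T (z j) \<in> carrier X" using mix[of j] z(1) by (auto simp: is_mixing_def)
    fix n show "\<nu> j n \<odot>\<^bsub>X\<^esub> \<sigma> j = \<nu> j n \<odot>\<^bsub>X\<^esub> T (z j)"
      using mix[of j] T_smult[OF \<nu>c z(1), of j n j] T_smult[OF \<nu>c \<eta>c, of j n n] z(2)[of j n]
      by (simp add: is_mixing_def)
  qed
  have zprop: "AE x in M. vnf (z j) x \<le> 1 \<and> m x - vnf (T (z j)) x \<le> 1 / real (Suc j)" for j
  proof -
    have "AE x in M. \<forall>n. linf_rep (\<nu> j n) x \<noteq> 0 \<longrightarrow> vnf (z j) x = vnf (\<eta> n) x"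
      unfolding AE_all_countable using smult_eq_vnf[OF \<nu>c z(1) \<eta>c z(2)] by blast
    moreover have "AE x in M. \<forall>n. linf_rep (\<nu> j n) x \<noteq> 0 \<longrightarrow> vnf (T (z j)) x = vnf (T (\<eta> n)) x"
      unfolding AE_all_countable
    proof
      fix n
      have "\<nu> j n \<odot>\<^bsub>X\<^esub> T (z j) = \<nu> j n \<odot>\<^bsub>X\<^esub> T (\<eta> n)"
        using T_smult[OF \<nu>c z(1), of j n j] T_smult[OF \<nu>c \<eta>c, of j n n] z(2)[of j n] by simp
      then show "AE x in M. linf_rep (\<nu> j n) x \<noteq> 0 \<longrightarrow> vnf (T (z j)) x = vnf (T (\<eta> n)) x"
        using \<nu>c z(1) \<eta>c by (intro smult_eq_vnf) auto
    qed
    moreover have "AE x in M. \<forall>n. vnf (\<eta> n) x \<le> 1 \<and> m x \<le> vnf (T (\<eta> n)) x + 1 / real (Suc n)"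
      unfolding AE_all_countable using unit_ballD(2)[OF \<eta>] m\<eta> by (auto intro: eventually_conj)
    ultimately show ?thesis using kk
    proof eventually_elim
      case (elim x)
      then obtain k where k: "strict_mono k" "\<And>j. linf_rep (\<nu> j (k j)) x = 1" by blast
      \<comment> \<open>At the point x the mixing looks like \<open>\<eta> (k j)\<close>, whose
        index is at least j, so its error is at most 1 / (j + 1).\<close>
      have "j \<le> k j" using k(1) by (rule strict_mono_imp_increasing)
      then have "1 / real (Suc (k j)) \<le> 1 / real (Suc j)" by (intro divide_left_mono) auto
      moreover have "m x \<le> vnf (T (\<eta> (k j))) x + 1 / real (Suc (k j))" "vnf (\<eta> (k j)) x \<le> 1"
        using elim(3) by blast+
      moreover have "vnf (z j) x = vnf (\<eta> (k j)) x" "vnf (T (z j)) x = vnf (T (\<eta> (k j))) x"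
        using elim(1,2) k(2)[of j] by simp_all
      ultimately show ?case by linarith
    qed
  qed
  define e where "e j = norm_inf M ip (\<sigma> j \<ominus>\<^bsub>X\<^esub> \<omega>)" for j
  have e0: "e \<longlonglongrightarrow> 0" using conv by (simp add: e_def[abs_def])
  have eb: "AE x in M. vnf (T (z j) \<ominus>\<^bsub>X\<^esub> \<omega>) x \<le> e j" for j
    unfolding e_def Tz using z(1) \<omega> by (intro vnf_le_norm_inf) auto
  \<comment> \<open>|T z| lies within 1 / (j + 1) of m and within \<open>e j\<close> of
    |\<omega>|.\<close>
  have "AE x in M. \<forall>j. \<bar>vnf \<omega> x - m x\<bar> \<le> e j + 1 / real (Suc j)"
    unfolding AE_all_countable
  proof
    fix j
    show "AE x in M. \<bar>vnf \<omega> x - m x\<bar> \<le> e j + 1 / real (Suc j)"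
      using eb[of j] zprop[of j] Tm[OF z(1)[of j]] vnf_diff[OF T_closed[OF z(1)[of j]] \<omega>]
    proof eventually_elim
      case (elim x)
      have "m x * vnf (z j) x \<le> m x" using elim m0 by (intro mult_left_le) auto
      then show ?case using elim by linarith
    qed
  qed
  then have \<omega>m: "AE x in M. vnf \<omega> x = m x"
  proof eventually_elim
    case (elim x)
    have "(\<lambda>j. e j + 1 / real (Suc j)) \<longlonglongrightarrow> 0 + 0"
      by (intro tendsto_add e0 LIMSEQ_Suc lim_1_over_n)
    then have "\<bar>vnf \<omega> x - m x\<bar> \<le> 0"
      using elim by (intro LIMSEQ_le_const[where X = "\<lambda>j. e j + 1 / real (Suc j)"]) auto
    then show ?case by simp
  qed
  define \<rho> where "\<rho> j = T (T (z j)) \<ominus>\<^bsub>X\<^esub> S \<odot>\<^bsub>X\<^esub> z j" for j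
  have \<rho>: "\<rho> j \<in> carrier X" for j using z(1) S(1) by (simp add: \<rho>_def)
  \<comment> \<open>Self-adjointness turns the mixed term into m^2 |T z|^2. With t = |T z| the
    square is then at most m^2 (m - t) (m + t), where m - t \<le> 1 / (j + 1) and m, t \<le>
    K.\<close>
  have \<rho>b: "AE x in M. vnf (\<rho> j) x \<le> sqrt (2 * K ^ 3 / real (Suc j))" for j
  proof -
    have c: "T (T (z j)) \<in> carrier X" "S \<odot>\<^bsub>X\<^esub> z j \<in> carrier X" "T (z j) \<in> carrier X" using z(1) S(1) by simp_all
    have Tzz: "ipf (T (T (z j))) (z j) = ipf (T (z j)) (T (z j))" using z(1) by (intro T_ip) auto
    from vnf_minus_square[OF c(1,2)] ipf_smult_right[OF S(1) z(1)[of j] c(1)] ipf_self[OF c(3)] S(2)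
      vnf_smult[OF S(1) z(1)[of j]] zprop[of j] Tm[OF z(1)[of j]] Tm[OF c(3)]
    show ?thesis
    proof eventually_elim
      case (elim x)
      define t where "t = vnf (T (z j)) x"
      have t: "0 \<le> t" "t \<le> m x" "m x - t \<le> 1 / real (Suc j)"
        using elim m0[of x] mult_left_le[of "vnf (z j) x" "m x"] by (auto simp: t_def)
      have "(vnf (\<rho> j) x)\<^sup>2 = (vnf (T (T (z j))) x)\<^sup>2 - 2 * ((m x)\<^sup>2 * t\<^sup>2) + ((m x)\<^sup>2 * vnf (z j) x)\<^sup>2"
        using elim Tzz by (simp add: \<rho>_def t_def norm_power m0)
      also have "\<dots> \<le> (m x * t)\<^sup>2 - 2 * ((m x)\<^sup>2 * t\<^sup>2) + ((m x)\<^sup>2 * 1)\<^sup>2"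
        using elim m0[of x] by (intro add_mono diff_mono power_mono mult_left_mono) (auto simp: t_def)
      also have "\<dots> = (m x)\<^sup>2 * ((m x - t) * (m x + t))" by (simp add: power2_eq_square algebra_simps)
      also have "\<dots> \<le> K\<^sup>2 * (1 / real (Suc j) * (K + K))"
        using t m0[of x] mK[of x] K0 by (intro mult_mono power_mono mult_nonneg_nonneg add_mono) auto
      also have "\<dots> = 2 * K ^ 3 / real (Suc j)" by (simp add: power2_eq_square power3_eq_cube)
      finally show ?case by (rule real_le_rsqrt)
    qed
  qed
  \<comment> \<open>The three terms estimate the pieces of T^2 \<omega> - m^2 \<omega> = T^2
    (\<omega> - T z) + T \<rho> + m^2 (T z - \<omega>), with \<open>e j\<close> the distance of T z
    from \<omega>.\<close>
  define r where "r j = K * (K * e j) + K * sqrt (2 * K ^ 3 / real (Suc j)) + K\<^sup>2 * e j" for j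
  have r0: "r \<longlonglongrightarrow> 0"
  proof -
    have "(\<lambda>j. sqrt (2 * K ^ 3 * (1 / real (Suc j)))) \<longlonglongrightarrow> sqrt (2 * K ^ 3 * 0)"
      by (intro tendsto_intros LIMSEQ_Suc lim_1_over_n)
    then have "r \<longlonglongrightarrow> K * (K * 0) + K * 0 + K\<^sup>2 * 0"
      unfolding r_def[abs_def] by (intro tendsto_intros e0) simp
    then show ?thesis by simp
  qed
  have S\<omega>: "S \<odot>\<^bsub>X\<^esub> \<omega> \<in> carrier X" "T (T \<omega>) \<in> carrier X" using S(1) \<omega> by auto
  have bound: "AE x in M. vnf (T (T \<omega>) \<ominus>\<^bsub>X\<^esub> S \<odot>\<^bsub>X\<^esub> \<omega>) x \<le> r j" for j
  proof -
    define d where "d = \<omega> \<ominus>\<^bsub>X\<^esub> T (z j)"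
    define d' where "d' = T (z j) \<ominus>\<^bsub>X\<^esub> \<omega>"
    have c: "d \<in> carrier X" "d' \<in> carrier X" "T d \<in> carrier X" "T (T d) \<in> carrier X" "T (\<rho> j) \<in> carrier X" "S \<odot>\<^bsub>X\<^esub> d' \<in> carrier X"
      "T (T d) \<oplus>\<^bsub>X\<^esub> T (\<rho> j) \<in> carrier X" "T (z j) \<in> carrier X" "T (T (z j)) \<in> carrier X" "T (T (T (z j))) \<in> carrier X"
      "S \<odot>\<^bsub>X\<^esub> z j \<in> carrier X" "S \<odot>\<^bsub>X\<^esub> T (z j) \<in> carrier X"
      using z(1) \<omega> \<rho> S(1) by (auto simp: d_def d'_def)
    have Td: "T (T d) = T (T \<omega>) \<ominus>\<^bsub>X\<^esub> T (T (T (z j)))" using \<omega> c by (simp add: d_def T_minus)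
    have T\<rho>: "T (\<rho> j) = T (T (T (z j))) \<ominus>\<^bsub>X\<^esub> S \<odot>\<^bsub>X\<^esub> T (z j)"
      using z(1)[of j] c S(1) by (simp add: \<rho>_def T_minus T_smult)
    have eq: "T (T \<omega>) \<ominus>\<^bsub>X\<^esub> S \<odot>\<^bsub>X\<^esub> \<omega> = (T (T d) \<oplus>\<^bsub>X\<^esub> T (\<rho> j)) \<oplus>\<^bsub>X\<^esub> S \<odot>\<^bsub>X\<^esub> d'"
    proof (rule vec_eqI)
      fix \<zeta> assume \<zeta>: "\<zeta> \<in> carrier X"
      from ipf_minus_left[OF S\<omega>(2,1) \<zeta>] ipf_add_left[OF c(7,6) \<zeta>] ipf_add_left[OF c(4,5) \<zeta>]
        ipf_smult_left[OF S(1) c(2) \<zeta>] ipf_smult_left[OF S(1) \<omega> \<zeta>] ipf_smult_left[OF S(1) c(8) \<zeta>]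
        ipf_minus_left[OF c(8) \<omega> \<zeta>, folded d'_def]
        ipf_minus_left[OF S\<omega>(2) c(10) \<zeta>, folded Td] ipf_minus_left[OF c(10,12) \<zeta>, folded T\<rho>]
      show "AE x in M. ipf (T (T \<omega>) \<ominus>\<^bsub>X\<^esub> S \<odot>\<^bsub>X\<^esub> \<omega>) \<zeta> x = ipf (T (T d) \<oplus>\<^bsub>X\<^esub> T (\<rho> j) \<oplus>\<^bsub>X\<^esub> S \<odot>\<^bsub>X\<^esub> d') \<zeta> x"
        by eventually_elim (simp add: right_diff_distrib)
    qed (use S\<omega> c in auto)
    from vnf_add[OF c(7,6)] vnf_add[OF c(4,5)] TK[OF c(3)] TK[OF c(1)] TK[OF \<rho>[of j]] \<rho>b[of j]
      vnf_smult[OF S(1) c(2)] S(2) eb[of j, folded d'_def]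
      vnf_minus_commute[OF \<omega> c(8), folded d_def d'_def]
    show ?thesis unfolding eq
    proof eventually_elim
      case (elim x)
      have "K * vnf d x \<le> K * e j" using elim K0 by (simp add: mult_left_mono)
      then have "K * vnf (T d) x \<le> K * (K * e j)" using elim(4) K0 by (intro mult_left_mono) linarith+
      then have "vnf (T (T d)) x \<le> K * (K * e j)" using elim(3) by linarith
      moreover have "K * vnf (\<rho> j) x \<le> K * sqrt (2 * K ^ 3 / real (Suc j))"
        using elim(6) K0 by (rule mult_left_mono)
      then have "vnf (T (\<rho> j)) x \<le> K * sqrt (2 * K ^ 3 / real (Suc j))" using elim(5) by linarith
      moreover have "vnf (S \<odot>\<^bsub>X\<^esub> d') x \<le> K\<^sup>2 * e j"
        unfolding elim(7,8) using elim(9) m0[of x] mK[of x] by (auto simp: norm_power intro!: mult_mono power_mono)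
      ultimately show ?case using elim(1,2) unfolding r_def by linarith
    qed
  qed
  then have "AE x in M. \<forall>j. vnf (T (T \<omega>) \<ominus>\<^bsub>X\<^esub> S \<odot>\<^bsub>X\<^esub> \<omega>) x \<le> r j" by (simp add: AE_all_countable)
  then have "AE x in M. vnf (T (T \<omega>) \<ominus>\<^bsub>X\<^esub> S \<odot>\<^bsub>X\<^esub> \<omega>) x = 0"
  proof eventually_elim
    case (elim x)
    then have "vnf (T (T \<omega>) \<ominus>\<^bsub>X\<^esub> S \<odot>\<^bsub>X\<^esub> \<omega>) x \<le> 0" by (intro LIMSEQ_le_const[OF r0]) auto
    then show ?case by (simp add: antisym)
  qed
  then have "T (T \<omega>) = S \<odot>\<^bsub>X\<^esub> \<omega>" by (rule vec_eqI'[OF S\<omega>(2,1)])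
  then show thesis using that[of m K \<omega>] m m0 mK Tm \<omega> \<omega>m unfolding S_def by blast
qed

text \<open>\<open>T \<omega> + m \<omega>\<close> and \<open>T \<omega> - m \<omega>\<close> are eigenvectors for \<open>m\<close> and \<open>-m\<close> which do not vanish
  simultaneously where \<open>m \<noteq> 0\<close>: the first is used on its support, the second elsewhere.\<close>

lemma dominant_eigenvector_exists: "\<exists>\<xi> l. dominant_eigenvector T \<xi> l"
proof -
  obtain m :: "'a \<Rightarrow> real" and K \<omega> where m [measurable]: "m \<in> borel_measurable M" and m0: "\<And>x. 0 \<le> m x" and mK: "\<And>x. m x \<le> K"
    and Tm: "\<And>\<zeta>. \<zeta> \<in> carrier X \<Longrightarrow> AE x in M. vnf (T \<zeta>) x \<le> m x * vnf \<zeta> x"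
    and \<omega>: "\<omega> \<in> carrier X" and \<omega>m: "AE x in M. vnf \<omega> x = m x"
    and TT: "T (T \<omega>) = linf_class M (\<lambda>x. complex_of_real ((m x)\<^sup>2)) \<odot>\<^bsub>X\<^esub> \<omega>"
    by (rule square_eigenvector_exists) blast
  define S where "S = linf_class M (\<lambda>x. complex_of_real ((m x)\<^sup>2))"
  have "(\<lambda>x. complex_of_real ((m x)\<^sup>2)) \<in> carrier (bmeas_ring M)"
    by (rule bmeas_carrierI[of _ _ "K\<^sup>2"]) (auto simp: norm_power m0 mK intro!: power_mono)
  then have S: "S \<in> carrier (Linf M)" "AE x in M. linf_rep S x = complex_of_real ((m x)\<^sup>2)"
    unfolding S_def by (auto intro: linf_class_closed linf_rep_class)
  define \<mu> where "\<mu> = linf_class M (\<lambda>x. complex_of_real (m x))"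
  have "(\<lambda>x. complex_of_real (m x)) \<in> carrier (bmeas_ring M)"
    by (rule bmeas_carrierI[of _ _ K]) (auto simp: m0 mK)
  then have \<mu>: "\<mu> \<in> carrier (Linf M)" "AE x in M. linf_rep \<mu> x = complex_of_real (m x)"
    unfolding \<mu>_def by (auto intro: linf_class_closed linf_rep_class)
  define u where "u = T \<omega> \<oplus>\<^bsub>X\<^esub> \<mu> \<odot>\<^bsub>X\<^esub> \<omega>"
  define v where "v = T \<omega> \<ominus>\<^bsub>X\<^esub> \<mu> \<odot>\<^bsub>X\<^esub> \<omega>"
  have c: "T \<omega> \<in> carrier X" "\<mu> \<odot>\<^bsub>X\<^esub> \<omega> \<in> carrier X" "S \<odot>\<^bsub>X\<^esub> \<omega> \<in> carrier X" "\<mu> \<odot>\<^bsub>X\<^esub> T \<omega> \<in> carrier X"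
    using \<omega> \<mu>(1) S(1) by auto
  have u [measurable]: "u \<in> carrier X" and v: "v \<in> carrier X" using c by (auto simp: u_def v_def)
  have Tu: "T u = S \<odot>\<^bsub>X\<^esub> \<omega> \<oplus>\<^bsub>X\<^esub> \<mu> \<odot>\<^bsub>X\<^esub> T \<omega>" and Tv: "T v = S \<odot>\<^bsub>X\<^esub> \<omega> \<ominus>\<^bsub>X\<^esub> \<mu> \<odot>\<^bsub>X\<^esub> T \<omega>"
    using TT[folded S_def] \<omega> \<mu>(1) c by (simp_all add: u_def v_def T_add T_minus T_smult)
  \<comment> \<open>(T - m) u = T^2 \<omega> - m^2 \<omega> = 0, and likewise (T + m) v = 0.\<close>
  have ipTu: "AE x in M. ipf (T u) \<zeta> x = complex_of_real (m x) * ipf u \<zeta> x" if \<zeta>: "\<zeta> \<in> carrier X" for \<zeta>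
    using ipf_add_left[OF c(3,4) \<zeta>] ipf_smult_left[OF S(1) \<omega> \<zeta>] ipf_smult_left[OF \<mu>(1) c(1) \<zeta>] S(2) \<mu>(2)
      ipf_add_left[OF c(1,2) \<zeta>] ipf_smult_left[OF \<mu>(1) \<omega> \<zeta>]
    unfolding Tu unfolding u_def by eventually_elim (simp add: algebra_simps power2_eq_square)
  have ipTv: "AE x in M. ipf (T v) \<zeta> x = - complex_of_real (m x) * ipf v \<zeta> x" if \<zeta>: "\<zeta> \<in> carrier X" for \<zeta>
    using ipf_minus_left[OF c(3,4) \<zeta>] ipf_smult_left[OF S(1) \<omega> \<zeta>] ipf_smult_left[OF \<mu>(1) c(1) \<zeta>] S(2) \<mu>(2)
      ipf_minus_left[OF c(1,2) \<zeta>] ipf_smult_left[OF \<mu>(1) \<omega> \<zeta>]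
    unfolding Tv unfolding v_def by eventually_elim (simp add: right_diff_distrib power2_eq_square mult.assoc)
  define A where "A = {x \<in> space M. vnf u x \<noteq> 0}"
  have A [measurable]: "A \<in> sets M" unfolding A_def by measurable
  define l where "l = linf_class M (\<lambda>x. complex_of_real (if x \<in> A then m x else - m x))"
  have "(\<lambda>x. complex_of_real (if x \<in> A then m x else - m x)) \<in> carrier (bmeas_ring M)"
    by (rule bmeas_carrierI[of _ _ K]) (auto simp: m0 mK)
  then have l: "l \<in> carrier (Linf M)" "AE x in M. linf_rep l x = complex_of_real (if x \<in> A then m x else - m x)"
    unfolding l_def by (intro linf_class_closed linf_rep_class; assumption)+
  define p where "p = linf_ind M A"
  define q where "q = linf_ind M (space M - A)"
  have p: "p \<in> carrier (Linf M)" "AE x in M. linf_rep p x = (if x \<in> A then 1 else 0)"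
    unfolding p_def using linf_rep_ind[OF A] by (auto simp: indicator_def)
  have q: "q \<in> carrier (Linf M)" "AE x in M. linf_rep q x = (if x \<in> A then 0 else 1)"
    unfolding q_def using linf_rep_ind[of "space M - A" M] A AE_space
    by (auto elim!: eventually_elim2)
  define w where "w = p \<odot>\<^bsub>X\<^esub> u \<oplus>\<^bsub>X\<^esub> q \<odot>\<^bsub>X\<^esub> v"
  have c2: "p \<odot>\<^bsub>X\<^esub> u \<in> carrier X" "q \<odot>\<^bsub>X\<^esub> v \<in> carrier X" "p \<odot>\<^bsub>X\<^esub> T u \<in> carrier X" "q \<odot>\<^bsub>X\<^esub> T v \<in> carrier X"
    "T u \<in> carrier X" "T v \<in> carrier X"
    using u v p(1) q(1) by auto
  have w: "w \<in> carrier X" using c2 by (simp add: w_def)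
  have Tw: "T w = p \<odot>\<^bsub>X\<^esub> T u \<oplus>\<^bsub>X\<^esub> q \<odot>\<^bsub>X\<^esub> T v"
    using u v p(1) q(1) c2 by (simp add: w_def T_add T_smult)
  have ipw: "AE x in M. ipf w \<zeta> x = (if x \<in> A then ipf u \<zeta> x else ipf v \<zeta> x)" if \<zeta>: "\<zeta> \<in> carrier X" for \<zeta>
    using ipf_add_left[OF c2(1,2) \<zeta>] ipf_smult_left[OF p(1) u \<zeta>] ipf_smult_left[OF q(1) v \<zeta>] p(2) q(2)
    unfolding w_def by eventually_elim simp
  have Tw_l: "T w = l \<odot>\<^bsub>X\<^esub> w"
  proof (rule vec_eqI)
    fix \<zeta> assume \<zeta>: "\<zeta> \<in> carrier X"
    from ipf_add_left[OF c2(3,4) \<zeta>] ipf_smult_left[OF p(1) c2(5) \<zeta>] ipf_smult_left[OF q(1) c2(6) \<zeta>] p(2) q(2)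
      ipTu[OF \<zeta>] ipTv[OF \<zeta>] ipf_smult_left[OF l(1) w \<zeta>] l(2) ipw[OF \<zeta>]
    show "AE x in M. ipf (T w) \<zeta> x = ipf (l \<odot>\<^bsub>X\<^esub> w) \<zeta> x"
      unfolding Tw by eventually_elim simp
  qed (use w l in auto)
  have vw: "AE x in M. vnf w x = (if x \<in> A then vnf u x else vnf v x)"
  proof -
    have "p \<odot>\<^bsub>X\<^esub> w = p \<odot>\<^bsub>X\<^esub> u"
    proof (rule vec_eqI)
      fix \<zeta> assume \<zeta>: "\<zeta> \<in> carrier X"
      from ipf_smult_left[OF p(1) w \<zeta>] ipf_smult_left[OF p(1) u \<zeta>] ipw[OF \<zeta>] p(2)
      show "AE x in M. ipf (p \<odot>\<^bsub>X\<^esub> w) \<zeta> x = ipf (p \<odot>\<^bsub>X\<^esub> u) \<zeta> x" by eventually_elim auto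
    qed (use w p u in auto)
    moreover have "q \<odot>\<^bsub>X\<^esub> w = q \<odot>\<^bsub>X\<^esub> v"
    proof (rule vec_eqI)
      fix \<zeta> assume \<zeta>: "\<zeta> \<in> carrier X"
      from ipf_smult_left[OF q(1) w \<zeta>] ipf_smult_left[OF q(1) v \<zeta>] ipw[OF \<zeta>] q(2)
      show "AE x in M. ipf (q \<odot>\<^bsub>X\<^esub> w) \<zeta> x = ipf (q \<odot>\<^bsub>X\<^esub> v) \<zeta> x" by eventually_elim auto
    qed (use w q v in auto)
    ultimately have "AE x in M. linf_rep p x \<noteq> 0 \<longrightarrow> vnf w x = vnf u x"
      "AE x in M. linf_rep q x \<noteq> 0 \<longrightarrow> vnf w x = vnf v x"
      using smult_eq_vnf[OF p(1) w u] smult_eq_vnf[OF q(1) w v] by simp_all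
    then show ?thesis using p(2) q(2) by eventually_elim auto
  qed
  \<comment> \<open>|u| + |v| \<ge> |u - v| = 2 m |\<omega>| = 2 m^2 shows that u and v do not
    vanish together where m is nonzero. Where m = 0 both vanish, because |T \<omega>| \<le> m
    |\<omega>|.\<close>
  have supp: "AE x in M. vnf w x = 0 \<longleftrightarrow> m x = 0"
  proof -
    have "AE x in M. vnf u x + vnf v x \<ge> 2 * (m x * vnf \<omega> x)"
    proof -
      have "u \<ominus>\<^bsub>X\<^esub> v = \<mu> \<odot>\<^bsub>X\<^esub> \<omega> \<oplus>\<^bsub>X\<^esub> \<mu> \<odot>\<^bsub>X\<^esub> \<omega>"
      proof (rule vec_eqI)
        fix \<zeta> assume \<zeta>: "\<zeta> \<in> carrier X"
        from ipf_minus_left[OF u v \<zeta>] ipf_add_left[OF c(1,2) \<zeta>, folded u_def] ipf_minus_left[OF c(1,2) \<zeta>, folded v_def]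
          ipf_add_left[OF c(2,2) \<zeta>]
        show "AE x in M. ipf (u \<ominus>\<^bsub>X\<^esub> v) \<zeta> x = ipf (\<mu> \<odot>\<^bsub>X\<^esub> \<omega> \<oplus>\<^bsub>X\<^esub> \<mu> \<odot>\<^bsub>X\<^esub> \<omega>) \<zeta> x" by eventually_elim simp
      qed (use u v c in auto)
      then have eq: "u \<ominus>\<^bsub>X\<^esub> v = (\<mu> \<oplus>\<^bsub>Linf M\<^esub> \<mu>) \<odot>\<^bsub>X\<^esub> \<omega>" using \<mu>(1) \<omega> by (simp add: smult_l_distr)
      from vnf_minus[OF u v] vnf_smult[OF linf_add_closed[OF \<mu>(1) \<mu>(1)] \<omega>] linf_rep_add[OF \<mu>(1) \<mu>(1)] \<mu>(2)
      show ?thesis unfolding eq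
        by eventually_elim (simp add: m0 abs_of_nonneg flip: of_real_add)
    qed
    moreover have "AE x in M. vnf u x \<le> m x * vnf \<omega> x + m x * vnf \<omega> x"
      using vnf_add[OF c(1,2), folded u_def] Tm[OF \<omega>] vnf_smult[OF \<mu>(1) \<omega>] \<mu>(2)
      by eventually_elim (simp add: m0)
    moreover have "AE x in M. vnf v x \<le> m x * vnf \<omega> x + m x * vnf \<omega> x"
      using vnf_minus[OF c(1,2), folded v_def] Tm[OF \<omega>] vnf_smult[OF \<mu>(1) \<omega>] \<mu>(2)
      by eventually_elim (simp add: m0)
    ultimately show ?thesis using vw \<omega>m AE_space
    proof eventually_elim
      case (elim x)
      show ?case
      proof (cases "m x = 0")
        case True
        then have "vnf u x = 0" "vnf v x = 0" using elim vnf_nonneg[of u x] vnf_nonneg[of v x] by auto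
        then show ?thesis using elim True by auto
      next
        case False
        then have "0 < m x * m x" using m0[of x] by (simp add: less_le)
        then have "vnf u x = 0 \<Longrightarrow> vnf v x \<noteq> 0" using elim by auto
        then show ?thesis using elim False by (auto simp: A_def)
      qed
    qed
  qed
  obtain \<xi> where \<xi>: "\<xi> \<in> carrier X" "AE x in M. vnf \<xi> x = (if vnf w x = 0 then 0 else 1)"
    "w = vec_norm M ip w \<odot>\<^bsub>X\<^esub> \<xi>" by (rule polar_decomposition[OF w])
  note n = vec_norm_closed[OF w]
  have l\<xi>: "l \<odot>\<^bsub>X\<^esub> \<xi> \<in> carrier X" "T \<xi> \<in> carrier X" using l \<xi> by auto
  \<comment> \<open>The eigenvalue equation for w = |w| \<xi> only gives |w| (T \<xi> - l \<xi>) =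
    0. Where |w| = 0 the vector \<xi> vanishes, and T \<xi> with it by the bound |T \<xi>| \<le> m
    |\<xi>|.\<close>
  have "T \<xi> = l \<odot>\<^bsub>X\<^esub> \<xi>"
  proof (rule vec_eqI'[OF l\<xi>(2,1)])
    have "vec_norm M ip w \<odot>\<^bsub>X\<^esub> (T \<xi> \<ominus>\<^bsub>X\<^esub> l \<odot>\<^bsub>X\<^esub> \<xi>) = \<zero>\<^bsub>X\<^esub>"
    proof (rule vec_eqI)
      fix \<zeta> assume \<zeta>: "\<zeta> \<in> carrier X"
      have d: "T \<xi> \<ominus>\<^bsub>X\<^esub> l \<odot>\<^bsub>X\<^esub> \<xi> \<in> carrier X" using l\<xi> by simp
      have "T w = vec_norm M ip w \<odot>\<^bsub>X\<^esub> T \<xi>" using \<xi>(3) T_smult[OF n \<xi>(1)] by simp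
      then have "AE x in M. ipf (T w) \<zeta> x = linf_rep (vec_norm M ip w) x * ipf (T \<xi>) \<zeta> x"
        using ipf_smult_left[OF n l\<xi>(2) \<zeta>] by simp
      moreover have "AE x in M. ipf w \<zeta> x = linf_rep (vec_norm M ip w) x * ipf \<xi> \<zeta> x"
        using ipf_smult_left[OF n \<xi>(1) \<zeta>] \<xi>(3) by simp
      ultimately show "AE x in M. ipf (vec_norm M ip w \<odot>\<^bsub>X\<^esub> (T \<xi> \<ominus>\<^bsub>X\<^esub> l \<odot>\<^bsub>X\<^esub> \<xi>)) \<zeta> x = ipf \<zero>\<^bsub>X\<^esub> \<zeta> x"
        using ipf_smult_left[OF n d \<zeta>] ipf_minus_left[OF l\<xi>(2,1) \<zeta>] ipf_smult_left[OF l(1) \<xi>(1) \<zeta>]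
          ipf_smult_left[OF l(1) w \<zeta>, folded Tw_l] ipf_zero_left[OF \<zeta>]
      proof eventually_elim
        case (elim x)
        then have "linf_rep (vec_norm M ip w) x * ipf (T \<xi>) \<zeta> x = linf_rep l x * (linf_rep (vec_norm M ip w) x * ipf \<xi> \<zeta> x)"
          by metis
        with elim show ?case by (simp add: right_diff_distrib mult.left_commute)
      qed
    qed (use n l\<xi> in auto)
    with vnf_smult[OF n M.minus_closed[OF l\<xi>(2,1)]] vnf_zero
    have "AE x in M. cmod (linf_rep (vec_norm M ip w) x) * vnf (T \<xi> \<ominus>\<^bsub>X\<^esub> l \<odot>\<^bsub>X\<^esub> \<xi>) x = 0" by auto
    then show "AE x in M. vnf (T \<xi> \<ominus>\<^bsub>X\<^esub> l \<odot>\<^bsub>X\<^esub> \<xi>) x = 0"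
      using vec_norm_AE[OF w] \<xi>(2) vnf_minus[OF l\<xi>(2,1)] Tm[OF \<xi>(1)] vnf_smult[OF l(1) \<xi>(1)]
    proof eventually_elim
      case (elim x)
      have "vnf (T \<xi> \<ominus>\<^bsub>X\<^esub> l \<odot>\<^bsub>X\<^esub> \<xi>) x \<le> 0" if "vnf w x = 0" using elim that by simp
      then show ?case using elim by (cases "vnf w x = 0") (auto intro: antisym)
    qed
  qed
  moreover have "AE x in M. Im (linf_rep l x) = 0" using l(2) by eventually_elim simp
  moreover have "AE x in M. vnf \<xi> x = (if linf_rep l x = 0 then 0 else 1)"
    using l(2) \<xi>(2) supp by eventually_elim auto
  moreover have "AE x in M. vnf (T \<zeta>) x \<le> cmod (linf_rep l x) * vnf \<zeta> x" if "\<zeta> \<in> carrier X" for \<zeta>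
    using Tm[OF that] l(2) by eventually_elim (simp add: m0 split: if_splits)
  ultimately show ?thesis using \<xi>(1) l(1) unfolding dominant_eigenvector_def by blast
qed

text \<open>T' is T composed with the map P that removes the component along \<xi>, and it equals T
  minus the rank-one operator l \<xi> \<otimes> \<xi>. The first form gives compactness and the norm
  bound, since P does not increase norms; the second form, symmetric because l is real, gives
  self-adjointness.\<close>

lemma deflation:
  assumes dom: "dominant_eigenvector T \<xi> l"
  defines "T' \<equiv> \<lambda>\<eta>. T (\<eta> \<ominus>\<^bsub>X\<^esub> ip \<eta> \<xi> \<odot>\<^bsub>X\<^esub> \<xi>)"
  shows "compact_self_adjoint M X ip T'"
    and "\<And>\<eta>. \<eta> \<in> carrier X \<Longrightarrow> AE x in M. vnf (T' \<eta>) x \<le> cmod (linf_rep l x) * vnf \<eta> x"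
    and "\<And>\<eta> \<zeta>. \<eta> \<in> carrier X \<Longrightarrow> \<zeta> \<in> carrier X \<Longrightarrow>
      AE x in M. ipf (T' \<eta>) \<zeta> x = ipf (T \<eta>) \<zeta> x - linf_rep l x * ipf \<eta> \<xi> x * ipf \<xi> \<zeta> x"
proof -
  have \<xi>: "\<xi> \<in> carrier X" and l: "l \<in> carrier (Linf M)" and T\<xi>: "T \<xi> = l \<odot>\<^bsub>X\<^esub> \<xi>"
    and re: "AE x in M. Im (linf_rep l x) = 0"
    and v\<xi>: "AE x in M. vnf \<xi> x = (if linf_rep l x = 0 then 0 else 1)"
    and Tl: "\<And>\<zeta>. \<zeta> \<in> carrier X \<Longrightarrow> AE x in M. vnf (T \<zeta>) x \<le> cmod (linf_rep l x) * vnf \<zeta> x"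
    using dom by (auto simp: dominant_eigenvector_def)
  define P where "P \<eta> = \<eta> \<ominus>\<^bsub>X\<^esub> ip \<eta> \<xi> \<odot>\<^bsub>X\<^esub> \<xi>" for \<eta>
  have c: "ip \<eta> \<xi> \<in> carrier (Linf M)" "ip \<eta> \<xi> \<odot>\<^bsub>X\<^esub> \<xi> \<in> carrier X" "P \<eta> \<in> carrier X" "T' \<eta> \<in> carrier X"
    if "\<eta> \<in> carrier X" for \<eta>
    using that \<xi> ip_closed by (auto simp: P_def T'_def)
  \<comment> \<open>With b = <\<eta>,\<xi>> one has |\<eta> - b \<xi>|^2 = |\<eta>|^2 - 2 |b|^2 +
    |b|^2 |\<xi>|^2, and |\<xi>| \<le> 1 suffices: \<xi> may vanish on a part of the space.\<close>
  have vP: "AE x in M. vnf (P \<eta>) x \<le> vnf \<eta> x" if \<eta>: "\<eta> \<in> carrier X" for \<eta>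
    using vnf_minus_square[OF \<eta> c(2)[OF \<eta>]] ipf_smult_right[OF c(1)[OF \<eta>] \<xi> \<eta>]
      vnf_smult[OF c(1)[OF \<eta>] \<xi>] v\<xi> unfolding P_def[symmetric]
  proof eventually_elim
    case (elim x)
    define b where "b = ipf \<eta> \<xi> x"
    have "Re (cnj b * b) = (cmod b)\<^sup>2"
      by (metis Re_complex_of_real complex_norm_square mult.commute)
    then have "(vnf (P \<eta>) x)\<^sup>2 = (vnf \<eta> x)\<^sup>2 - 2 * (cmod b)\<^sup>2 + (cmod b * vnf \<xi> x)\<^sup>2"
      using elim by (simp add: b_def ipf_def)
    also have "(cmod b * vnf \<xi> x)\<^sup>2 \<le> (cmod b)\<^sup>2" using elim by simp
    finally have "(vnf (P \<eta>) x)\<^sup>2 \<le> (vnf \<eta> x)\<^sup>2" using zero_le_power2[of "cmod b"] by linarith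
    then show ?case by (rule power2_le_imp_le) simp
  qed
  show formula: "AE x in M. ipf (T' \<eta>) \<zeta> x = ipf (T \<eta>) \<zeta> x - linf_rep l x * ipf \<eta> \<xi> x * ipf \<xi> \<zeta> x"
    if \<eta>: "\<eta> \<in> carrier X" and \<zeta>: "\<zeta> \<in> carrier X" for \<eta> \<zeta>
  proof -
    have l\<xi>: "l \<odot>\<^bsub>X\<^esub> \<xi> \<in> carrier X" "ip \<eta> \<xi> \<odot>\<^bsub>X\<^esub> (l \<odot>\<^bsub>X\<^esub> \<xi>) \<in> carrier X" using l \<xi> c(1)[OF \<eta>] by auto
    have "T' \<eta> = T \<eta> \<ominus>\<^bsub>X\<^esub> ip \<eta> \<xi> \<odot>\<^bsub>X\<^esub> (l \<odot>\<^bsub>X\<^esub> \<xi>)"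
      using T_minus[OF \<eta> c(2)[OF \<eta>]] T_smult[OF c(1)[OF \<eta>] \<xi>] T\<xi> by (simp add: T'_def)
    then show ?thesis
      using ipf_minus_left[OF T_closed[OF \<eta>] l\<xi>(2) \<zeta>] ipf_smult_left[OF c(1)[OF \<eta>] l\<xi>(1) \<zeta>]
        ipf_smult_left[OF l \<xi> \<zeta>]
      by simp (elim AE_mp, simp add: ipf_def mult.left_commute)
  qed
  show "AE x in M. vnf (T' \<eta>) x \<le> cmod (linf_rep l x) * vnf \<eta> x" if \<eta>: "\<eta> \<in> carrier X" for \<eta>
    using Tl[OF c(3)[OF \<eta>]] vP[OF \<eta>] unfolding T'_def P_def
    by eventually_elim (meson mult_left_mono norm_ge_zero order_trans)
  have "Linf_linear M X T'" unfolding Linf_linear_def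
  proof (intro conjI ballI)
    fix \<eta> \<theta> assume \<eta>: "\<eta> \<in> carrier X" and \<theta>: "\<theta> \<in> carrier X"
    show "T' (\<eta> \<oplus>\<^bsub>X\<^esub> \<theta>) = T' \<eta> \<oplus>\<^bsub>X\<^esub> T' \<theta>"
    proof (rule vec_eqI)
      fix \<zeta> assume \<zeta>: "\<zeta> \<in> carrier X"
      have s: "\<eta> \<oplus>\<^bsub>X\<^esub> \<theta> \<in> carrier X" using \<eta> \<theta> by simp
      have "AE x in M. ipf (T (\<eta> \<oplus>\<^bsub>X\<^esub> \<theta>)) \<zeta> x = ipf (T \<eta>) \<zeta> x + ipf (T \<theta>) \<zeta> x"
        unfolding T_add[OF \<eta> \<theta>] using \<eta> \<theta> \<zeta> by (intro ipf_add_left) auto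
      with formula[OF s \<zeta>] formula[OF \<eta> \<zeta>] formula[OF \<theta> \<zeta>] ipf_add_left[OF \<eta> \<theta> \<xi>]
        ipf_add_left[OF c(4)[OF \<eta>] c(4)[OF \<theta>] \<zeta>]
      show "AE x in M. ipf (T' (\<eta> \<oplus>\<^bsub>X\<^esub> \<theta>)) \<zeta> x = ipf (T' \<eta> \<oplus>\<^bsub>X\<^esub> T' \<theta>) \<zeta> x"
        by eventually_elim (simp add: distrib_left distrib_right)
    qed (use c \<eta> \<theta> in auto)
  next
    fix a \<eta> assume a: "a \<in> carrier (Linf M)" and \<eta>: "\<eta> \<in> carrier X"
    show "T' (a \<odot>\<^bsub>X\<^esub> \<eta>) = a \<odot>\<^bsub>X\<^esub> T' \<eta>"
    proof (rule vec_eqI)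
      fix \<zeta> assume \<zeta>: "\<zeta> \<in> carrier X"
      have s: "a \<odot>\<^bsub>X\<^esub> \<eta> \<in> carrier X" using \<eta> a by simp
      have "AE x in M. ipf (T (a \<odot>\<^bsub>X\<^esub> \<eta>)) \<zeta> x = linf_rep a x * ipf (T \<eta>) \<zeta> x"
        unfolding T_smult[OF a \<eta>] using a \<eta> \<zeta> by (intro ipf_smult_left) auto
      with formula[OF s \<zeta>] formula[OF \<eta> \<zeta>] ipf_smult_left[OF a \<eta> \<xi>] ipf_smult_left[OF a c(4)[OF \<eta>] \<zeta>]
      show "AE x in M. ipf (T' (a \<odot>\<^bsub>X\<^esub> \<eta>)) \<zeta> x = ipf (a \<odot>\<^bsub>X\<^esub> T' \<eta>) \<zeta> x"
        by eventually_elim (simp add: right_diff_distrib mult.left_commute)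
    qed (use c \<eta> a in auto)
  qed (use c in auto)
  moreover have "relatively_cyclically_compact M X ip (T' ` C)" if C: "C \<subseteq> carrier X" "norm_bounded M ip C" for C
  proof -
    obtain K where K: "0 \<le> K" "\<And>\<eta>. \<eta> \<in> C \<Longrightarrow> AE x in M. vnf \<eta> x \<le> K"
      using C(2,1) by (rule norm_boundedE) blast
    have "P ` C \<subseteq> carrier X" using C c(3) by blast
    moreover have "norm_bounded M ip (P ` C)"
    proof (rule norm_boundedI[OF calculation K(1)])
      fix \<theta> assume "\<theta> \<in> P ` C"
      then obtain \<eta> where \<eta>: "\<eta> \<in> C" "\<theta> = P \<eta>" by blast
      with C have "\<eta> \<in> carrier X" by blast
      from vP[OF this] K(2)[OF \<eta>(1)] show "AE x in M. vnf \<theta> x \<le> K"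
        unfolding \<eta>(2) by eventually_elim simp
    qed
    ultimately have "relatively_cyclically_compact M X ip (T ` (P ` C))"
      using compact unfolding cyclically_compact_operator_def by blast
    then show ?thesis by (simp add: image_image T'_def P_def)
  qed
  ultimately have cc: "cyclically_compact_operator M X ip T'"
    unfolding cyclically_compact_operator_def by blast
  have "self_adjoint X ip T'" unfolding self_adjoint_def
  proof (intro ballI)
    fix \<eta> \<zeta> assume \<eta>: "\<eta> \<in> carrier X" and \<zeta>: "\<zeta> \<in> carrier X"
    show "ip (T' \<eta>) \<zeta> = ip \<eta> (T' \<zeta>)"
    proof (rule linf_eqI)
      from formula[OF \<eta> \<zeta>] formula[OF \<zeta> \<eta>] re ipf_cnj[OF c(4)[OF \<zeta>] \<eta>] ipf_cnj[OF T_closed[OF \<zeta>] \<eta>]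
        ipf_cnj[OF \<zeta> \<xi>] ipf_cnj[OF \<xi> \<eta>]
      have "AE x in M. ipf (T' \<eta>) \<zeta> x = ipf \<eta> (T' \<zeta>) x"
      proof eventually_elim
        case (elim x)
        have "cnj (linf_rep l x) = linf_rep l x" using elim by (simp add: complex_eq_iff)
        with elim T_ip[OF \<eta> \<zeta>] show ?case by simp
      qed
      then show "AE x in M. linf_rep (ip (T' \<eta>) \<zeta>) x = linf_rep (ip \<eta> (T' \<zeta>)) x" by (simp add: ipf_def)
    qed (use c \<eta> \<zeta> ip_closed in auto)
  qed
  with cc show "compact_self_adjoint M X ip T'"
    by (intro compact_self_adjoint.intro compact_self_adjoint_axioms.intro Hilbert_Kaplansky_module_axioms)
qed

text \<open>Deflation is iterated by dependent choice. The vector r is the value at \<eta> of the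
  n-fold deflated operator: it is bounded by |\<open>l n\<close>| |\<eta>| because
  \<open>l n\<close> is dominant for that operator, and the sum over j < n is what the n deflations
  removed.\<close>

lemma eigensystem_exists:
  "\<exists>\<xi> l. (\<forall>n :: nat. \<xi> n \<in> carrier X \<and> l n \<in> carrier (Linf M) \<and> T (\<xi> n) = l n \<odot>\<^bsub>X\<^esub> \<xi> n) \<and>
     (AE x in M. \<forall>n. vnf (\<xi> n) x = (if linf_rep (l n) x = 0 then 0 else 1)) \<and>
     (\<forall>m n. m \<noteq> n \<longrightarrow> (AE x in M. ipf (\<xi> m) (\<xi> n) x = 0)) \<and>
     (AE x in M. \<forall>n. cmod (linf_rep (l (Suc n)) x) \<le> cmod (linf_rep (l n) x)) \<and>
     (\<forall>n. \<forall>\<eta>\<in>carrier X. \<exists>r\<in>carrier X. (AE x in M. vnf r x \<le> cmod (linf_rep (l n) x) * vnf \<eta> x) \<and>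
        (\<forall>\<zeta>\<in>carrier X. AE x in M. ipf r \<zeta> x = ipf (T \<eta>) \<zeta> x -
           (\<Sum>j<n. linf_rep (l j) x * ipf \<eta> (\<xi> j) x * ipf (\<xi> j) \<zeta> x)))"
proof -
  \<comment> \<open>A state consists of an operator, a dominant eigenvector and its eigenvalue. The
    operator of the next state is determined by the state; the other two components are
    chosen.\<close>
  define ok where "ok s \<longleftrightarrow> compact_self_adjoint M X ip (fst s) \<and>
    dominant_eigenvector (fst s) (fst (snd s)) (snd (snd s))" for s
  define next_op where "next_op s = (\<lambda>\<eta>. fst s (\<eta> \<ominus>\<^bsub>X\<^esub> ip \<eta> (fst (snd s)) \<odot>\<^bsub>X\<^esub> fst (snd s)))"
    for s :: "('x \<Rightarrow> 'x) \<times> 'x \<times> ('a \<Rightarrow> complex) set"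
  have ex: "\<exists>s. ok s \<and> fst s = R" if R: "compact_self_adjoint M X ip R" for R
  proof -
    obtain \<xi> l where "dominant_eigenvector R \<xi> l"
      using compact_self_adjoint.dominant_eigenvector_exists[OF R] by blast
    with R show ?thesis by (intro exI[of _ "(R, \<xi>, l)"]) (simp add: ok_def)
  qed
  have "\<exists>s. \<forall>n :: nat. (ok (s n) \<and> (n = 0 \<longrightarrow> fst (s n) = T)) \<and> fst (s (Suc n)) = next_op (s n)"
  proof (rule dependent_nat_choice)
    show "\<exists>s. ok s \<and> (0 = (0 :: nat) \<longrightarrow> fst s = T)" using ex[OF compact_self_adjoint_axioms] by simp
    fix s n assume "ok s \<and> (n = (0 :: nat) \<longrightarrow> fst s = T)"
    then have "compact_self_adjoint M X ip (next_op s)"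
      unfolding next_op_def ok_def by (intro compact_self_adjoint.deflation(1)) auto
    from ex[OF this] show "\<exists>t. (ok t \<and> (Suc n = 0 \<longrightarrow> fst t = T)) \<and> fst t = next_op s" by simp
  qed
  then obtain s where s: "\<And>n. ok (s n)" "fst (s 0) = T" "\<And>n. fst (s (Suc n)) = next_op (s n)" by blast
  define S where "S n = fst (s n)" for n
  define \<xi> where "\<xi> n = fst (snd (s n))" for n
  define l where "l n = snd (snd (s n))" for n
  have csa: "compact_self_adjoint M X ip (S n)" and dom: "dominant_eigenvector (S n) (\<xi> n) (l n)" for n
    using s(1)[of n] by (auto simp: ok_def S_def \<xi>_def l_def)
  have S0: "S 0 = T" using s(2) by (simp add: S_def)
  have SSuc: "S (Suc n) = (\<lambda>\<eta>. S n (\<eta> \<ominus>\<^bsub>X\<^esub> ip \<eta> (\<xi> n) \<odot>\<^bsub>X\<^esub> \<xi> n))" for n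
    using s(3)[of n] by (simp add: S_def next_op_def \<xi>_def)
  have defl: "AE x in M. vnf (S (Suc n) \<eta>) x \<le> cmod (linf_rep (l n) x) * vnf \<eta> x"
    "\<zeta> \<in> carrier X \<Longrightarrow> AE x in M. ipf (S (Suc n) \<eta>) \<zeta> x =
      ipf (S n \<eta>) \<zeta> x - linf_rep (l n) x * ipf \<eta> (\<xi> n) x * ipf (\<xi> n) \<zeta> x"
    if "\<eta> \<in> carrier X" for n \<eta> \<zeta>
    unfolding SSuc using compact_self_adjoint.deflation(2,3)[OF csa dom that] by blast+
  have \<xi>: "\<xi> n \<in> carrier X" and l: "l n \<in> carrier (Linf M)" and S\<xi>: "S n (\<xi> n) = l n \<odot>\<^bsub>X\<^esub> \<xi> n"
    and v\<xi>: "AE x in M. vnf (\<xi> n) x = (if linf_rep (l n) x = 0 then 0 else 1)"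
    and Sl: "\<And>\<zeta>. \<zeta> \<in> carrier X \<Longrightarrow> AE x in M. vnf (S n \<zeta>) x \<le> cmod (linf_rep (l n) x) * vnf \<zeta> x" for n
    using dom[of n] by (auto simp: dominant_eigenvector_def)
  have Sc: "S n \<eta> \<in> carrier X" if "\<eta> \<in> carrier X" for n \<eta>
    using compact_self_adjoint.T_closed[OF csa that] .
  have expand: "AE x in M. ipf (S n \<eta>) \<zeta> x = ipf (T \<eta>) \<zeta> x -
      (\<Sum>j<n. linf_rep (l j) x * ipf \<eta> (\<xi> j) x * ipf (\<xi> j) \<zeta> x)"
    if \<eta>: "\<eta> \<in> carrier X" and \<zeta>: "\<zeta> \<in> carrier X" for n \<eta> \<zeta>
  proof (induction n)
    case 0 show ?case by (simp add: S0)
  next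
    case (Suc n)
    from this defl(2)[OF \<eta> \<zeta>, of n] show ?case by eventually_elim simp
  qed
  \<comment> \<open>l_n <\<xi>_n,\<xi>_j> = <S_n \<xi>_n,\<xi>_j> = <\<xi>_n,S_n \<xi>_j> = 0, and
    \<xi>_n vanishes where its eigenvalue does.\<close>
  have vanish_imp: "AE x in M. ipf (\<xi> n) (\<xi> j) x = 0" if "S n (\<xi> j) = \<zero>\<^bsub>X\<^esub>" for n j
  proof -
    have "AE x in M. linf_rep (l n) x * ipf (\<xi> n) (\<xi> j) x = 0"
    proof -
      have "ipf (S n (\<xi> n)) (\<xi> j) = ipf (\<xi> n) \<zero>\<^bsub>X\<^esub>"
        using compact_self_adjoint.T_ip[OF csa[of n] \<xi> \<xi>, of n j] that by simp
      then have eq: "ipf (S n (\<xi> n)) (\<xi> j) x = ipf (\<xi> n) \<zero>\<^bsub>X\<^esub> x" for x by simp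
      from ipf_smult_left[OF l \<xi> \<xi>, of n n j] ipf_zero_left[OF \<xi>[of n]] ipf_cnj[OF M.zero_closed \<xi>[of n]]
      show ?thesis unfolding S\<xi>[symmetric] eq by eventually_elim simp
    qed
    then show ?thesis using v\<xi>[of n] Cauchy_Schwarz_AE[OF \<xi>[of n] \<xi>[of j]]
      by eventually_elim auto
  qed
  \<comment> \<open>The newest eigenvector is killed by its own deflation, since l_n |\<xi>_n|^2 =
    l_n. The earlier ones stay in the kernel because \<open>vanish_imp\<close> makes them orthogonal
    to \<xi>_n.\<close>
  have vanish: "\<forall>j<n. S n (\<xi> j) = \<zero>\<^bsub>X\<^esub>" for n
  proof (induction n)
    case (Suc n)
    show ?case
    proof (intro allI impI)
      fix j assume j: "j < Suc n"
      show "S (Suc n) (\<xi> j) = \<zero>\<^bsub>X\<^esub>"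
      proof (rule vec_eqI)
        fix \<zeta> assume \<zeta>: "\<zeta> \<in> carrier X"
        show "AE x in M. ipf (S (Suc n) (\<xi> j)) \<zeta> x = ipf \<zero>\<^bsub>X\<^esub> \<zeta> x"
        proof (cases "j = n")
          case True
          from defl(2)[OF \<xi> \<zeta>, of n n] ipf_smult_left[OF l \<xi> \<zeta>, of n n, folded S\<xi>] ipf_self[OF \<xi>[of n]]
            v\<xi>[of n] ipf_zero_left[OF \<zeta>]
          show ?thesis unfolding True by eventually_elim auto
        next
          case False
          with j have j: "j < n" by simp
          with Suc have "S n (\<xi> j) = \<zero>\<^bsub>X\<^esub>" by blast
          note z = vanish_imp[OF this]
          have "ipf (S n (\<xi> j)) = ipf \<zero>\<^bsub>X\<^esub>" using Suc j by simp
          with defl(2)[OF \<xi> \<zeta>, of n j] z ipf_cnj[OF \<xi>[of n] \<xi>[of j]]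
          show ?thesis by simp (elim AE_mp, simp)
        qed
      qed (use Sc \<xi> in auto)
    qed
  qed simp
  have orth: "AE x in M. ipf (\<xi> m) (\<xi> n) x = 0" if "m \<noteq> n" for m n
  proof -
    have *: "AE x in M. ipf (\<xi> n) (\<xi> j) x = 0" if "j < n" for n j using vanish vanish_imp that by blast
    show ?thesis
    proof (cases "m < n")
      case True
      from *[OF True] ipf_cnj[OF \<xi>[of n] \<xi>[of m]] show ?thesis by eventually_elim simp
    qed (use * that in auto)
  qed
  \<comment> \<open>An eigenvector of the deflated operator is one of T itself: the terms removed by
    the first n deflations vanish on \<xi>_n by orthogonality.\<close>
  have T\<xi>: "T (\<xi> n) = l n \<odot>\<^bsub>X\<^esub> \<xi> n" for n
  proof (rule vec_eqI)
    fix \<zeta> assume \<zeta>: "\<zeta> \<in> carrier X"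
    have "AE x in M. \<forall>j\<in>{..<n}. ipf (\<xi> n) (\<xi> j) x = 0"
      using orth by (intro AE_finite_allI) auto
    with expand[OF \<xi> \<zeta>, of n n]
    show "AE x in M. ipf (T (\<xi> n)) \<zeta> x = ipf (l n \<odot>\<^bsub>X\<^esub> \<xi> n) \<zeta> x"
      unfolding S\<xi>[symmetric] by eventually_elim simp
  qed (use \<xi> l in auto)
  \<comment> \<open>\<open>S (Suc n)\<close> is bounded by the modulus of \<open>l n\<close>;
    evaluated at its own eigenvector this compares the moduli where \<open>l (Suc n)\<close> is
    nonzero.\<close>
  have dec: "AE x in M. cmod (linf_rep (l (Suc n)) x) \<le> cmod (linf_rep (l n) x)" for n
    using defl(1)[OF \<xi>, of n "Suc n"] vnf_smult[OF l \<xi>, of "Suc n" "Suc n", folded S\<xi>] v\<xi>[of "Suc n"]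
    by eventually_elim (auto split: if_splits)
  have rem: "\<exists>r\<in>carrier X. (AE x in M. vnf r x \<le> cmod (linf_rep (l n) x) * vnf \<eta> x) \<and>
      (\<forall>\<zeta>\<in>carrier X. AE x in M. ipf r \<zeta> x = ipf (T \<eta>) \<zeta> x -
         (\<Sum>j<n. linf_rep (l j) x * ipf \<eta> (\<xi> j) x * ipf (\<xi> j) \<zeta> x))"
    if \<eta>: "\<eta> \<in> carrier X" for n \<eta>
    using Sc[OF \<eta>] Sl[OF \<eta>] expand[OF \<eta>] by (intro bexI[of _ "S n \<eta>"]) auto
  show ?thesis
    using \<xi> l T\<xi> v\<xi> orth dec rem
    by (intro exI[of _ \<xi>] exI[of _ l] conjI) (simp_all add: AE_all_countable)
qed

text \<open>Two consecutive members of a cyclic subsequence of the orthogonal sequence \<open>T \<xi>\<^sub>n\<close> are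
  orthogonal, so their distance bounds an eigenvalue.\<close>

lemma eigenvalues_tendsto_zero:
  assumes \<xi>: "\<And>n :: nat. \<xi> n \<in> carrier X" and l: "\<And>n. l n \<in> carrier (Linf M)"
    and T\<xi>: "\<And>n. T (\<xi> n) = l n \<odot>\<^bsub>X\<^esub> \<xi> n"
    and v\<xi>: "AE x in M. \<forall>n. vnf (\<xi> n) x = (if linf_rep (l n) x = 0 then 0 else 1)"
    and orth: "\<And>m n. m \<noteq> n \<Longrightarrow> AE x in M. ipf (\<xi> m) (\<xi> n) x = 0"
    and dec: "AE x in M. \<forall>n. cmod (linf_rep (l (Suc n)) x) \<le> cmod (linf_rep (l n) x)"
  shows "AE x in M. (\<lambda>n. cmod (linf_rep (l n) x)) \<longlonglongrightarrow> 0"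
proof -
  have "AE x in M. vnf (\<xi> n) x \<le> 1" for n using v\<xi> by eventually_elim simp
  then have ball: "\<xi> n \<in> unit_ball" for n using \<xi> by (simp add: unit_ball_def)
  from cyclic_limit_exists[of \<xi>] ball obtain \<sigma> \<omega> and \<nu> :: "nat \<Rightarrow> nat \<Rightarrow> ('a \<Rightarrow> complex) set"
    where \<omega>: "\<omega> \<in> carrier X" and conv: "(\<lambda>j. norm_inf M ip (\<sigma> j \<ominus>\<^bsub>X\<^esub> \<omega>)) \<longlonglongrightarrow> 0"
    and part: "\<And>j. partition_of_unity M UNIV (\<nu> j)"
    and kk: "AE x in M. \<exists>k. strict_mono k \<and> (\<forall>j. linf_rep (\<nu> j (k j)) x = 1)"
    and mix: "\<And>j. is_mixing X UNIV (\<nu> j) (\<lambda>n. T (\<xi> n)) (\<sigma> j)" by blast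
  have \<nu>c: "\<nu> j n \<in> carrier (Linf M)" for j n using partition_nabla[OF part] by simp
  have \<sigma>c: "\<sigma> j \<in> carrier X" and \<nu>\<sigma>: "\<nu> j n \<odot>\<^bsub>X\<^esub> \<sigma> j = \<nu> j n \<odot>\<^bsub>X\<^esub> T (\<xi> n)" for j n
    using mix by (auto simp: is_mixing_def)
  have T\<xi>c: "T (\<xi> n) \<in> carrier X" for n using \<xi> by simp
  have v\<sigma>: "AE x in M. \<forall>j n. linf_rep (\<nu> j n) x \<noteq> 0 \<longrightarrow> vnf (\<sigma> j) x = vnf (T (\<xi> n)) x"
    unfolding AE_all_countable using smult_eq_vnf[OF \<nu>c \<sigma>c T\<xi>c \<nu>\<sigma>] by blast
  \<comment> \<open>\<open>smult_eq_ipf\<close> localises the first argument only; the second one is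
    reached by conjugation.\<close>
  have ip\<sigma>: "AE x in M. \<forall>j n i. linf_rep (\<nu> j n) x \<noteq> 0 \<longrightarrow> ipf (\<sigma> j) (\<sigma> i) x = ipf (T (\<xi> n)) (\<sigma> i) x"
    unfolding AE_all_countable using smult_eq_ipf[OF \<nu>c \<sigma>c T\<xi>c \<sigma>c \<nu>\<sigma>] by blast
  have ip\<sigma>': "AE x in M. \<forall>j n i. linf_rep (\<nu> j n) x \<noteq> 0 \<longrightarrow> ipf (\<sigma> j) (T (\<xi> i)) x = ipf (T (\<xi> n)) (T (\<xi> i)) x"
    unfolding AE_all_countable using smult_eq_ipf[OF \<nu>c \<sigma>c T\<xi>c T\<xi>c \<nu>\<sigma>] by blast
  have cnj\<sigma>: "AE x in M. \<forall>n i. ipf (T (\<xi> n)) (\<sigma> i) x = cnj (ipf (\<sigma> i) (T (\<xi> n)) x)"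
    unfolding AE_all_countable using ipf_cnj[OF \<sigma>c T\<xi>c] by blast
  have ortho: "AE x in M. \<forall>m n. m \<noteq> n \<longrightarrow> ipf (T (\<xi> m)) (T (\<xi> n)) x = 0"
    unfolding AE_all_countable
  proof (intro allI)
    fix m n
    show "AE x in M. m \<noteq> n \<longrightarrow> ipf (T (\<xi> m)) (T (\<xi> n)) x = 0"
    proof (cases "m = n")
      case False
      have c: "l n \<odot>\<^bsub>X\<^esub> \<xi> n \<in> carrier X" using l \<xi> by simp
      from ipf_smult_left[OF l \<xi> c, of m m] ipf_smult_right[OF l[of n] \<xi>[of n] \<xi>[of m]] orth[OF False]
      show ?thesis unfolding T\<xi> by eventually_elim simp
    qed simp
  qed
  have vT: "AE x in M. \<forall>n. vnf (T (\<xi> n)) x = cmod (linf_rep (l n) x)"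
    unfolding AE_all_countable
  proof
    fix n
    have "AE x in M. vnf (\<xi> n) x = (if linf_rep (l n) x = 0 then 0 else 1)"
      using v\<xi> by (simp add: AE_all_countable)
    with vnf_smult[OF l \<xi>, of n n] show "AE x in M. vnf (T (\<xi> n)) x = cmod (linf_rep (l n) x)"
      unfolding T\<xi> by eventually_elim auto
  qed
  define e where "e j = norm_inf M ip (\<sigma> j \<ominus>\<^bsub>X\<^esub> \<omega>)" for j
  have e0: "e \<longlonglongrightarrow> 0" using conv by (simp add: e_def[abs_def])
  have diff: "AE x in M. \<forall>j. vnf (\<sigma> j \<ominus>\<^bsub>X\<^esub> \<sigma> (Suc j)) x \<le> e j + e (Suc j)"
    unfolding AE_all_countable
  proof
    fix j
    have c: "\<sigma> j \<ominus>\<^bsub>X\<^esub> \<omega> \<in> carrier X" "\<sigma> (Suc j) \<ominus>\<^bsub>X\<^esub> \<omega> \<in> carrier X" using \<sigma>c \<omega> by auto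
    have "\<sigma> j \<ominus>\<^bsub>X\<^esub> \<sigma> (Suc j) = (\<sigma> j \<ominus>\<^bsub>X\<^esub> \<omega>) \<ominus>\<^bsub>X\<^esub> (\<sigma> (Suc j) \<ominus>\<^bsub>X\<^esub> \<omega>)"
    proof (rule vec_eqI)
      fix \<zeta> assume \<zeta>: "\<zeta> \<in> carrier X"
      from ipf_minus_left[OF \<sigma>c[of j] \<sigma>c[of "Suc j"] \<zeta>] ipf_minus_left[OF c \<zeta>]
        ipf_minus_left[OF \<sigma>c[of j] \<omega> \<zeta>] ipf_minus_left[OF \<sigma>c[of "Suc j"] \<omega> \<zeta>]
      show "AE x in M. ipf (\<sigma> j \<ominus>\<^bsub>X\<^esub> \<sigma> (Suc j)) \<zeta> x = ipf ((\<sigma> j \<ominus>\<^bsub>X\<^esub> \<omega>) \<ominus>\<^bsub>X\<^esub> (\<sigma> (Suc j) \<ominus>\<^bsub>X\<^esub> \<omega>)) \<zeta> x"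
        by eventually_elim simp
    qed (use \<sigma>c c in auto)
    with vnf_minus[OF c] vnf_le_norm_inf[OF c(1)] vnf_le_norm_inf[OF c(2)]
    show "AE x in M. vnf (\<sigma> j \<ominus>\<^bsub>X\<^esub> \<sigma> (Suc j)) x \<le> e j + e (Suc j)"
      unfolding e_def by simp (elim AE_mp, simp)
  qed
  have sq: "AE x in M. \<forall>j. (vnf (\<sigma> j \<ominus>\<^bsub>X\<^esub> \<sigma> (Suc j)) x)\<^sup>2 =
      (vnf (\<sigma> j) x)\<^sup>2 - 2 * Re (ipf (\<sigma> j) (\<sigma> (Suc j)) x) + (vnf (\<sigma> (Suc j)) x)\<^sup>2"
    unfolding AE_all_countable using vnf_minus_square[OF \<sigma>c \<sigma>c] by blast
  from kk v\<sigma> ip\<sigma> ip\<sigma>' cnj\<sigma> ortho vT diff sq dec show ?thesis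
  proof eventually_elim
    case (elim x)
    then obtain k where k: "strict_mono k" "\<And>j. linf_rep (\<nu> j (k j)) x \<noteq> 0" by (metis zero_neq_one)
    have le: "cmod (linf_rep (l (k j)) x) \<le> e j + e (Suc j)" for j
    proof -
      have ne: "k (Suc j) \<noteq> k j" using k(1) by (metis lessI nat_less_le strict_mono_less)
      have "ipf (\<sigma> j) (\<sigma> (Suc j)) x = ipf (T (\<xi> (k j))) (\<sigma> (Suc j)) x" using elim(3) k(2) by blast
      also have "\<dots> = cnj (ipf (\<sigma> (Suc j)) (T (\<xi> (k j))) x)" using elim(5) by blast
      also have "ipf (\<sigma> (Suc j)) (T (\<xi> (k j))) x = ipf (T (\<xi> (k (Suc j)))) (T (\<xi> (k j))) x" using elim(4) k(2) by blast
      also have "\<dots> = 0" using elim(6) ne by blast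
      finally have "ipf (\<sigma> j) (\<sigma> (Suc j)) x = 0" by simp
      moreover have "vnf (\<sigma> j) x = cmod (linf_rep (l (k j)) x)" using elim(2,7) k(2) by metis
      ultimately have "(cmod (linf_rep (l (k j)) x))\<^sup>2 \<le> (vnf (\<sigma> j \<ominus>\<^bsub>X\<^esub> \<sigma> (Suc j)) x)\<^sup>2" using elim(9) by simp
      then have "cmod (linf_rep (l (k j)) x) \<le> vnf (\<sigma> j \<ominus>\<^bsub>X\<^esub> \<sigma> (Suc j)) x" by (rule power2_le_imp_le) simp
      also have "\<dots> \<le> e j + e (Suc j)" using elim(8) by blast
      finally show ?thesis .
    qed
    have dq: "decseq (\<lambda>n. cmod (linf_rep (l n) x))" using elim(10) by (auto simp: decseq_Suc_iff)
    have "(\<lambda>j. e j + e (Suc j)) \<longlonglongrightarrow> 0 + 0" by (intro tendsto_add e0 LIMSEQ_Suc)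
    then have lim: "(\<lambda>j. e j + e (Suc j)) \<longlonglongrightarrow> 0" by simp
    \<comment> \<open>The bounds \<open>e j\<close> are constants while the indices k depend on the
      point; monotonicity extends the estimate from \<open>k j\<close> to all later indices.\<close>
    have b: "cmod (linf_rep (l n) x) \<le> e j + e (Suc j)" if "k j \<le> n" for n j
      using decseqD[OF dq that] le[of j] by linarith
    show ?case
    proof (rule LIMSEQ_I)
      fix r :: real assume "0 < r"
      obtain j where "\<bar>e j + e (Suc j)\<bar> < r" using LIMSEQ_D[OF lim \<open>0 < r\<close>] by auto
      with b have "\<forall>n\<ge>k j. norm (cmod (linf_rep (l n) x) - 0) < r" by fastforce
      then show "\<exists>no. \<forall>n\<ge>no. norm (cmod (linf_rep (l n) x) - 0) < r" by blast
    qed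
  qed
qed

end

section \<open>The spectral representation\<close>

text \<open>The value \<open>k = \<infinity>\<close> collects the points at which no \<open>L j\<close> vanishes.\<close>

definition first_zero_set :: "'a measure \<Rightarrow> (nat \<Rightarrow> 'a \<Rightarrow> complex) \<Rightarrow> enat \<Rightarrow> 'a set" where
  "first_zero_set M L k = {x \<in> space M. (\<forall>j. enat j < k \<longrightarrow> L j x \<noteq> 0) \<and> (\<forall>j. enat j = k \<longrightarrow> L j x = 0)}"

lemma first_zero_set_measurable [measurable]:
  assumes [measurable]: "\<And>n. L n \<in> borel_measurable M"
  shows "first_zero_set M L k \<in> sets M"
  unfolding first_zero_set_def by measurable

lemma first_zero_set_disjoint:
  assumes "i \<noteq> k"
  shows "first_zero_set M L i \<inter> first_zero_set M L k = {}"
proof -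
  have *: "first_zero_set M L i \<inter> first_zero_set M L k = {}" if "i < k" for i k
  proof -
    obtain j where "i = enat j" using \<open>i < k\<close> by (cases i) auto
    with that show ?thesis by (auto simp: first_zero_set_def)
  qed
  show ?thesis using *[of i k] *[of k i] assms by (cases i k rule: linorder_cases) auto
qed

lemma first_zero_set_cover: "space M \<subseteq> (\<Union>k. first_zero_set M L k)"
proof
  fix x assume x: "x \<in> space M"
  show "x \<in> (\<Union>k. first_zero_set M L k)"
  proof (cases "\<exists>j. L j x = 0")
    case True
    define i where "i = (LEAST j. L j x = 0)"
    have "L i x = 0" unfolding i_def using True by (rule LeastI_ex)
    moreover have "\<forall>j<i. L j x \<noteq> 0" unfolding i_def using not_less_Least by blast
    ultimately have "x \<in> first_zero_set M L (enat i)" using x by (auto simp: first_zero_set_def)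
    then show ?thesis by (rule UN_I[OF UNIV_I])
  next
    case False
    then have "x \<in> first_zero_set M L \<infinity>" using x by (simp add: first_zero_set_def)
    then show ?thesis by (rule UN_I[OF UNIV_I])
  qed
qed

theorem theorem2p1:
  fixes M :: "'a measure"
    and X :: "(('a \<Rightarrow> complex) set, 'x, 'm) module_scheme"
    and ip :: "'x \<Rightarrow> 'x \<Rightarrow> ('a \<Rightarrow> complex) set"
    and T :: "'x \<Rightarrow> 'x"
  assumes "direct_sum_property M"
    and "Hilbert_Kaplansky_module M X ip"
    and "cyclically_compact_operator M X ip T"
    and "self_adjoint X ip T"
  shows "\<exists>(\<pi> :: enat \<Rightarrow> ('a \<Rightarrow> complex) set) (\<xi> :: enat \<Rightarrow> nat \<Rightarrow> 'x)
           (f :: enat \<Rightarrow> nat \<Rightarrow> ('a \<Rightarrow> complex) set).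
      partition_of_unity M UNIV \<pi> \<and>
      (\<forall>k\<ge>1. orthonormal_family M X ip (\<pi> k) {n. 1 \<le> n \<and> enat n \<le> k} (\<xi> k)) \<and>
      (\<forall>k\<ge>1. \<forall>n\<in>{n. 1 \<le> n \<and> enat n \<le> k}.
         f k n \<in> (\<lambda>a. \<pi> k \<otimes>\<^bsub>Linf M\<^esub> a) ` carrier (Linf M)) \<and>
      (\<forall>\<zeta>\<in>carrier X. \<pi> 0 \<odot>\<^bsub>X\<^esub> T \<zeta> = \<zero>\<^bsub>X\<^esub>) \<and>
      decreases_to_zero M (\<lambda>n. \<pi> \<infinity> \<otimes>\<^bsub>Linf M\<^esub> linf_abs M (f \<infinity> (Suc n))) \<and>
      (\<forall>\<zeta>\<in>carrier X. \<exists>\<alpha>\<in>carrier X. \<exists>\<beta>\<in>carrier X.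
         vec_sums M X ip (\<lambda>n. f \<infinity> n \<odot>\<^bsub>X\<^esub> rank_one X ip (\<xi> \<infinity> n) (\<xi> \<infinity> n) \<zeta>) \<alpha> \<and>
         vec_sums M X ip
           (\<lambda>k. \<pi> (enat k) \<odot>\<^bsub>X\<^esub>
                (\<Oplus>\<^bsub>X\<^esub>n\<in>{1..k}. f (enat k) n \<odot>\<^bsub>X\<^esub>
                   rank_one X ip (\<xi> (enat k) n) (\<xi> (enat k) n) \<zeta>)) \<beta> \<and>
         T \<zeta> = \<pi> \<infinity> \<odot>\<^bsub>X\<^esub> \<alpha> \<oplus>\<^bsub>X\<^esub> \<beta>)"
proof -
  have "compact_self_adjoint M X ip T"
    using assms(2-4) by (intro compact_self_adjoint.intro compact_self_adjoint_axioms.intro)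
  then interpret compact_self_adjoint M X ip T .
  obtain e l where "\<forall>n :: nat. e n \<in> carrier X \<and> l n \<in> carrier (Linf M) \<and> T (e n) = l n \<odot>\<^bsub>X\<^esub> e n"
    and ve: "AE x in M. \<forall>n. vnf (e n) x = (if linf_rep (l n) x = 0 then 0 else 1)"
    and "\<forall>m n. m \<noteq> n \<longrightarrow> (AE x in M. ipf (e m) (e n) x = 0)"
    and dec: "AE x in M. \<forall>n. cmod (linf_rep (l (Suc n)) x) \<le> cmod (linf_rep (l n) x)"
    and rem: "\<forall>n. \<forall>\<eta>\<in>carrier X. \<exists>r\<in>carrier X. (AE x in M. vnf r x \<le> cmod (linf_rep (l n) x) * vnf \<eta> x) \<and>
        (\<forall>\<zeta>\<in>carrier X. AE x in M. ipf r \<zeta> x = ipf (T \<eta>) \<zeta> x -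
           (\<Sum>j<n. linf_rep (l j) x * ipf \<eta> (e j) x * ipf (e j) \<zeta> x))"
    using eigensystem_exists by (elim exE conjE)
  then have e: "\<And>n. e n \<in> carrier X" and l: "\<And>n. l n \<in> carrier (Linf M)" and Te: "\<And>n. T (e n) = l n \<odot>\<^bsub>X\<^esub> e n"
    and orth: "\<And>m n. m \<noteq> n \<Longrightarrow> AE x in M. ipf (e m) (e n) x = 0" by blast+
  have lim: "AE x in M. (\<lambda>n. cmod (linf_rep (l n) x)) \<longlonglongrightarrow> 0"
    using e l Te ve orth dec by (rule eigenvalues_tendsto_zero)
  define L where "L n = linf_rep (l n)" for n
  have [measurable]: "L n \<in> borel_measurable M" for n unfolding L_def using l by (rule linf_rep_measurable)
  define A where "A = first_zero_set M L"
  have A [measurable]: "A k \<in> sets M" for k unfolding A_def by measurable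
  have Adis: "x \<in> A i \<Longrightarrow> x \<in> A k \<Longrightarrow> i = k" for x i k
    unfolding A_def using first_zero_set_disjoint[of i k M L] by blast
  have Acov: "x \<in> space M \<Longrightarrow> \<exists>k. x \<in> A k" for x unfolding A_def using subsetD[OF first_zero_set_cover, of x M L] by blast
  define p where "p k = linf_ind M (A k)" for k
  have p: "p k \<in> carrier (Linf M)" "AE x in M. linf_rep (p k) x = indicator (A k) x" for k
    unfolding p_def using A by (auto intro: linf_rep_ind)
  \<comment> \<open>Eigenvectors are numbered from 0, the families of the representation from 1;
    hence n - 1.\<close>
  define g where "g k n = p k \<odot>\<^bsub>X\<^esub> e (n - 1)" for k n
  define f where "f k n = p k \<otimes>\<^bsub>Linf M\<^esub> l (n - 1)" for k n
  have g: "g k n \<in> carrier X" and f: "f k n \<in> carrier (Linf M)" for k n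
    using p e l by (auto simp: g_def f_def)
  have part: "partition_of_unity M UNIV p"
    unfolding p_def[abs_def]
  proof (rule partition_of_unity_ind)
    show "A i \<inter> A k = {}" if "i \<noteq> k" for i k unfolding A_def using that by (rule first_zero_set_disjoint)
    show "space M \<subseteq> (\<Union>k. A k)" unfolding A_def by (rule first_zero_set_cover)
  qed (rule A)
  have orthonormal: "orthonormal_family M X ip (p k) {n. 1 \<le> n \<and> enat n \<le> k} (g k)" for k
    unfolding orthonormal_family_def
  proof (intro conjI ballI impI)
    fix n assume "n \<in> {n. 1 \<le> n \<and> enat n \<le> k}"
    \<comment> \<open>The eigenvalue with index n - 1 therefore has no zero on \<open>A k\<close>,
      and the corresponding eigenvector has norm one there.\<close>
    then have n: "enat (n - 1) < k" by (cases k) auto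
    show "g k n \<in> (\<lambda>\<eta>. p k \<odot>\<^bsub>X\<^esub> \<eta>) ` carrier X" using e by (auto simp: g_def)
    have "AE x in M. vnf (g k n) x = indicator (A k) x"
      using vnf_smult[OF p(1)[of k] e[of "n - 1"]] p(2)[of k] ve
    proof eventually_elim
      case (elim x)
      have "L (n - 1) x \<noteq> 0" if "x \<in> A k" using that n by (auto simp: A_def first_zero_set_def)
      with elim show ?case by (auto simp: g_def L_def indicator_def)
    qed
    then show "ip (g k n) (g k n) = p k" unfolding p_def by (intro ip_self_eq_ind g A)
  next
    fix m n assume mn: "m \<in> {n. 1 \<le> n \<and> enat n \<le> k}" "n \<in> {n. 1 \<le> n \<and> enat n \<le> k}" "m \<noteq> n"
    then have ne: "m - 1 \<noteq> n - 1" by auto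
    show "ip (g k m) (g k n) = \<zero>\<^bsub>Linf M\<^esub>"
    proof (rule linf_eqI)
      from ipf_smult_left[OF p(1)[of k] e[of "m - 1"] g[of k n]] ipf_smult_right[OF p(1)[of k] e[of "n - 1"] e[of "m - 1"]]
        orth[OF ne] linf_rep_zero[of M]
      show "AE x in M. linf_rep (ip (g k m) (g k n)) x = linf_rep \<zero>\<^bsub>Linf M\<^esub> x"
        unfolding g_def[symmetric] ipf_def[symmetric] by eventually_elim simp
    qed (use g ip_closed in auto)
  qed
  \<comment> \<open>The remainder of order 0 is T \<zeta> itself, bounded by the modulus of the
    first eigenvalue times |\<zeta>|, and that eigenvalue is zero on \<open>A 0\<close>.\<close>
  have zero: "AE x in M. x \<in> A 0 \<longrightarrow> vnf (T \<zeta>) x = 0" if \<zeta>: "\<zeta> \<in> carrier X" for \<zeta>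
  proof -
    obtain r where r: "r \<in> carrier X" "AE x in M. vnf r x \<le> cmod (linf_rep (l 0) x) * vnf \<zeta> x"
      and r': "\<And>\<theta>. \<theta> \<in> carrier X \<Longrightarrow> AE x in M. ipf r \<theta> x = ipf (T \<zeta>) \<theta> x"
      using rem[rule_format, OF \<zeta>, of 0] by auto
    have "r = T \<zeta>" using r(1) \<zeta> r' by (intro vec_eqI) auto
    show ?thesis using r(2) unfolding \<open>r = T \<zeta>\<close>
    proof eventually_elim
      case (elim x)
      have "linf_rep (l 0) x = 0" if "x \<in> A 0" using that by (auto simp: A_def first_zero_set_def L_def zero_enat_def)
      with elim show ?case by (auto intro: antisym)
    qed
  qed
  have p0: "p 0 \<odot>\<^bsub>X\<^esub> T \<zeta> = \<zero>\<^bsub>X\<^esub>" if \<zeta>: "\<zeta> \<in> carrier X" for \<zeta>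
  proof (rule vec_eq_zeroI)
    show "AE x in M. vnf (p 0 \<odot>\<^bsub>X\<^esub> T \<zeta>) x = 0"
      using vnf_smult[OF p(1) T_closed[OF \<zeta>], of 0] p(2)[of 0] zero[OF \<zeta>]
      by eventually_elim (auto simp: indicator_def)
  qed (use p \<zeta> in auto)
  have decreasing: "decreases_to_zero M (\<lambda>n. p \<infinity> \<otimes>\<^bsub>Linf M\<^esub> linf_abs M (f \<infinity> (Suc n)))"
  proof (rule decreases_to_zeroI[where h = "\<lambda>n x. indicator (A \<infinity>) x * cmod (L n x)"])
    show "AE x in M. \<forall>n. linf_rep (p \<infinity> \<otimes>\<^bsub>Linf M\<^esub> linf_abs M (f \<infinity> (Suc n))) x =
        complex_of_real (indicator (A \<infinity>) x * cmod (L n x))"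
      unfolding AE_all_countable
    proof
      fix n
      from linf_rep_mult[OF p(1)[of \<infinity>] linf_abs_closed[OF f[of \<infinity> "Suc n"]]] p(2)[of \<infinity>]
        linf_rep_abs[OF f[of \<infinity> "Suc n"]] linf_rep_mult[OF p(1)[of \<infinity>] l[of n]]
      show "AE x in M. linf_rep (p \<infinity> \<otimes>\<^bsub>Linf M\<^esub> linf_abs M (f \<infinity> (Suc n))) x =
          complex_of_real (indicator (A \<infinity>) x * cmod (L n x))"
        by eventually_elim (simp add: f_def L_def indicator_def)
    qed
    show "AE x in M. \<forall>n. indicator (A \<infinity>) x * cmod (L (Suc n) x) \<le> indicator (A \<infinity>) x * cmod (L n x)"
      using dec unfolding L_def by eventually_elim (auto simp: indicator_def)
    show "AE x in M. (\<lambda>n. indicator (A \<infinity>) x * cmod (L n x)) \<longlonglongrightarrow> 0"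
      using lim unfolding L_def by eventually_elim (intro tendsto_mult_right_zero)
  qed (use p f in auto)
  have repr: "\<exists>\<alpha>\<in>carrier X. \<exists>\<beta>\<in>carrier X.
      vec_sums M X ip (\<lambda>n. f \<infinity> n \<odot>\<^bsub>X\<^esub> rank_one X ip (g \<infinity> n) (g \<infinity> n) \<zeta>) \<alpha> \<and>
      vec_sums M X ip (\<lambda>k. p (enat k) \<odot>\<^bsub>X\<^esub>
        (\<Oplus>\<^bsub>X\<^esub>n\<in>{1..k}. f (enat k) n \<odot>\<^bsub>X\<^esub> rank_one X ip (g (enat k) n) (g (enat k) n) \<zeta>)) \<beta> \<and>
      T \<zeta> = p \<infinity> \<odot>\<^bsub>X\<^esub> \<alpha> \<oplus>\<^bsub>X\<^esub> \<beta>" if \<zeta>: "\<zeta> \<in> carrier X" for \<zeta>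
  proof -
    note T\<zeta> = T_closed[OF \<zeta>]
    obtain R where R: "\<And>n. R n \<in> carrier X" "\<And>n. AE x in M. vnf (R n) x \<le> cmod (L n x) * vnf \<zeta> x"
      "\<And>n \<theta>. \<theta> \<in> carrier X \<Longrightarrow> AE x in M. ipf (R n) \<theta> x = ipf (T \<zeta>) \<theta> x -
           (\<Sum>j<n. L j x * ipf \<zeta> (e j) x * ipf (e j) \<theta> x)"
    proof -
      have "\<forall>n. \<exists>r. r \<in> carrier X \<and> (AE x in M. vnf r x \<le> cmod (L n x) * vnf \<zeta> x) \<and>
        (\<forall>\<theta>\<in>carrier X. AE x in M. ipf r \<theta> x = ipf (T \<zeta>) \<theta> x -
           (\<Sum>j<n. L j x * ipf \<zeta> (e j) x * ipf (e j) \<theta> x))"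
        using rem \<zeta> unfolding L_def by blast
      from choice[OF this] show thesis using that by blast
    qed
    define t where "t k n = f k n \<odot>\<^bsub>X\<^esub> rank_one X ip (g k n) (g k n) \<zeta>" for k n
    have t: "t k n \<in> carrier X" for k n using f g \<zeta> ip_closed by (simp add: t_def rank_one_def)
    have sum_closed: "(\<Oplus>\<^bsub>X\<^esub>n\<in>{1..N}. t k n) \<in> carrier X" for k N using t by (intro M.finsum_closed) auto
    have ipt: "AE x in M. ipf (t k n) \<theta> x = indicator (A k) x * (L (n - 1) x * ipf \<zeta> (e (n - 1)) x * ipf (e (n - 1)) \<theta> x)"
      if \<theta>: "\<theta> \<in> carrier X" for k n \<theta>
    proof -
      have c: "ip \<zeta> (g k n) \<in> carrier (Linf M)" "ip \<zeta> (g k n) \<odot>\<^bsub>X\<^esub> g k n \<in> carrier X" using \<zeta> g ip_closed by auto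
      from ipf_smult_left[OF f c(2) \<theta>, of k n] ipf_smult_left[OF c(1) g[of k n] \<theta>] p(2)[of k]
        linf_rep_mult[OF p(1) l, of k "n - 1"] ipf_smult_right[OF p(1) e \<zeta>, of k "n - 1"]
        ipf_smult_left[OF p(1) e \<theta>, of k "n - 1"]
      show ?thesis
        by eventually_elim (simp add: t_def rank_one_def f_def g_def L_def ipf_def indicator_def)
    qed
    \<comment> \<open>The N-th partial sum is the part of T \<zeta> - \<open>R N\<close> that lives
      on \<open>A k\<close>; the index shift turns the sum over 1..N into the sum over j <
      N.\<close>
    have ipsum: "AE x in M. ipf (\<Oplus>\<^bsub>X\<^esub>n\<in>{1..N}. t k n) \<theta> x = indicator (A k) x * (ipf (T \<zeta>) \<theta> x - ipf (R N) \<theta> x)"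
      if \<theta>: "\<theta> \<in> carrier X" for k N \<theta>
    proof -
      have "AE x in M. \<forall>n. ipf (t k n) \<theta> x = indicator (A k) x * (L (n - 1) x * ipf \<zeta> (e (n - 1)) x * ipf (e (n - 1)) \<theta> x)"
        using ipt[OF \<theta>] by (simp add: AE_all_countable)
      moreover have "AE x in M. ipf (\<Oplus>\<^bsub>X\<^esub>n\<in>{1..N}. t k n) \<theta> x = (\<Sum>n\<in>{1..N}. ipf (t k n) \<theta> x)"
        using t \<theta> by (intro ipf_finsum_left) auto
      ultimately show ?thesis using R(3)[OF \<theta>, of N]
        by eventually_elim (simp add: sum.atLeast1_atMost_eq sum_distrib_left)
    qed
    \<comment> \<open>The sums are known in advance: they are the parts of T \<zeta> on
      \<open>A \<infinity>\<close> and on the set B of points with k finite and positive.\<close>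
    define \<alpha> where "\<alpha> = p \<infinity> \<odot>\<^bsub>X\<^esub> T \<zeta>"
    define B where "B = space M - A 0 - A \<infinity>"
    have B: "B \<in> sets M" unfolding B_def by measurable
    define b where "b = linf_ind M B"
    have b: "b \<in> carrier (Linf M)" "AE x in M. linf_rep b x = indicator B x"
      unfolding b_def using B by (auto intro: linf_rep_ind)
    define \<beta> where "\<beta> = b \<odot>\<^bsub>X\<^esub> T \<zeta>"
    have \<alpha>: "\<alpha> \<in> carrier X" and \<beta>: "\<beta> \<in> carrier X" using p b T\<zeta> by (auto simp: \<alpha>_def \<beta>_def)
    have "vec_sums M X ip (t \<infinity>) \<alpha>" unfolding vec_sums_def
    \<comment> \<open>The error is the remainder \<open>R N\<close> on \<open>A \<infinity>\<close>
      up to sign, bounded by the modulus of the N-th eigenvalue times |\<zeta>|, which decreases to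
      0 at almost every point.\<close>
    proof (rule order_null_vec_normI[where e = "\<lambda>N. p \<infinity> \<otimes>\<^bsub>Linf M\<^esub> linf_abs M (l N) \<otimes>\<^bsub>Linf M\<^esub> vec_norm M ip \<zeta>"
          and h = "\<lambda>N x. indicator (A \<infinity>) x * cmod (L N x) * vnf \<zeta> x"])
      fix N
      let ?S = "\<Oplus>\<^bsub>X\<^esub>n\<in>{1..N}. t \<infinity> n"
      show "?S \<ominus>\<^bsub>X\<^esub> \<alpha> \<in> carrier X" using sum_closed \<alpha> by simp
      show "p \<infinity> \<otimes>\<^bsub>Linf M\<^esub> linf_abs M (l N) \<otimes>\<^bsub>Linf M\<^esub> vec_norm M ip \<zeta> \<in> carrier (Linf M)"
        using p l vec_norm_closed[OF \<zeta>] by simp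
      from linf_rep_mult[OF linf_mult_closed[OF p(1) linf_abs_closed[OF l]] vec_norm_closed[OF \<zeta>], of \<infinity> N]
        linf_rep_mult[OF p(1) linf_abs_closed[OF l], of \<infinity> N] p(2)[of \<infinity>] linf_rep_abs[OF l[of N]] vec_norm_AE[OF \<zeta>]
      show "AE x in M. linf_rep (p \<infinity> \<otimes>\<^bsub>Linf M\<^esub> linf_abs M (l N) \<otimes>\<^bsub>Linf M\<^esub> vec_norm M ip \<zeta>) x =
          complex_of_real (indicator (A \<infinity>) x * cmod (L N x) * vnf \<zeta> x)"
        by eventually_elim (simp add: L_def indicator_def)
      have c: "p \<infinity> \<odot>\<^bsub>X\<^esub> R N \<in> carrier X" using p R by simp
      have "?S \<ominus>\<^bsub>X\<^esub> \<alpha> = \<ominus>\<^bsub>X\<^esub> (p \<infinity> \<odot>\<^bsub>X\<^esub> R N)"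
      proof (rule vec_eqI)
        fix \<theta> assume \<theta>: "\<theta> \<in> carrier X"
        from ipf_minus_left[OF sum_closed \<alpha> \<theta>, of \<infinity> N] ipsum[OF \<theta>, of \<infinity> N] ipf_smult_left[OF p(1) T\<zeta> \<theta>, of \<infinity>, folded \<alpha>_def]
          ipf_uminus_left[OF c \<theta>] ipf_smult_left[OF p(1) R(1) \<theta>, of \<infinity> N] p(2)[of \<infinity>]
        show "AE x in M. ipf (?S \<ominus>\<^bsub>X\<^esub> \<alpha>) \<theta> x = ipf (\<ominus>\<^bsub>X\<^esub> (p \<infinity> \<odot>\<^bsub>X\<^esub> R N)) \<theta> x"
          by eventually_elim (simp add: right_diff_distrib)
      qed (use c \<alpha> sum_closed in auto)
      then show "AE x in M. vnf (?S \<ominus>\<^bsub>X\<^esub> \<alpha>) x \<le> indicator (A \<infinity>) x * cmod (L N x) * vnf \<zeta> x"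
        using vnf_uminus[OF c] vnf_smult[OF p(1) R(1), of \<infinity> N] p(2)[of \<infinity>] R(2)[of N]
        by simp (elim AE_mp, auto simp: indicator_def)
    next
      show "AE x in M. \<forall>N. indicator (A \<infinity>) x * cmod (L (Suc N) x) * vnf \<zeta> x \<le> indicator (A \<infinity>) x * cmod (L N x) * vnf \<zeta> x"
        using dec unfolding L_def by eventually_elim (auto simp: indicator_def intro: mult_right_mono)
      show "AE x in M. (\<lambda>N. indicator (A \<infinity>) x * cmod (L N x) * vnf \<zeta> x) \<longlonglongrightarrow> 0"
        using lim unfolding L_def by eventually_elim (intro tendsto_mult_left_zero tendsto_mult_right_zero)
    qed
    moreover have "vec_sums M X ip (\<lambda>k. p (enat k) \<odot>\<^bsub>X\<^esub> (\<Oplus>\<^bsub>X\<^esub>n\<in>{1..k}. t (enat k) n)) \<beta>"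
      unfolding vec_sums_def
    proof -
      define s where "s k = p (enat k) \<odot>\<^bsub>X\<^esub> (\<Oplus>\<^bsub>X\<^esub>n\<in>{1..k}. t (enat k) n)" for k
      have s: "s k \<in> carrier X" for k using p sum_closed by (simp add: s_def)
      \<comment> \<open>On \<open>A (enat k)\<close> the eigenvalue with index k is zero, so the
        remainder \<open>R k\<close> vanishes and the finite inner sum is exactly T \<zeta>
        there.\<close>
      have ips: "AE x in M. ipf (s k) \<theta> x = indicator (A (enat k)) x * ipf (T \<zeta>) \<theta> x" if \<theta>: "\<theta> \<in> carrier X" for k \<theta>
        using ipf_smult_left[OF p(1) sum_closed \<theta>, of "enat k" "enat k" k] ipsum[OF \<theta>, of "enat k" k] p(2)[of "enat k"]
          R(2)[of k] Cauchy_Schwarz_AE[OF R(1)[of k] \<theta>]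
      proof eventually_elim
        case (elim x)
        have "ipf (R k) \<theta> x = 0" if "x \<in> A (enat k)"
        proof -
          have "L k x = 0" using that by (simp add: A_def first_zero_set_def)
          then have "vnf (R k) x = 0" using elim(4) vnf_nonneg[of "R k" x] by simp
          with elim(5) show ?thesis by simp
        qed
        with elim show ?case by (auto simp: s_def indicator_def)
      qed
      have s_sum: "(\<Oplus>\<^bsub>X\<^esub>k\<in>{1..N}. s k) \<in> carrier X" for N using s by (intro M.finsum_closed) auto
      \<comment> \<open>\<open>E N\<close> collects the points with finite k > N; up to sign, the
        N-th error of the outer sum is T \<zeta> restricted to \<open>E N\<close>. It need not be
        small in norm, but every point leaves \<open>E N\<close> once N reaches its k, so this
        restriction serves as its own majorant.\<close>
      define E where "E N = B - (\<Union>k\<in>{1..N}. A (enat k))" for N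
      have E: "E N \<in> sets M" for N unfolding E_def using A B by auto
      have point: "(\<Sum>k=1..N. indicator (A (enat k)) x) - indicator B x = (- indicator (E N) x :: complex)"
        if x: "x \<in> space M" for x N
      proof -
        obtain \<kappa> where \<kappa>: "x \<in> A \<kappa>" using Acov[OF x] by blast
        have mem: "x \<in> A k \<longleftrightarrow> k = \<kappa>" for k using \<kappa> Adis by blast
        have "(\<Sum>k=1..N. indicator (A (enat k)) x :: complex) = (if \<exists>k\<in>{1..N}. \<kappa> = enat k then 1 else 0)"
        proof (cases \<kappa>)
          case (enat i)
          have "(\<Sum>k=1..N. indicator (A (enat k)) x :: complex) = (\<Sum>k=1..N. if k = i then 1 else 0)"
            by (intro sum.cong) (auto simp: indicator_def mem enat)
          then show ?thesis using enat by auto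
        qed (auto simp: indicator_def mem)
        moreover have "indicator B x = (if \<kappa> = 0 \<or> \<kappa> = \<infinity> then 0 else 1 :: complex)"
          using x by (auto simp: B_def indicator_def mem)
        moreover have "indicator (E N) x = (if \<kappa> = 0 \<or> \<kappa> = \<infinity> \<or> (\<exists>k\<in>{1..N}. \<kappa> = enat k) then 0 else 1 :: complex)"
          using x by (auto simp: E_def B_def indicator_def mem)
        ultimately show ?thesis by (auto simp: zero_enat_def)
      qed
      define q where "q N = linf_ind M (E N)" for N
      have q: "q N \<in> carrier (Linf M)" "AE x in M. linf_rep (q N) x = indicator (E N) x" for N
        unfolding q_def using E by (auto intro: linf_rep_ind)
      have "order_null M (\<lambda>N. vec_norm M ip ((\<Oplus>\<^bsub>X\<^esub>k\<in>{1..N}. s k) \<ominus>\<^bsub>X\<^esub> \<beta>))"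
      proof (rule order_null_vec_normI[where e = "\<lambda>N. q N \<otimes>\<^bsub>Linf M\<^esub> vec_norm M ip (T \<zeta>)"
            and h = "\<lambda>N x. indicator (E N) x * vnf (T \<zeta>) x"])
        fix N
        let ?S = "\<Oplus>\<^bsub>X\<^esub>k\<in>{1..N}. s k"
        show "?S \<ominus>\<^bsub>X\<^esub> \<beta> \<in> carrier X" using s_sum \<beta> by simp
        show "q N \<otimes>\<^bsub>Linf M\<^esub> vec_norm M ip (T \<zeta>) \<in> carrier (Linf M)" using q vec_norm_closed[OF T\<zeta>] by simp
        from linf_rep_mult[OF q(1) vec_norm_closed[OF T\<zeta>], of N] q(2)[of N] vec_norm_AE[OF T\<zeta>]
        show "AE x in M. linf_rep (q N \<otimes>\<^bsub>Linf M\<^esub> vec_norm M ip (T \<zeta>)) x =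
            complex_of_real (indicator (E N) x * vnf (T \<zeta>) x)"
          by eventually_elim (simp add: indicator_def)
        have c: "q N \<odot>\<^bsub>X\<^esub> T \<zeta> \<in> carrier X" using q T\<zeta> by simp
        have "?S \<ominus>\<^bsub>X\<^esub> \<beta> = \<ominus>\<^bsub>X\<^esub> (q N \<odot>\<^bsub>X\<^esub> T \<zeta>)"
        proof (rule vec_eqI)
          fix \<theta> assume \<theta>: "\<theta> \<in> carrier X"
          have "AE x in M. \<forall>k. ipf (s k) \<theta> x = indicator (A (enat k)) x * ipf (T \<zeta>) \<theta> x"
            using ips[OF \<theta>] by (simp add: AE_all_countable)
          moreover have "AE x in M. ipf ?S \<theta> x = (\<Sum>k=1..N. ipf (s k) \<theta> x)"
            using s \<theta> by (intro ipf_finsum_left) auto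
          ultimately show "AE x in M. ipf (?S \<ominus>\<^bsub>X\<^esub> \<beta>) \<theta> x = ipf (\<ominus>\<^bsub>X\<^esub> (q N \<odot>\<^bsub>X\<^esub> T \<zeta>)) \<theta> x"
            using ipf_minus_left[OF s_sum \<beta> \<theta>, of N] ipf_smult_left[OF b(1) T\<zeta> \<theta>, folded \<beta>_def] b(2)
              ipf_uminus_left[OF c \<theta>] ipf_smult_left[OF q(1) T\<zeta> \<theta>, of N] q(2)[of N] AE_space
          proof eventually_elim
            case (elim x)
            have "ipf (?S \<ominus>\<^bsub>X\<^esub> \<beta>) \<theta> x = ((\<Sum>k=1..N. indicator (A (enat k)) x) - indicator B x) * ipf (T \<zeta>) \<theta> x"
              using elim by (simp add: sum_distrib_right left_diff_distrib)
            also have "\<dots> = ipf (\<ominus>\<^bsub>X\<^esub> (q N \<odot>\<^bsub>X\<^esub> T \<zeta>)) \<theta> x" using elim point by simp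
            finally show ?case .
          qed
        qed (use c \<beta> s_sum in auto)
        then show "AE x in M. vnf (?S \<ominus>\<^bsub>X\<^esub> \<beta>) x \<le> indicator (E N) x * vnf (T \<zeta>) x"
          using vnf_uminus[OF c] vnf_smult[OF q(1) T\<zeta>, of N] q(2)[of N]
          by simp (elim AE_mp, auto simp: indicator_def)
      next
        have "E (Suc N) \<subseteq> E N" for N by (auto simp: E_def)
        then show "AE x in M. \<forall>N. indicator (E (Suc N)) x * vnf (T \<zeta>) x \<le> indicator (E N) x * vnf (T \<zeta>) x"
          by (intro AE_I2) (auto simp: indicator_def)
        show "AE x in M. (\<lambda>N. indicator (E N) x * vnf (T \<zeta>) x) \<longlonglongrightarrow> 0"
        proof (rule AE_I2)
          fix x assume x: "x \<in> space M"
          obtain \<kappa> where \<kappa>: "x \<in> A \<kappa>" using Acov[OF x] by blast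
          have "\<exists>N0. \<forall>N\<ge>N0. x \<notin> E N"
          proof (cases "\<kappa> = 0 \<or> \<kappa> = \<infinity>")
            case True
            then show ?thesis using \<kappa> by (auto simp: E_def B_def)
          next
            case False
            then obtain i where "\<kappa> = enat i" "1 \<le> i" by (cases \<kappa>) (auto simp: zero_enat_def Suc_le_eq)
            then show ?thesis using \<kappa> by (intro exI[of _ i]) (auto simp: E_def)
          qed
          then have "\<forall>\<^sub>F N in sequentially. x \<notin> E N" by (simp add: eventually_sequentially)
          then have "\<forall>\<^sub>F N in sequentially. indicator (E N) x * vnf (T \<zeta>) x = 0"
            by eventually_elim simp
          then show "(\<lambda>N. indicator (E N) x * vnf (T \<zeta>) x) \<longlonglongrightarrow> 0" by (rule tendsto_eventually)
        qed
      qed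
      then show "order_null M (\<lambda>N. vec_norm M ip ((\<Oplus>\<^bsub>X\<^esub>k\<in>{1..N}. p (enat k) \<odot>\<^bsub>X\<^esub>
          (\<Oplus>\<^bsub>X\<^esub>n\<in>{1..k}. t (enat k) n)) \<ominus>\<^bsub>X\<^esub> \<beta>))" by (simp add: s_def)
    qed
    \<comment> \<open>The sets \<open>A 0\<close>, \<open>A \<infinity>\<close> and B cover the
      space, and T \<zeta> vanishes on \<open>A 0\<close>.\<close>
    moreover have "T \<zeta> = p \<infinity> \<odot>\<^bsub>X\<^esub> \<alpha> \<oplus>\<^bsub>X\<^esub> \<beta>"
    proof (rule vec_eqI)
      have c: "p \<infinity> \<odot>\<^bsub>X\<^esub> \<alpha> \<in> carrier X" using p \<alpha> by simp
      fix \<theta> assume \<theta>: "\<theta> \<in> carrier X"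
      from ipf_add_left[OF c \<beta> \<theta>] ipf_smult_left[OF p(1) \<alpha> \<theta>, of \<infinity>] ipf_smult_left[OF p(1) T\<zeta> \<theta>, of \<infinity>, folded \<alpha>_def]
        ipf_smult_left[OF b(1) T\<zeta> \<theta>, folded \<beta>_def] p(2)[of \<infinity>] b(2) zero[OF \<zeta>] Cauchy_Schwarz_AE[OF T\<zeta> \<theta>] AE_space
      show "AE x in M. ipf (T \<zeta>) \<theta> x = ipf (p \<infinity> \<odot>\<^bsub>X\<^esub> \<alpha> \<oplus>\<^bsub>X\<^esub> \<beta>) \<theta> x"
      proof eventually_elim
        case (elim x)
        have "x \<in> A 0 \<Longrightarrow> x \<notin> A \<infinity>" using Adis[of x 0 \<infinity>] by auto
        with elim show ?case by (auto simp: indicator_def B_def)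
      qed
    qed (use T\<zeta> p \<alpha> \<beta> in auto)
    ultimately show ?thesis using \<alpha> \<beta> unfolding t_def[abs_def] by blast
  qed
  show ?thesis
  proof (intro exI conjI allI impI ballI)
    show "f k n \<in> (\<lambda>a. p k \<otimes>\<^bsub>Linf M\<^esub> a) ` carrier (Linf M)" for k n
      using l by (auto simp: f_def)
  qed (use part orthonormal p0 decreasing repr in auto)
qed

end
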